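(* Let $0<m<1$, let $\Omega\subset\mathbb{R}^n$ be open and bounded, $T>0$, $\Omega_T=\Omega\times(0,T)$. Let $\psi\in C(\overline{\Omega_T})$ be nonnegative and let $u\in K_\psi(\Omega_T)$ be a continuous, local weak solution to the obstacle problem for the porous medium equation with obstacle $\psi$. Then $u$ is a weak solution to the porous medium equation in the set $\{(x,t)\in\Omega_T:u(x,t)>\psi(x,t)\}$.
   Context: The porous medium equation is $\partial_tu-\Delta(u^m)=0$, $u\ge0$. A measurable $u:\Omega_T\to[0,\infty]$ with $u^m\in L^2_{\rm loc}(0,T;H^1_{\rm loc}(\Omega))\cap L^{1/m}_{\rm loc}(\Omega_T)$ is a weak solution if $\iint_{\Omega_T}(-u\,\partial_t\varphi+\nabla u^m\cdot\nabla\varphi)\,dx\,dt=0$ for all $\varphi\in C_0^\infty(\Omega_T)$; weak solutions in an open subset of $\Omega_T$ are defined analogously, with local integrability in, and test functions compactly supported in, that subset. $K_\psi(\Omega_T)$ is the set of $v$ with $v^m\in L^2(0,T;H^1(\Omega))$, $v\in C([0,T];L^{m+1}(\Omega))$, $v\ge\psi$ a.e. in $\Omega_T$; $K'_\psi(\Omega_T)=\{v\in K_\psi(\Omega_T):\partial_t(v^m)\in L^{\frac{m+1}{m}}(\Omega_T)\}$. For $\eta\in C_0^1(\Omega;\mathbb{R}_{\ge0})$ and $\alpha\in W_0^{1,\infty}((0,T);\mathbb{R}_{\ge0})$ set $$\langle\!\langle\partial_tu,\alpha\eta(v^m-u^m)\rangle\!\rangle:=\iint_{\Omega_T}\eta\Big[\alpha'\big(\tfrac1{m+1}u^{m+1}-uv^m\big)-\alpha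 u\,\partial_tv^m\Big]dx\,dt.$$ $u\in K_\psi(\Omega_T)$ is a local weak solution to the obstacle problem with obstacle $\psi$ if $$\langle\!\langle\partial_tu,\alpha\eta(v^m-u^m)\rangle\!\rangle+\iint_{\Omega_T}\alpha\nabla u^m\cdot\nabla\big(\eta(v^m-u^m)\big)dx\,dt\ge0$$ for all $v\in K'_\psi(\Omega_T)$, all $\eta\in C_0^1(\Omega;\mathbb{R}_{\ge0})$ and all $\alpha\in W_0^{1,\infty}((0,T);\mathbb{R}_{\ge0})$. *)

theory Defs
  imports "HOL-Analysis.Analysis"
begin

text \<open>
  Points of space-time are pairs \<open>(x, t) :: 'a \<times> real\<close>. Functions on a set are total functions
  of which only the values on that set matter. An object that is only determined almost everywhere
  (a weak derivative) enters as a relation between a function and its derivative, so no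
  representative has to be chosen.
\<close>

section \<open>Smooth functions with compact support\<close>

primrec C_k :: "nat \<Rightarrow> ('a::euclidean_space \<Rightarrow> real) \<Rightarrow> bool" where
  "C_k 0 f \<longleftrightarrow> continuous_on UNIV f"
| "C_k (Suc k) f \<longleftrightarrow> (\<forall>x. f differentiable (at x)) \<and>
     (\<forall>i\<in>Basis. C_k k (\<lambda>x. frechet_derivative f (at x) i))"

text \<open>Compactly supported functions on \<open>U\<close> are identified with their extension by zero.\<close>

definition compact_supp_in :: "'a::euclidean_space set \<Rightarrow> ('a \<Rightarrow> real) \<Rightarrow> bool" where
  "compact_supp_in U f \<longleftrightarrow>
     compact (closure {x. f x \<noteq> 0}) \<and> closure {x. f x \<noteq> 0} \<subseteq> U"

definition C1_c :: "'a::euclidean_space set \<Rightarrow> ('a \<Rightarrow> real) set" where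
  "C1_c U = {f. C_k 1 f \<and> compact_supp_in U f}"

definition Cinf_c :: "'a::euclidean_space set \<Rightarrow> ('a \<Rightarrow> real) set" where
  "Cinf_c U = {f. (\<forall>k. C_k k f) \<and> compact_supp_in U f}"

definition grad_x :: "('a::euclidean_space \<times> real \<Rightarrow> real) \<Rightarrow> 'a \<times> real \<Rightarrow> 'a" where
  "grad_x f z = (\<Sum>i\<in>Basis. frechet_derivative f (at z) (i, 0) *\<^sub>R i)"

definition deriv_t :: "('a::euclidean_space \<times> real \<Rightarrow> real) \<Rightarrow> 'a \<times> real \<Rightarrow> real" where
  "deriv_t f z = frechet_derivative f (at z) (0, 1)"


section \<open>Lebesgue and Sobolev spaces\<close>

definition Lp_on :: "real \<Rightarrow> 'a::euclidean_space set \<Rightarrow> ('a \<Rightarrow> 'b::euclidean_space) \<Rightarrow> bool" where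
  "Lp_on p S f \<longleftrightarrow> f \<in> borel_measurable (lebesgue_on S) \<and>
     integrable (lebesgue_on S) (\<lambda>x. norm (f x) powr p)"

definition Lp_norm :: "real \<Rightarrow> 'a::euclidean_space set \<Rightarrow> ('a \<Rightarrow> 'b::euclidean_space) \<Rightarrow> real" where
  "Lp_norm p S f = (integral\<^sup>L (lebesgue_on S) (\<lambda>x. norm (f x) powr p)) powr (1 / p)"

definition Linf_on :: "'a::euclidean_space set \<Rightarrow> ('a \<Rightarrow> real) \<Rightarrow> bool" where
  "Linf_on S f \<longleftrightarrow> f \<in> borel_measurable (lebesgue_on S) \<and>
     (\<exists>C. AE x in lebesgue_on S. \<bar>f x\<bar> \<le> C)"

definition L1_loc :: "'a::euclidean_space set \<Rightarrow> ('a \<Rightarrow> real) \<Rightarrow> bool" where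
  "L1_loc U f \<longleftrightarrow> (\<forall>K. compact K \<and> K \<subseteq> U \<longrightarrow> integrable (lebesgue_on K) f)"

text \<open>\<open>g\<close> is the weak derivative of \<open>f\<close> in direction \<open>e\<close> on the open set \<open>U\<close>.\<close>

definition weak_deriv ::
  "'a::euclidean_space set \<Rightarrow> 'a \<Rightarrow> ('a \<Rightarrow> real) \<Rightarrow> ('a \<Rightarrow> real) \<Rightarrow> bool" where
  "weak_deriv U e f g \<longleftrightarrow> L1_loc U f \<and> L1_loc U g \<and>
     (\<forall>\<phi>\<in>Cinf_c U. integral\<^sup>L (lebesgue_on U) (\<lambda>x. f x * frechet_derivative \<phi> (at x) e)
                  = - integral\<^sup>L (lebesgue_on U) (\<lambda>x. g x * \<phi> x))"

text \<open>\<open>f \<in> H\<^sup>1(\<Omega>)\<close> with weak gradient \<open>G\<close>.\<close>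

definition H1_grad :: "'a::euclidean_space set \<Rightarrow> ('a \<Rightarrow> real) \<Rightarrow> ('a \<Rightarrow> 'a) \<Rightarrow> bool" where
  "H1_grad \<Omega> f G \<longleftrightarrow> Lp_on 2 \<Omega> f \<and> Lp_on 2 \<Omega> G \<and>
     (\<forall>i\<in>Basis. weak_deriv \<Omega> i f (\<lambda>x. G x \<bullet> i))"

text \<open>
  \<open>f \<in> L\<^sup>2(a,b;H\<^sup>1(\<Omega>))\<close> with spatial weak gradient \<open>G\<close>: almost every time slice is in
  \<open>H\<^sup>1(\<Omega>)\<close>, and the squared \<open>H\<^sup>1\<close>-norms of the slices have a finite integral over \<open>(a,b)\<close>, which
  by Tonelli is the square-integrability of \<open>f\<close> and \<open>G\<close> over the cylinder.
\<close>

definition L2H1_grad ::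
  "real \<Rightarrow> real \<Rightarrow> 'a::euclidean_space set \<Rightarrow> ('a \<times> real \<Rightarrow> real) \<Rightarrow> ('a \<times> real \<Rightarrow> 'a) \<Rightarrow> bool" where
  "L2H1_grad a b \<Omega> f G \<longleftrightarrow>
     Lp_on 2 (\<Omega> \<times> {a<..<b}) f \<and> Lp_on 2 (\<Omega> \<times> {a<..<b}) G \<and>
     (AE t in lebesgue_on {a<..<b}. H1_grad \<Omega> (\<lambda>x. f (x, t)) (\<lambda>x. G (x, t)))"

text \<open>
  The local version on an open set \<open>U\<close> of space-time, required on every cylinder compactly contained
  in \<open>U\<close>. For \<open>U = \<Omega> \<times> (0,T)\<close> this is \<open>f \<in> L\<^sup>2\<^sub>l\<^sub>o\<^sub>c(0,T;H\<^sup>1\<^sub>l\<^sub>o\<^sub>c(\<Omega>))\<close>.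
\<close>

definition L2H1_loc_grad ::
  "('a::euclidean_space \<times> real) set \<Rightarrow> ('a \<times> real \<Rightarrow> real) \<Rightarrow> ('a \<times> real \<Rightarrow> 'a) \<Rightarrow> bool" where
  "L2H1_loc_grad U f G \<longleftrightarrow>
     (\<forall>\<Omega>' a b. open \<Omega>' \<and> bounded \<Omega>' \<and> a < b \<and> closure \<Omega>' \<times> {a..b} \<subseteq> U \<longrightarrow> L2H1_grad a b \<Omega>' f G)"

text \<open>
  \<open>v \<in> C([0,T];L\<^sup>p(\<Omega>))\<close>: the map \<open>t \<mapsto> v(\<cdot>,t)\<close>, defined for almost every \<open>t\<close>, has a representative
  \<open>w\<close> that is continuous on the closed interval.
\<close>

definition C_Lp :: "real \<Rightarrow> real \<Rightarrow> 'a::euclidean_space set \<Rightarrow> ('a \<times> real \<Rightarrow> real) \<Rightarrow> bool" where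
  "C_Lp T p \<Omega> v \<longleftrightarrow> (\<exists>w :: real \<Rightarrow> 'a \<Rightarrow> real.
     (\<forall>t\<in>{0..T}. Lp_on p \<Omega> (w t)) \<and>
     (\<forall>s\<in>{0..T}. ((\<lambda>t. Lp_norm p \<Omega> (\<lambda>x. w t x - w s x)) \<longlongrightarrow> 0) (at s within {0..T})) \<and>
     (AE t in lebesgue_on {0<..<T}. AE x in lebesgue_on \<Omega>. v (x, t) = w t x))"

text \<open>
  \<open>\<alpha> \<in> W\<^sub>0\<^sup>1\<^sup>,\<^sup>\<infinity>((0,T);\<real>\<^sub>\<ge>\<^sub>0)\<close> with weak derivative \<open>\<alpha>'\<close>. As usual \<open>\<alpha>\<close> is taken to be the
  continuous representative on \<open>[0,T]\<close>, and the subscript means zero boundary values.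
\<close>

definition W1inf_0_nonneg :: "real \<Rightarrow> (real \<Rightarrow> real) \<Rightarrow> (real \<Rightarrow> real) \<Rightarrow> bool" where
  "W1inf_0_nonneg T \<alpha> \<alpha>' \<longleftrightarrow>
     Linf_on {0<..<T} \<alpha> \<and> Linf_on {0<..<T} \<alpha>' \<and> weak_deriv {0<..<T} 1 \<alpha> \<alpha>' \<and>
     continuous_on {0..T} \<alpha> \<and> \<alpha> 0 = 0 \<and> \<alpha> T = 0 \<and> (\<forall>t\<in>{0..T}. 0 \<le> \<alpha> t)"


section \<open>The porous medium equation and its obstacle problem\<close>

abbreviation cyl :: "'a set \<Rightarrow> real \<Rightarrow> ('a \<times> real) set" where
  "cyl \<Omega> T \<equiv> \<Omega> \<times> {0<..<T}"

text \<open>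
  A weak solution with values in \<open>[0,\<infinity>]\<close> is finite almost everywhere, since \<open>u\<^sup>m\<close> is locally
  integrable, and is represented here by a function with values in \<open>[0,\<infinity>)\<close>.
\<close>

definition PME_weak_solution ::
  "real \<Rightarrow> ('a::euclidean_space \<times> real) set \<Rightarrow> ('a \<times> real \<Rightarrow> real) \<Rightarrow> bool" where
  "PME_weak_solution m U u \<longleftrightarrow>
     open U \<and> u \<in> borel_measurable (lebesgue_on U) \<and> (\<forall>z\<in>U. 0 \<le> u z) \<and>
     (\<forall>K. compact K \<and> K \<subseteq> U \<longrightarrow> Lp_on (1 / m) K (\<lambda>z. u z powr m)) \<and>
     (\<exists>G. L2H1_loc_grad U (\<lambda>z. u z powr m) G \<and>
        (\<forall>\<phi>\<in>Cinf_c U.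
           integral\<^sup>L (lebesgue_on U) (\<lambda>z. - u z * deriv_t \<phi> z + G z \<bullet> grad_x \<phi> z) = 0))"

definition K_psi ::
  "real \<Rightarrow> 'a::euclidean_space set \<Rightarrow> real \<Rightarrow> ('a \<times> real \<Rightarrow> real) \<Rightarrow> ('a \<times> real \<Rightarrow> real) set" where
  "K_psi m \<Omega> T \<psi> = {v.
     v \<in> borel_measurable (lebesgue_on (cyl \<Omega> T)) \<and>
     (\<exists>G. L2H1_grad 0 T \<Omega> (\<lambda>z. v z powr m) G) \<and>
     C_Lp T (m + 1) \<Omega> v \<and>
     (AE z in lebesgue_on (cyl \<Omega> T). \<psi> z \<le> v z)}"

text \<open>\<open>v \<in> K'\<^sub>\<psi>(\<Omega>\<^sub>T)\<close> with \<open>d = \<partial>\<^sub>t(v\<^sup>m)\<close>.\<close>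

definition K_psi'_deriv ::
  "real \<Rightarrow> 'a::euclidean_space set \<Rightarrow> real \<Rightarrow> ('a \<times> real \<Rightarrow> real) \<Rightarrow>
   ('a \<times> real \<Rightarrow> real) \<Rightarrow> ('a \<times> real \<Rightarrow> real) \<Rightarrow> bool" where
  "K_psi'_deriv m \<Omega> T \<psi> v d \<longleftrightarrow> v \<in> K_psi m \<Omega> T \<psi> \<and>
     weak_deriv (cyl \<Omega> T) (0, 1) (\<lambda>z. v z powr m) d \<and>
     Lp_on ((m + 1) / m) (cyl \<Omega> T) d"

text \<open>
  \<open>\<langle>\<langle>\<partial>\<^sub>tu, \<alpha>\<eta>(v\<^sup>m - u\<^sup>m)\<rangle>\<rangle>\<close>, where \<open>\<alpha>'\<close> and \<open>d\<close> stand for the weak derivatives of \<open>\<alpha>\<close> and \<open>v\<^sup>m\<close>.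
\<close>

definition time_term ::
  "real \<Rightarrow> 'a::euclidean_space set \<Rightarrow> real \<Rightarrow> ('a \<times> real \<Rightarrow> real) \<Rightarrow> ('a \<times> real \<Rightarrow> real) \<Rightarrow>
   ('a \<times> real \<Rightarrow> real) \<Rightarrow> ('a \<Rightarrow> real) \<Rightarrow> (real \<Rightarrow> real) \<Rightarrow> (real \<Rightarrow> real) \<Rightarrow> real" where
  "time_term m \<Omega> T u v d \<eta> \<alpha> \<alpha>' = integral\<^sup>L (lebesgue_on (cyl \<Omega> T)) (\<lambda>(x, t).
     \<eta> x * (\<alpha>' t * (1 / (m + 1) * u (x, t) powr (m + 1) - u (x, t) * v (x, t) powr m)
            - \<alpha> t * u (x, t) * d (x, t)))"

text \<open>
  Below, \<open>G\<close> is \<open>\<nabla>u\<^sup>m\<close> and \<open>H\<close> is \<open>\<nabla>(\<eta>(v\<^sup>m - u\<^sup>m))\<close>. Both exist and are unique almost everywhere,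
  so the universal quantification over them and over \<open>d\<close>, \<open>\<alpha>'\<close> only avoids choosing representatives.
\<close>

definition obstacle_local_weak_solution ::
  "real \<Rightarrow> 'a::euclidean_space set \<Rightarrow> real \<Rightarrow> ('a \<times> real \<Rightarrow> real) \<Rightarrow> ('a \<times> real \<Rightarrow> real) \<Rightarrow> bool" where
  "obstacle_local_weak_solution m \<Omega> T \<psi> u \<longleftrightarrow> u \<in> K_psi m \<Omega> T \<psi> \<and>
     (\<forall>v d \<eta> \<alpha> \<alpha>' G H.
        K_psi'_deriv m \<Omega> T \<psi> v d \<longrightarrow>
        \<eta> \<in> C1_c \<Omega> \<and> (\<forall>x. 0 \<le> \<eta> x) \<longrightarrow>
        W1inf_0_nonneg T \<alpha> \<alpha>' \<longrightarrow>
        L2H1_grad 0 T \<Omega> (\<lambda>z. u z powr m) G \<longrightarrow>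
        L2H1_grad 0 T \<Omega> (\<lambda>(x, t). \<eta> x * (v (x, t) powr m - u (x, t) powr m)) H \<longrightarrow>
        0 \<le> time_term m \<Omega> T u v d \<eta> \<alpha> \<alpha>' +
             integral\<^sup>L (lebesgue_on (cyl \<Omega> T)) (\<lambda>(x, t). \<alpha> t * (G (x, t) \<bullet> H (x, t))))"

end

theory Submission
  imports Defs "HOL-Probability.Probability"
begin

text \<open>
  Off the contact set the obstacle leaves room on both sides of \<open>u\<^sup>m\<close>. On the compact support of a
  test function \<open>\<phi>\<close> the gap \<open>u\<^sup>m - \<psi>\<^sup>m\<close> has a positive minimum, so \<open>u\<^sup>m + s\<phi>\<close> stays above \<open>\<psi>\<^sup>m\<close> for
  all small \<open>s\<close> of either sign. If \<open>v\<^sup>m = u\<^sup>m + s\<phi>\<close> were an admissible comparison function, then with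
  cutoffs \<open>\<eta>\<close> and \<open>\<alpha>\<close> that are \<open>1\<close> near the support of \<open>\<phi>\<close> the variational inequality would say
  \<open>s I \<ge> 0\<close>, where \<open>I\<close> is the weak form of the equation tested with \<open>\<phi>\<close>. Both signs of \<open>s\<close> together
  give \<open>I = 0\<close>.

  The difficulty is that \<open>u\<^sup>m\<close> has no time derivative. The comparison function used instead is
  \<open>v\<^sup>m = M + S Z + \<epsilon> + s\<phi>\<close> with \<open>Z = \<beta>(t) \<eta>2(x) (u\<^sup>m - M)\<close>. Here \<open>M\<close> is a constant above \<open>\<psi>\<^sup>m\<close>, \<open>\<beta>\<close>
  and \<open>\<eta>2\<close> are cutoffs that are \<open>1\<close> near the supports of \<open>\<alpha>\<close> and \<open>\<eta>\<close>, and \<open>S\<close> is the Steklov average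
  over the time interval \<open>[t-h, t]\<close>. The function \<open>M + Z\<close> is a convex combination of \<open>u\<^sup>m\<close> and \<open>M\<close>,
  hence lies above \<open>\<psi>\<^sup>m\<close>. As \<open>Z\<close> is continuous with compact support, initial and lateral
  boundary values never enter, and \<open>S Z\<close> differs from \<open>Z\<close> by at most \<open>\<epsilon>\<close> for small \<open>h\<close>. This error is
  compensated by the summand \<open>\<epsilon>\<close>.

  Two one-sided estimates control the terms that contain the average; both move it onto the smooth
  cutoff \<open>\<alpha>\<close>. In the time term, convexity gives
  \<open>u(t) (u\<^sup>m(t) - u\<^sup>m(t-h)) \<ge> m/(m+1) (u\<^sup>m\<^sup>+\<^sup>1(t) - u\<^sup>m\<^sup>+\<^sup>1(t-h))\<close>, and the difference quotient on the right,
  shifted to \<open>\<alpha>\<close>, cancels the terms with \<open>\<alpha>'\<close> up to \<open>O(\<epsilon>)\<close> (\<open>time_integrand_le\<close>, \<open>time_gap_le\<close>). In the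
  gradient term, with \<open>G = \<nabla>u\<^sup>m\<close>, one has \<open>2 G \<bullet> S G \<le> |G|\<^sup>2 + |S G|\<^sup>2\<close> and, by Jensen, \<open>|S G|\<^sup>2 \<le> S |G|\<^sup>2\<close>;
  after the shift only the modulus of continuity of \<open>\<alpha>\<close> remains (\<open>AE_energy_integrand_le\<close>,
  \<open>energy_gap_le\<close>). So it is never necessary to show that \<open>S G\<close> converges to \<open>G\<close> in \<open>L\<^sup>2\<close>. The outcome is
  \<open>0 \<le> s I + \<epsilon> C\<close> with \<open>C\<close> independent of \<open>\<epsilon>\<close> and \<open>h\<close> (\<open>estimate\<close>), hence \<open>0 \<le> s I\<close>.

  The remaining parts provide what the argument needs of analysis: smooth cutoff functions, a calculus
  of weak derivatives, and the fact that averaging in time preserves \<open>L\<^sup>2(0,T;H\<^sup>1(\<Omega>))\<close>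
  (\<open>L2H1_grad_average\<close>). The weak gradient is replaced by a Borel representative first, so that Fubini's
  theorem applies to the product of Borel measures.
\<close>


section \<open>Smooth functions and cutoffs\<close>

lemma C_k_cong:
  assumes "C_k k f" "\<And>x. f x = g x"
  shows "C_k k g"
proof -
  have "f = g" using assms(2) by auto
  with assms(1) show ?thesis by simp
qed

lemma C_k_Suc_imp_C_k: "C_k (Suc k) f \<Longrightarrow> C_k k f"
proof (induction k arbitrary: f)
  case 0
  then show ?case
    by (auto simp: continuous_on_eq_continuous_at intro!: differentiable_imp_continuous_within)
next
  case (Suc k)
  show ?case
    unfolding C_k.simps(2)[of "k"]
  proof (intro conjI ballI allI)
    show "f differentiable (at x)" for x using Suc.prems by simp
    show "C_k k (\<lambda>x. frechet_derivative f (at x) i)" if "i \<in> Basis" for i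
      using Suc.prems that by (intro Suc.IH) (auto simp only: C_k.simps(2))
  qed
qed

lemma C_k_const: "C_k k (\<lambda>x::'a::euclidean_space. c)"
proof (induction k arbitrary: c)
  case (Suc k)
  have "frechet_derivative (\<lambda>x::'a. c) (at x) = (\<lambda>_. 0)" for x
    by (rule frechet_derivative_at[symmetric]) (auto intro!: derivative_eq_intros)
  then show ?case using Suc by simp
qed simp

lemma C_k_add:
  assumes "C_k k f" "C_k k g"
  shows "C_k k (\<lambda>x::'a::euclidean_space. f x + g x)"
  using assms
proof (induction k arbitrary: f g)
  case 0
  then show ?case by (auto intro: continuous_intros)
next
  case (Suc k)
  have d: "f differentiable (at x)" "g differentiable (at x)" for x
    using Suc.prems by auto
  have "frechet_derivative (\<lambda>x. f x + g x) (at x) =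
      (\<lambda>h. frechet_derivative f (at x) h + frechet_derivative g (at x) h)" for x
    using d[of x] by (intro frechet_derivative_at[symmetric] has_derivative_add)
      (auto simp: frechet_derivative_works)
  moreover have "C_k k (\<lambda>x. frechet_derivative f (at x) i + frechet_derivative g (at x) i)"
    if "i \<in> Basis" for i
    using Suc that by auto
  ultimately show ?case using d by (auto intro: differentiable_add)
qed

lemma C_k_mult:
  assumes "C_k k f" "C_k k g"
  shows "C_k k (\<lambda>x::'a::euclidean_space. f x * g x)"
  using assms
proof (induction k arbitrary: f g)
  case 0
  then show ?case by (auto intro: continuous_intros)
next
  case (Suc k)
  have d: "f differentiable (at x)" "g differentiable (at x)" for x
    using Suc.prems by auto
  have "frechet_derivative (\<lambda>x. f x * g x) (at x) =
      (\<lambda>h. f x * frechet_derivative g (at x) h + frechet_derivative f (at x) h * g x)" for x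
    using d[of x] by (intro frechet_derivative_at[symmetric] has_derivative_mult)
      (auto simp: frechet_derivative_works)
  moreover have "C_k k (\<lambda>x. f x * frechet_derivative g (at x) i + frechet_derivative f (at x) i * g x)"
    if "i \<in> Basis" for i
    using Suc.IH Suc.prems[THEN C_k_Suc_imp_C_k] Suc.prems that
    by (intro C_k_add) auto
  ultimately show ?case using d by (auto intro: differentiable_mult)
qed

lemma C_k_prod:
  "(\<And>i. i \<in> I \<Longrightarrow> C_k k (f i)) \<Longrightarrow> C_k k (\<lambda>x::'a::euclidean_space. \<Prod>i\<in>I. f i x)"
  by (induction I rule: infinite_finite_induct) (auto intro: C_k_const C_k_mult)

lemma C_k_inverse:
  assumes "C_k k f" "\<And>x. f x \<noteq> 0"
  shows "C_k k (\<lambda>x::'a::euclidean_space. inverse (f x))"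
  using assms(1)
proof (induction k)
  case 0
  then show ?case using assms(2) by (auto intro: continuous_intros)
next
  case (Suc k)
  have d: "(f has_derivative frechet_derivative f (at x)) (at x)" for x
    using Suc.prems by (auto simp: frechet_derivative_works)
  have d': "((\<lambda>x. inverse (f x)) has_derivative
      (\<lambda>h. (-1 * frechet_derivative f (at x) h) * (inverse (f x) * inverse (f x)))) (at x)" for x
    using Deriv.has_derivative_inverse[OF assms(2) d, of x] by (simp add: mult_ac)
  have "C_k k (\<lambda>x. (-1 * frechet_derivative f (at x) i) * (inverse (f x) * inverse (f x)))"
    if "i \<in> Basis" for i
    using Suc.IH Suc.prems[THEN C_k_Suc_imp_C_k] Suc.prems that
    by (intro C_k_mult C_k_const) auto
  with d' show ?case
    by (auto simp: frechet_derivative_at[OF d', symmetric] differentiable_def)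
qed

lemma C_k_compose_affine_functional:
  fixes a :: "'a::euclidean_space" and f :: "real \<Rightarrow> real"
  assumes "C_k k f"
  shows "C_k k (\<lambda>x. f (a \<bullet> x + b))"
  using assms
proof (induction k arbitrary: f)
  case 0
  then show ?case
    by (auto intro!: continuous_on_compose2[where f="\<lambda>x. a \<bullet> x + b" and g=f] continuous_intros)
next
  case (Suc k)
  let ?f' = "\<lambda>x. frechet_derivative f (at x) 1"
  have lin: "frechet_derivative f (at x) h = h * ?f' x" for x h
  proof -
    have "linear (frechet_derivative f (at x))"
      using Suc.prems by (intro linear_frechet_derivative) auto
    from linear_cmul[OF this, of h 1] show ?thesis by simp
  qed
  have d: "(f has_derivative (\<lambda>h. h * ?f' x)) (at x)" for x
  proof -
    have "frechet_derivative f (at x) = (\<lambda>h. h * ?f' x)" by (rule ext) (rule lin)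
    with Suc.prems show ?thesis by (metis C_k.simps(2) frechet_derivative_works)
  qed
  have d': "((\<lambda>x. f (a \<bullet> x + b)) has_derivative (\<lambda>h. (a \<bullet> h) * ?f' (a \<bullet> x + b))) (at x)" for x
    by (rule has_derivative_compose[where f="\<lambda>x. a \<bullet> x + b" and g=f, OF _ d])
      (auto intro!: derivative_eq_intros)
  have "C_k k (\<lambda>x. (a \<bullet> i) * ?f' (a \<bullet> x + b))" if "i \<in> Basis" for i
    using Suc.prems by (intro C_k_mult C_k_const Suc.IH) auto
  with d' show ?case
    by (auto simp: frechet_derivative_at[OF d', symmetric] differentiable_def)
qed

lemma C_k_if_iterated_derivatives:
  fixes D :: "nat \<Rightarrow> real \<Rightarrow> real"
  assumes "\<And>j x. (D j has_real_derivative D (Suc j) x) (at x)"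
  shows "C_k k (D j)"
proof (induction k arbitrary: j)
  case 0
  then show ?case using assms
    by (auto simp: continuous_on_eq_continuous_at intro!: DERIV_isCont)
next
  case (Suc k)
  have "frechet_derivative (D j) (at x) = (*) (D (Suc j) x)" for x
    using assms[of j x] by (intro frechet_derivative_at[symmetric]) (simp add: has_field_derivative_def)
  moreover have "D j differentiable (at x)" for x
    using assms[of j x] by (auto simp: differentiable_def has_field_derivative_def)
  ultimately show ?case using Suc by simp
qed

text \<open>
  The standard smooth function that vanishes to infinite order at the origin.
\<close>

definition flat_exp :: "real \<Rightarrow> real" where
  "flat_exp x = (if x \<le> 0 then 0 else exp (- (1 / x)))"

text \<open>Each derivative of \<open>flat_exp\<close> on the positive axis is a polynomial in \<open>1/x\<close> times
  \<open>exp (- 1/x)\<close>; the exponential beats every such polynomial at the origin.\<close>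

lemma poly_mult_exp_minus_tendsto_0: "((\<lambda>z::real. poly p z * exp (- z)) \<longlongrightarrow> 0) at_top"
proof -
  have "((\<lambda>z. \<Sum>i\<le>degree p. coeff p i * (z ^ i / exp z)) \<longlongrightarrow> (\<Sum>i\<le>degree p. coeff p i * 0)) at_top"
    by (intro tendsto_sum tendsto_mult tendsto_const tendsto_power_div_exp_0)
  then show ?thesis
    by (simp add: poly_altdef sum_distrib_right exp_minus divide_inverse mult.assoc)
qed

lemma C_k_flat_exp: "C_k k flat_exp"
proof -
  define P :: "nat \<Rightarrow> real poly" where
    "P = rec_nat 1 (\<lambda>_ p. monom 1 2 * (p - pderiv p))"
  have P: "P 0 = 1" "P (Suc j) = monom 1 2 * (P j - pderiv (P j))" for j
    by (simp_all add: P_def)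
  define D where "D = (\<lambda>j x. if x \<le> 0 then 0 else poly (P j) (1 / x) * exp (- (1 / x)))"
  have deriv: "(D j has_real_derivative D (Suc j) x) (at x)" for j x
  proof -
    consider "x < 0" | "x > 0" | "x = 0" by linarith
    then show ?thesis
    proof cases
      case 1
      have "((\<lambda>_. 0) has_real_derivative 0) (at x)" by simp
      moreover have "eventually (\<lambda>y. D j y = 0) (nhds x)"
        using eventually_nhds_in_open[of "{..<0}" x] 1 by (auto elim!: eventually_mono simp: D_def)
      ultimately show ?thesis using 1
        by (subst DERIV_cong_ev[where g="\<lambda>_. 0"]) (auto simp: D_def)
    next
      case 2
      have "((\<lambda>x. poly (P j) (1 / x) * exp (- (1 / x))) has_real_derivative D (Suc j) x) (at x)"
        using 2 by (auto intro!: derivative_eq_intros poly_DERIV[THEN DERIV_chain2]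
            simp: D_def P poly_monom power2_eq_square field_simps)
      moreover have "eventually (\<lambda>y. D j y = poly (P j) (1 / y) * exp (- (1 / y))) (nhds x)"
        using eventually_nhds_in_open[of "{0<..}" x] 2 by (auto elim!: eventually_mono simp: D_def)
      ultimately show ?thesis
        by (subst DERIV_cong_ev[where g="\<lambda>y. poly (P j) (1 / y) * exp (- (1 / y))"]) auto
    next
      case 3
      \<comment> \<open>At the origin the difference quotient of \<open>D j\<close> from the right is again a polynomial in \<open>1/h\<close> times \<open>exp (- 1/h)\<close>.\<close>
      have "((\<lambda>h. D j h / h) \<longlongrightarrow> 0) (at_left 0)"
        by (rule tendsto_eventually) (auto simp: D_def eventually_at_filter)
      moreover have "((\<lambda>h. D j h / h) \<longlongrightarrow> 0) (at_right 0)"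
      proof (rule Lim_transform_eventually)
        show "((\<lambda>h. poly (monom 1 1 * P j) (inverse h) * exp (- (inverse h))) \<longlongrightarrow> 0) (at_right (0::real))"
          by (rule filterlim_compose[OF poly_mult_exp_minus_tendsto_0 filterlim_inverse_at_top_right])
        show "\<forall>\<^sub>F h in at_right 0. poly (monom 1 1 * P j) (inverse h) * exp (- inverse h) = D j h / h"
          unfolding eventually_at_filter
          by (intro always_eventually) (auto simp: D_def poly_monom field_simps)
      qed
      ultimately have "((\<lambda>h. D j h / h) \<longlongrightarrow> 0) (at 0)"
        by (simp add: filterlim_split_at)
      then show ?thesis using 3 by (simp add: DERIV_def) (simp add: D_def)
    qed
  qed
  have "D 0 = flat_exp" by (auto simp: D_def P flat_exp_def)
  with C_k_if_iterated_derivatives[of D k 0, OF deriv] show ?thesis by simp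
qed

definition smooth_step :: "real \<Rightarrow> real" where
  "smooth_step x = flat_exp x * inverse (flat_exp x + flat_exp (1 - x))"

lemma smooth_step_denominator_pos: "flat_exp x + flat_exp (1 - x) > 0"
  by (auto simp: flat_exp_def add_pos_pos)

lemma smooth_step_simps:
  "x \<le> 0 \<Longrightarrow> smooth_step x = 0" "x \<ge> 1 \<Longrightarrow> smooth_step x = 1"
  "0 \<le> smooth_step x" "smooth_step x \<le> 1"
proof -
  have nn: "0 \<le> flat_exp y" for y by (simp add: flat_exp_def)
  show "x \<le> 0 \<Longrightarrow> smooth_step x = 0" "x \<ge> 1 \<Longrightarrow> smooth_step x = 1"
    by (auto simp: smooth_step_def flat_exp_def)
  show "0 \<le> smooth_step x" using nn smooth_step_denominator_pos[of x]
    by (simp add: smooth_step_def)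
  show "smooth_step x \<le> 1" using nn[of "1-x"] smooth_step_denominator_pos[of x]
    by (simp add: smooth_step_def field_simps)
qed

lemma C_k_smooth_step: "C_k k smooth_step"
proof -
  have 1: "C_k k (\<lambda>x. flat_exp (1 - x))"
    by (rule C_k_cong[OF C_k_compose_affine_functional[OF C_k_flat_exp, of k "-1" 1]]) simp
  show ?thesis unfolding smooth_step_def[abs_def] using smooth_step_denominator_pos
    by (intro C_k_mult C_k_inverse C_k_add C_k_flat_exp 1) (metis less_irrefl)
qed

text \<open>
  A product of one-dimensional profiles: it is \<open>1\<close> where every coordinate is within \<open>r\<close> of that of \<open>c\<close>
  and \<open>0\<close> where some coordinate is at distance at least \<open>2 r\<close>.
\<close>

definition cube_cutoff :: "'a::euclidean_space \<Rightarrow> real \<Rightarrow> 'a \<Rightarrow> real" where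
  "cube_cutoff c r x = (\<Prod>i\<in>Basis. smooth_step (2 - ((x - c) \<bullet> i) / r) * smooth_step (2 + ((x - c) \<bullet> i) / r))"

lemma C_k_cube_cutoff: "C_k k (cube_cutoff c r)"
proof -
  have 1: "C_k k (\<lambda>x. smooth_step (2 - ((x - c) \<bullet> i) / r))" for i
    by (rule C_k_cong[OF C_k_compose_affine_functional[OF C_k_smooth_step, of k "(-1 / r) *\<^sub>R i" "2 + (c \<bullet> i) / r"]])
      (auto simp: inner_diff_left inner_diff_right inner_commute diff_divide_distrib algebra_simps)
  have 2: "C_k k (\<lambda>x. smooth_step (2 + ((x - c) \<bullet> i) / r))" for i
    by (rule C_k_cong[OF C_k_compose_affine_functional[OF C_k_smooth_step, of k "(1 / r) *\<^sub>R i" "2 - (c \<bullet> i) / r"]])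
      (auto simp: inner_diff_left inner_diff_right inner_commute diff_divide_distrib algebra_simps)
  show ?thesis unfolding cube_cutoff_def[abs_def] by (intro C_k_prod C_k_mult 1 2)
qed

lemma cube_cutoff_bounds: "0 \<le> cube_cutoff c r x" "cube_cutoff c r x \<le> 1"
  unfolding cube_cutoff_def
  by (auto intro!: prod_nonneg prod_le_1 mult_nonneg_nonneg mult_le_one smooth_step_simps)

lemma cube_cutoff_eq_1:
  assumes "x \<in> ball c r"
  shows "cube_cutoff c r x = 1"
proof -
  have "0 < r" using assms by (metis dist_not_less_zero mem_ball order_less_le_trans not_less)
  have "\<bar>(x - c) \<bullet> i\<bar> \<le> r" if "i \<in> Basis" for i
    using Basis_le_norm[OF that, of "x - c"] assms by (auto simp: dist_norm norm_minus_commute)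
  then have "\<bar>((x - c) \<bullet> i) / r\<bar> \<le> 1" if "i \<in> Basis" for i
    using that \<open>0 < r\<close> by (simp add: field_simps)
  note le1 = this
  show ?thesis unfolding cube_cutoff_def
  proof (intro prod.neutral ballI)
    fix i :: 'a assume "i \<in> Basis"
    then have "\<bar>((x - c) \<bullet> i) / r\<bar> \<le> 1" by (rule le1)
    then have "2 - ((x - c) \<bullet> i) / r \<ge> 1" "2 + ((x - c) \<bullet> i) / r \<ge> 1" by linarith+
    then show "smooth_step (2 - ((x - c) \<bullet> i) / r) * smooth_step (2 + ((x - c) \<bullet> i) / r) = 1"
      by (simp add: smooth_step_simps)
  qed
qed

lemma cube_cutoff_nonzero_imp:
  fixes x :: "'a::euclidean_space"
  assumes "cube_cutoff c r x \<noteq> 0" "0 < r"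
  shows "x \<in> cball c (2 * r * DIM('a))"
proof -
  have "\<bar>(x - c) \<bullet> i\<bar> \<le> 2 * r" if "i \<in> Basis" for i
  proof (rule ccontr)
    assume "\<not> \<bar>(x - c) \<bullet> i\<bar> \<le> 2 * r"
    then have "((x - c) \<bullet> i) / r > 2 \<or> ((x - c) \<bullet> i) / r < -2"
      using \<open>0 < r\<close> by (auto simp: field_simps)
    then have "smooth_step (2 - ((x - c) \<bullet> i) / r) * smooth_step (2 + ((x - c) \<bullet> i) / r) = 0"
      by (auto simp: smooth_step_simps)
    with that have "cube_cutoff c r x = 0"
      unfolding cube_cutoff_def by (intro prod_zero) auto
    with assms show False by simp
  qed
  then have "norm (x - c) \<le> (\<Sum>i\<in>(Basis::'a set). 2 * r)"
    by (intro order.trans[OF norm_le_l1] sum_mono) auto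
  then show ?thesis by (simp add: dist_norm norm_minus_commute mult_ac)
qed

text \<open>
  \<open>K\<close> is covered by finitely many balls on which a cube cutoff is \<open>1\<close>. If \<open>b\<^sub>c\<close> are these cutoffs, then
  \<open>1 - (\<Prod>c. 1 - b\<^sub>c)\<close> is \<open>1\<close> as soon as one of them is, and \<open>0\<close> where all of them vanish.
\<close>

lemma smooth_cutoff:
  fixes K U :: "'a::euclidean_space set"
  assumes "compact K" "open U" "K \<subseteq> U"
  obtains \<rho> V where "\<rho> \<in> Cinf_c U" "\<And>x. 0 \<le> \<rho> x" "\<And>x. \<rho> x \<le> 1"
    "open V" "K \<subseteq> V" "\<And>x. x \<in> V \<Longrightarrow> \<rho> x = 1"
proof -
  \<comment> \<open>A cube of half side \<open>2 r\<close> lies in the ball of radius \<open>2 r DIM('a)\<close>.\<close>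
  have "\<exists>r>0::real. cball x (2 * r * DIM('a)) \<subseteq> U" if "x \<in> K" for x
  proof -
    have "x \<in> U" using that assms(3) by blast
    from bspec[OF iffD1[OF open_contains_cball assms(2)] this]
    obtain e where e: "e > 0" "cball x e \<subseteq> U" by blast
    define N where "N = real DIM('a)"
    have "N > 0" by (simp add: N_def)
    have "2 * (e / (2 * N)) * N = e" using \<open>N > 0\<close> by (simp add: field_simps)
    moreover have "e / (2 * N) > 0" using e \<open>N > 0\<close> by simp
    ultimately show ?thesis unfolding N_def[symmetric] using e(2) by metis
  qed
  then obtain r :: "'a \<Rightarrow> real" where r: "\<And>x. x \<in> K \<Longrightarrow> r x > 0" "\<And>x. x \<in> K \<Longrightarrow> cball x (2 * r x * DIM('a)) \<subseteq> U"
    by metis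
  obtain C where C: "C \<subseteq> K" "finite C" "K \<subseteq> (\<Union>c\<in>C. ball c (r c))"
  proof (rule compactE_image[OF assms(1), of K "\<lambda>c. ball c (r c)"])
    show "K \<subseteq> (\<Union>c\<in>K. ball c (r c))" using r(1) by (auto intro!: bexI)
  qed auto
  define \<rho> where "\<rho> = (\<lambda>x. 1 + (-1) * (\<Prod>c\<in>C. 1 + (-1) * cube_cutoff c (r c) x))"
  define L where "L = (\<Union>c\<in>C. cball c (2 * r c * DIM('a)))"
  have L: "compact L" "L \<subseteq> U"
    unfolding L_def by (rule compact_UN[OF C(2)], simp) (rule UN_least, use C(1) r(2) in blast)
  have nz: "{x. \<rho> x \<noteq> 0} \<subseteq> L"
  proof
    fix x assume "x \<in> {x. \<rho> x \<noteq> 0}"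
    then have "(\<Prod>c\<in>C. 1 + (-1) * cube_cutoff c (r c) x) \<noteq> 1" by (auto simp: \<rho>_def)
    then obtain c where "c \<in> C" "cube_cutoff c (r c) x \<noteq> 0"
      by (metis (no_types, lifting) add.right_neutral mult_zero_right prod.neutral)
    then show "x \<in> L" using cube_cutoff_nonzero_imp[of c "r c" x] C r(1) by (auto simp: L_def)
  qed
  have clos: "closure {x. \<rho> x \<noteq> 0} \<subseteq> L"
    using L(1) nz by (simp add: closure_minimal compact_imp_closed)
  have "compact (closure {x. \<rho> x \<noteq> 0})"
    using clos L(1) compact_closure bounded_subset compact_imp_bounded nz by blast
  moreover have "C_k k \<rho>" for k unfolding \<rho>_def
    by (intro C_k_add C_k_const C_k_mult C_k_prod C_k_cube_cutoff)
  ultimately have "\<rho> \<in> Cinf_c U" using clos L by (auto simp: Cinf_c_def compact_supp_in_def)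
  moreover have "0 \<le> \<rho> x" "\<rho> x \<le> 1" for x
  proof -
    have "0 \<le> (\<Prod>c\<in>C. 1 + (-1) * cube_cutoff c (r c) x)"
      using cube_cutoff_bounds by (intro prod_nonneg) (auto simp: )
    moreover have "(\<Prod>c\<in>C. 1 + (-1) * cube_cutoff c (r c) x) \<le> 1"
      using cube_cutoff_bounds by (intro prod_le_1) (auto simp: )
    ultimately show "0 \<le> \<rho> x" "\<rho> x \<le> 1" by (auto simp: \<rho>_def)
  qed
  moreover have "\<rho> x = 1" if "x \<in> (\<Union>c\<in>C. ball c (r c))" for x
  proof -
    from that obtain c where "c \<in> C" "x \<in> ball c (r c)" by auto
    then have "(\<Prod>c\<in>C. 1 + (-1) * cube_cutoff c (r c) x) = 0"
      using C(2) cube_cutoff_eq_1[of x c "r c"] by (intro prod_zero) auto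
    then show ?thesis by (simp add: \<rho>_def)
  qed
  ultimately show thesis using C(3) by (intro that[of \<rho> "\<Union>c\<in>C. ball c (r c)"]) auto
qed


section \<open>Borel functions and Lebesgue measure on a subset\<close>

lemma borel_imp_lebesgue_on: "f \<in> borel_measurable borel \<Longrightarrow> f \<in> borel_measurable (lebesgue_on S)"
  by (intro measurable_restrict_space1 measurable_completion) simp

lemma integral_lebesgue_on_borel:
  fixes f :: "'a::euclidean_space \<Rightarrow> 'b::{banach, second_countable_topology}"
  assumes "f \<in> borel_measurable borel" "S \<in> sets borel"
  shows "integral\<^sup>L (lebesgue_on S) f = (LBINT x. indicator S x *\<^sub>R f x)"
  using assms by (subst integral_restrict_space) (auto intro!: integral_completion)

lemma integrable_lebesgue_on_borel:
  fixes f :: "'a::euclidean_space \<Rightarrow> 'b::{banach, second_countable_topology}"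
  assumes "f \<in> borel_measurable borel" "S \<in> sets borel"
  shows "integrable (lebesgue_on S) f \<longleftrightarrow> integrable lborel (\<lambda>x. indicator S x *\<^sub>R f x)"
  using assms by (subst integrable_restrict_space) (auto intro!: integrable_completion)

lemma lebesgue_on_zero_outside:
  fixes g :: "'a::euclidean_space \<Rightarrow> real"
  assumes "g \<in> borel_measurable borel" "S \<in> sets borel" "\<And>x. x \<notin> S \<Longrightarrow> g x = 0"
  shows "integral\<^sup>L (lebesgue_on S) g = integral\<^sup>L lborel g"
    and "integrable (lebesgue_on S) g \<longleftrightarrow> integrable lborel g"
proof -
  have "indicator S x *\<^sub>R g x = g x" for x using assms(3)[of x] by (cases "x \<in> S") auto
  then show "integral\<^sup>L (lebesgue_on S) g = integral\<^sup>L lborel g"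
    "integrable (lebesgue_on S) g \<longleftrightarrow> integrable lborel g"
    using assms by (simp_all add: integral_lebesgue_on_borel integrable_lebesgue_on_borel del: real_scaleR_def)
qed

lemma measurable_lebesgue_on_empty: "f \<in> borel_measurable (lebesgue_on {})"
  by (auto simp: measurable_def)

lemma integrable_bounded_times:
  fixes f k :: "'a \<Rightarrow> real"
  assumes "integrable M f" "k \<in> borel_measurable M" "\<And>x. \<bar>k x\<bar> \<le> B"
  shows "integrable M (\<lambda>x. k x * f x)"
proof (rule Bochner_Integration.integrable_bound[OF integrable_mult_right[OF assms(1), of B]])
  show "AE x in M. norm (k x * f x) \<le> norm (B * f x)"
  proof (intro AE_I2)
    fix x
    have "\<bar>k x\<bar> \<le> \<bar>B\<bar>" using assms(3)[of x] by linarith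
    then show "norm (k x * f x) \<le> norm (B * f x)" by (simp add: abs_mult mult_right_mono)
  qed
  show "(\<lambda>x. k x * f x) \<in> borel_measurable M" using assms by (intro borel_measurable_times) auto
qed

lemma AE_lebesgue_on_iff:
  assumes "S \<in> sets borel"
  shows "(AE x in lebesgue_on S. P x) \<longleftrightarrow> (AE x in lborel. x \<in> S \<longrightarrow> P x)"
  using assms by (subst AE_restrict_space_iff) (auto simp: AE_completion_iff)

lemma lebesgue_sets_compact: "compact K \<Longrightarrow> K \<in> sets lebesgue"
  using lmeasurable_compact by blast

lemma lebesgue_sets_open: "open U \<Longrightarrow> U \<in> sets lebesgue"
  using lmeasurable_open borel_open sets_completionI_sets by fastforce

lemma lborel_integral_translation:
  fixes f :: "'a::euclidean_space \<Rightarrow> 'b::{banach, second_countable_topology}"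
  assumes "f \<in> borel_measurable borel"
  shows "(LBINT x. f (c + x)) = (LBINT x. f x)"
proof -
  have "(LBINT x. f x) = (\<integral>x. f x \<partial>distr lborel borel ((+) c))" by (simp add: lborel_distr_plus)
  also have "\<dots> = (LBINT x. f (c + x))" using assms by (subst integral_distr) auto
  finally show ?thesis ..
qed

lemma lborel_integrable_translation:
  fixes f :: "'a::euclidean_space \<Rightarrow> 'b::{banach, second_countable_topology}"
  assumes "integrable lborel f"
  shows "integrable lborel (\<lambda>x. f (c + x))"
proof -
  have "integrable (distr lborel borel ((+) c)) f" using assms by (simp add: lborel_distr_plus)
  then show ?thesis using assms by (subst (asm) integrable_distr_eq) auto
qed

lemma integrable_if_continuous_compact_support:
  fixes f :: "'a::euclidean_space \<Rightarrow> 'b::{banach, second_countable_topology}"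
  assumes "continuous_on UNIV f" "compact K" "\<And>x. x \<notin> K \<Longrightarrow> f x = 0"
  shows "integrable lborel f"
proof -
  have "integrable lborel (\<lambda>x. indicator K x *\<^sub>R f x)"
    using assms by (intro borel_integrable_compact) (auto intro: continuous_on_subset)
  moreover have "(\<lambda>x. indicator K x *\<^sub>R f x) = f" using assms(3) by (auto simp: indicator_def)
  ultimately show ?thesis by simp
qed

lemma bounded_if_continuous_compact_support:
  fixes f :: "'a::euclidean_space \<Rightarrow> 'b::real_normed_vector"
  assumes "continuous_on UNIV f" "compact K" "\<And>x. x \<notin> K \<Longrightarrow> f x = 0"
  obtains B where "\<And>x. norm (f x) \<le> B"
proof -
  have "bounded (f ` K)" using assms
    by (intro compact_imp_bounded compact_continuous_image) (auto intro: continuous_on_subset)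
  then obtain B where B: "\<And>y. y \<in> K \<Longrightarrow> norm (f y) \<le> B" by (auto simp: bounded_iff)
  have "norm (f x) \<le> max B 0" for x using B[of x] assms(3)[of x] by (cases "x \<in> K") auto
  then show thesis by (rule that)
qed


section \<open>Integration by parts along a line\<close>

text \<open>\<open>d\<close> is the derivative of \<open>f\<close> in direction \<open>e\<close>, with nothing required of the other directions.\<close>

definition has_line_deriv ::
  "('a::real_normed_vector \<Rightarrow> real) \<Rightarrow> 'a \<Rightarrow> ('a \<Rightarrow> real) \<Rightarrow> bool" where
  "has_line_deriv f e d \<longleftrightarrow> (\<forall>x. ((\<lambda>s. f (x + s *\<^sub>R e)) has_real_derivative d x) (at 0))"

text \<open>
  Only the value of the derivative at the base point enters the definition; along a line it can be read
  at every parameter.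
\<close>

lemma has_line_deriv_at:
  assumes "has_line_deriv f e d"
  shows "((\<lambda>s. f (x + s *\<^sub>R e)) has_real_derivative d (x + t *\<^sub>R e)) (at t)"
proof -
  have "((\<lambda>s. f ((x + t *\<^sub>R e) + s *\<^sub>R e)) has_real_derivative d (x + t *\<^sub>R e)) (at 0)"
    using assms unfolding has_line_deriv_def by blast
  then show ?thesis using DERIV_shift[of "\<lambda>s. f (x + s *\<^sub>R e)" "d (x + t *\<^sub>R e)" 0 t]
    by (simp add: algebra_simps)
qed

lemma has_line_deriv_frechet:
  assumes "\<And>x. f differentiable (at x)"
  shows "has_line_deriv f e (\<lambda>x. frechet_derivative f (at x) e)"
  unfolding has_line_deriv_def
proof
  fix x
  let ?D = "frechet_derivative f (at x)"
  have D: "(f has_derivative ?D) (at x)" using assms frechet_derivative_works by blast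
  have "((\<lambda>s. f (x + s *\<^sub>R e)) has_derivative (\<lambda>s. ?D (s *\<^sub>R e))) (at 0)"
    by (rule has_derivative_compose[where f="\<lambda>s. x + s *\<^sub>R e" and g=f])
      (use D in \<open>auto intro!: derivative_eq_intros\<close>)
  moreover have "?D (s *\<^sub>R e) = s * ?D e" for s
    using linear_cmul[OF has_derivative_linear[OF D]] by simp
  ultimately show "((\<lambda>s. f (x + s *\<^sub>R e)) has_real_derivative ?D e) (at 0)"
    by (simp add: has_field_derivative_def mult_commute_abs)
qed

lemma has_line_deriv_mult:
  assumes "has_line_deriv f e f'" "has_line_deriv g e g'"
  shows "has_line_deriv (\<lambda>x. f x * g x) e (\<lambda>x. f' x * g x + f x * g' x)"
  unfolding has_line_deriv_def
proof
  fix x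
  show "((\<lambda>s. f (x + s *\<^sub>R e) * g (x + s *\<^sub>R e)) has_real_derivative (f' x * g x + f x * g' x)) (at 0)"
    using DERIV_mult[OF assms[unfolded has_line_deriv_def, THEN spec[of _ x]]]
    by (simp add: algebra_simps)
qed

lemma line_deriv_zero_off_support:
  assumes "has_line_deriv f e d" "closed K" "\<And>x. x \<notin> K \<Longrightarrow> f x = 0" "x \<notin> K"
  shows "d x = 0"
proof -
  have "\<forall>\<^sub>F s in nhds (0::real). x + s *\<^sub>R e \<in> - K"
  proof (rule topological_tendstoD)
    show "((\<lambda>s. x + s *\<^sub>R e) \<longlongrightarrow> x + 0 *\<^sub>R e) (nhds 0)"
      by (intro tendsto_add tendsto_scaleR tendsto_const filterlim_ident)
  qed (use assms in auto)
  then have "\<forall>\<^sub>F s in nhds (0::real). f (x + s *\<^sub>R e) = 0"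
    by eventually_elim (use assms(3) in auto)
  then have "((\<lambda>s. f (x + s *\<^sub>R e)) has_real_derivative 0) (at 0)"
    by (subst DERIV_cong_ev[where g="\<lambda>_. 0"]) auto
  with assms(1) show ?thesis unfolding has_line_deriv_def by (blast intro: DERIV_unique)
qed

text \<open>
  Translation invariance makes the integral of every difference quotient vanish, and the quotients
  converge boundedly to the derivative. This avoids splitting off the direction \<open>e\<close> as a coordinate.
\<close>

lemma integral_line_deriv_eq_0:
  fixes f :: "'a::euclidean_space \<Rightarrow> real"
  assumes "continuous_on UNIV f" "continuous_on UNIV d" "has_line_deriv f e d"
    and "compact K" "\<And>x. x \<notin> K \<Longrightarrow> f x = 0"
  shows "(LBINT x. d x) = 0"
proof -
  have d0: "d x = 0" if "x \<notin> K" for x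
    using line_deriv_zero_off_support[OF assms(3) compact_imp_closed[OF assms(4)]] assms(5) that by auto
  obtain B where B: "\<And>x. norm (d x) \<le> B"
    using bounded_if_continuous_compact_support[OF assms(2,4) d0] by blast
  define h where "h = (\<lambda>n. inverse (real (Suc n)))"
  have h: "0 < h n" "h n \<le> 1" for n by (auto simp: h_def field_simps)
  have h0: "filterlim h (at 0) sequentially"
    using LIMSEQ_inverse_real_of_nat by (auto simp: filterlim_at h_def)
  define q where "q = (\<lambda>n x. (f (x + h n *\<^sub>R e) - f x) / h n)"
  define K' where "K' = (\<lambda>(x, s). x - s *\<^sub>R e) ` (K \<times> {0..1::real})"
  have K': "compact K'" unfolding K'_def
    by (intro compact_continuous_image compact_Times assms(4) compact_Icc)
      (auto simp: case_prod_beta intro!: continuous_intros)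
  have lip: "\<bar>q n x\<bar> \<le> B" for n x
  proof -
    have "\<exists>z. z > 0 \<and> z < h n \<and> f (x + h n *\<^sub>R e) - f (x + 0 *\<^sub>R e) = (h n - 0) * d (x + z *\<^sub>R e)"
      using h(1) has_line_deriv_at[OF assms(3)] by (intro MVT2) auto
    then obtain z where "q n x = d (x + z *\<^sub>R e)" using h(1)[of n] by (auto simp: q_def)
    with B show ?thesis by auto
  qed
  have q_zero: "q n x = 0" if "x \<notin> K'" for n x
  proof -
    have "x + h n *\<^sub>R e \<notin> K"
      using that h[of n] by (force simp: K'_def image_iff)
    moreover have "x \<notin> K" using that by (force simp: K'_def image_iff)
    ultimately show ?thesis using assms(5) by (simp add: q_def)
  qed
  have f_meas: "f \<in> borel_measurable borel" using assms(1) by (rule borel_measurable_continuous_onI)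
  have f_int: "integrable lborel f"
    by (rule integrable_if_continuous_compact_support[OF assms(1,4,5)])
  have q_int: "(LBINT x. q n x) = 0" for n
  proof -
    have "(LBINT x. f (x + h n *\<^sub>R e) - f x) = 0"
      using lborel_integral_translation[OF f_meas, of "h n *\<^sub>R e"]
        lborel_integrable_translation[OF f_int, of "h n *\<^sub>R e"] f_int
      by (simp add: add.commute)
    then show ?thesis by (simp add: q_def)
  qed
  have "(\<lambda>n. \<integral>x. q n x \<partial>lborel) \<longlonglongrightarrow> (LBINT x. d x)"
  proof (rule integral_dominated_convergence[where w="\<lambda>x. indicator K' x *\<^sub>R B"])
    show "integrable lborel (\<lambda>x. indicator K' x *\<^sub>R B)"
      using K' by (intro borel_integrable_compact) auto
    show "AE x in lborel. (\<lambda>n. q n x) \<longlonglongrightarrow> d x"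
    proof (rule AE_I2)
      fix x
      have "((\<lambda>s. (f (x + s *\<^sub>R e) - f x) / s) \<longlongrightarrow> d x) (at 0)"
        using assms(3) unfolding has_line_deriv_def DERIV_def by (simp add: algebra_simps)
      from filterlim_compose[OF this h0] show "(\<lambda>n. q n x) \<longlonglongrightarrow> d x" by (simp add: q_def)
    qed
    show "AE x in lborel. norm (q n x) \<le> indicator K' x *\<^sub>R B" for n
      using lip q_zero by (intro AE_I2) (auto simp: indicator_def)
    show "d \<in> borel_measurable lborel" using assms(2) by (simp add: borel_measurable_continuous_onI)
    show "q n \<in> borel_measurable lborel" for n
      unfolding q_def using f_meas by measurable
  qed
  then have "(\<lambda>n. 0) \<longlonglongrightarrow> (LBINT x. d x)" by (simp only: q_int)
  from LIMSEQ_unique[OF this tendsto_const] show ?thesis .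
qed

lemma Cinf_c_facts:
  assumes "\<phi> \<in> Cinf_c U"
  shows "\<And>x. \<phi> differentiable (at x)" "continuous_on UNIV \<phi>" "\<And>k. C_k k \<phi>"
    "\<And>i. i \<in> Basis \<Longrightarrow> continuous_on UNIV (\<lambda>x. frechet_derivative \<phi> (at x) i)"
proof -
  show C: "\<And>k. C_k k \<phi>" using assms by (simp add: Cinf_c_def)
  show "\<And>x. \<phi> differentiable (at x)" using C[of 1] by simp
  show "continuous_on UNIV \<phi>" using C[of 0] by simp
  show "continuous_on UNIV (\<lambda>x. frechet_derivative \<phi> (at x) i)" if "i \<in> Basis" for i
    using C[of 1] that by simp
qed

lemma Cinf_c_support:
  assumes "\<phi> \<in> Cinf_c U"
  obtains K where "compact K" "K \<subseteq> U" "\<And>x. x \<notin> K \<Longrightarrow> \<phi> x = 0"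
    "\<And>x e. x \<notin> K \<Longrightarrow> frechet_derivative \<phi> (at x) e = 0"
proof
  let ?K = "closure {x. \<phi> x \<noteq> 0}"
  show "compact ?K" "?K \<subseteq> U" using assms by (auto simp: Cinf_c_def compact_supp_in_def)
  show z: "\<phi> x = 0" if "x \<notin> ?K" for x using that subsetD[OF closure_subset, of x "{x. \<phi> x \<noteq> 0}"] by auto
  show "frechet_derivative \<phi> (at x) e = 0" if "x \<notin> ?K" for x e
    by (rule line_deriv_zero_off_support[OF has_line_deriv_frechet closed_closure z that])
      (rule Cinf_c_facts(1)[OF assms])
qed

lemma Cinf_c_mono: "\<phi> \<in> Cinf_c U \<Longrightarrow> U \<subseteq> V \<Longrightarrow> \<phi> \<in> Cinf_c V"
  by (auto simp: Cinf_c_def compact_supp_in_def)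

lemma Cinf_c_zero_outside:
  assumes "\<phi> \<in> Cinf_c U" "x \<notin> U"
  shows "\<phi> x = 0" "frechet_derivative \<phi> (at x) e = 0"
  using assms by (auto elim!: Cinf_c_support)

lemma Cinf_c_mult:
  assumes "\<And>k. C_k k \<eta>" "\<zeta> \<in> Cinf_c U"
  shows "(\<lambda>x. \<eta> x * \<zeta> x) \<in> Cinf_c U"
proof -
  have "closure {x. \<eta> x * \<zeta> x \<noteq> 0} \<subseteq> closure {x. \<zeta> x \<noteq> 0}" by (intro closure_mono) auto
  moreover have "compact (closure {x. \<zeta> x \<noteq> 0})" "closure {x. \<zeta> x \<noteq> 0} \<subseteq> U"
    using assms(2) by (auto simp: Cinf_c_def compact_supp_in_def)
  ultimately have "compact_supp_in U (\<lambda>x. \<eta> x * \<zeta> x)"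
    unfolding compact_supp_in_def compact_eq_bounded_closed
    using bounded_subset closed_closure subset_trans by blast
  moreover have "C_k k (\<lambda>x. \<eta> x * \<zeta> x)" for k
    using assms by (intro C_k_mult) (auto simp: Cinf_c_def)
  ultimately show ?thesis by (simp add: Cinf_c_def)
qed

lemma frechet_derivative_mult_apply:
  fixes f g :: "'a::real_normed_vector \<Rightarrow> real"
  assumes "f differentiable (at x)" "g differentiable (at x)"
  shows "frechet_derivative (\<lambda>x. f x * g x) (at x) e =
    f x * frechet_derivative g (at x) e + frechet_derivative f (at x) e * g x"
proof -
  have "((\<lambda>x. f x * g x) has_derivative
      (\<lambda>h. f x * frechet_derivative g (at x) h + frechet_derivative f (at x) h * g x)) (at x)"
    using assms by (intro has_derivative_mult) (auto simp: frechet_derivative_works)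
  from frechet_derivative_at[OF this] show ?thesis by metis
qed


section \<open>Calculus of weak derivatives\<close>

text \<open>
  Every integral in the definition of a weak derivative pairs a locally integrable function with a
  continuous one of compact support.
\<close>

lemma L1_loc_times_compact_support:
  assumes "L1_loc U f" "open U" "continuous_on UNIV k" "compact K" "K \<subseteq> U" "\<And>x. x \<notin> K \<Longrightarrow> k x = 0"
  shows "integrable (lebesgue_on U) (\<lambda>x. f x * k x)"
proof -
  obtain B where B: "\<And>x. norm (k x) \<le> B"
    using bounded_if_continuous_compact_support[OF assms(3,4,6)] by blast
  have kB: "k \<in> borel_measurable lebesgue"
    using borel_measurable_continuous_onI[OF assms(3)] by (intro measurable_completion) simp
  have Ks: "K \<in> sets lebesgue" "U \<in> sets lebesgue" using assms
    by (auto intro: lebesgue_sets_compact lebesgue_sets_open)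
  have i: "integrable lebesgue (\<lambda>x. indicator K x *\<^sub>R f x)"
    using assms(1,4,5) Ks by (auto simp: L1_loc_def integrable_restrict_space)
  have "integrable lebesgue (\<lambda>x. k x * (indicator K x *\<^sub>R f x))"
    using B by (intro integrable_bounded_times[OF i kB]) auto
  moreover have "(\<lambda>x. k x * (indicator K x *\<^sub>R f x)) = (\<lambda>x. indicator U x *\<^sub>R (f x * k x))"
    using assms(5,6) by (auto simp: indicator_def fun_eq_iff)
  ultimately show ?thesis using Ks by (simp add: integrable_restrict_space)
qed

lemma L1_loc_times_continuous:
  assumes "L1_loc U f" "open U" "continuous_on UNIV k"
  shows "L1_loc U (\<lambda>x. k x * f x)"
  unfolding L1_loc_def
proof (intro allI impI, elim conjE)
  fix K assume K: "compact K" "K \<subseteq> U"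
  obtain \<rho> V where \<rho>: "\<rho> \<in> Cinf_c U" "K \<subseteq> V" "\<And>x. x \<in> V \<Longrightarrow> \<rho> x = 1"
    by (rule smooth_cutoff[OF K(1) assms(2) K(2)]) blast
  obtain L where L: "compact L" "L \<subseteq> U" "\<And>x. x \<notin> L \<Longrightarrow> \<rho> x = 0"
    by (rule Cinf_c_support[OF \<rho>(1)]) blast
  have "integrable (lebesgue_on U) (\<lambda>x. f x * (k x * \<rho> x))"
    by (rule L1_loc_times_compact_support[OF assms(1,2) _ L(1,2)])
      (use assms(3) Cinf_c_facts(2)[OF \<rho>(1)] L(3) in \<open>auto intro: continuous_intros\<close>)
  then have "integrable lebesgue (\<lambda>x. indicator U x *\<^sub>R (f x * (k x * \<rho> x)))"
    using lebesgue_sets_open[OF assms(2)] by (subst (asm) integrable_restrict_space) auto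
  from integrable_mult_indicator[OF _ this, of K]
  have "integrable lebesgue (\<lambda>x. indicator K x *\<^sub>R (indicator U x *\<^sub>R (f x * (k x * \<rho> x))))"
    using lebesgue_sets_compact[OF K(1)] by auto
  moreover have "(\<lambda>x. indicator K x *\<^sub>R (indicator U x *\<^sub>R (f x * (k x * \<rho> x)))) =
      (\<lambda>x. indicator K x *\<^sub>R (k x * f x))"
    using K(2) \<rho>(2,3) by (auto simp: indicator_def fun_eq_iff)
  ultimately show "integrable (lebesgue_on K) (\<lambda>x. k x * f x)"
    using lebesgue_sets_compact[OF K(1)] by (subst integrable_restrict_space) auto
qed

lemma L1_loc_add: "L1_loc U f \<Longrightarrow> L1_loc U g \<Longrightarrow> L1_loc U (\<lambda>x. f x + g x)"
  by (auto simp: L1_loc_def)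

lemma L1_loc_cmult: "L1_loc U f \<Longrightarrow> L1_loc U (\<lambda>x. c * f x)"
  by (auto simp: L1_loc_def)

lemma L1_loc_continuous:
  assumes "continuous_on UNIV f"
  shows "L1_loc U f"
  unfolding L1_loc_def
proof (intro allI impI, elim conjE)
  fix K :: "'a set" assume K: "compact K"
  have "integrable lborel (\<lambda>x. indicator K x *\<^sub>R f x)"
    using assms K by (intro borel_integrable_compact) (auto intro: continuous_on_subset)
  then show "integrable (lebesgue_on K) f"
    using borel_measurable_continuous_onI[OF assms] borel_closed[OF compact_imp_closed[OF K]]
    by (subst integrable_lebesgue_on_borel) auto
qed

lemma L1_loc_subset: "L1_loc U f \<Longrightarrow> V \<subseteq> U \<Longrightarrow> L1_loc V f"
  by (auto simp: L1_loc_def)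

lemma weak_deriv_test_integrable:
  assumes "L1_loc U f" "open U" "\<phi> \<in> Cinf_c U"
  shows "integrable (lebesgue_on U) (\<lambda>x. f x * \<phi> x)"
    and "e \<in> Basis \<Longrightarrow> integrable (lebesgue_on U) (\<lambda>x. f x * frechet_derivative \<phi> (at x) e)"
proof -
  obtain K where K: "compact K" "K \<subseteq> U" "\<And>x. x \<notin> K \<Longrightarrow> \<phi> x = 0"
    "\<And>x e. x \<notin> K \<Longrightarrow> frechet_derivative \<phi> (at x) e = 0"
    by (rule Cinf_c_support[OF assms(3)]) blast
  show "integrable (lebesgue_on U) (\<lambda>x. f x * \<phi> x)"
    using L1_loc_times_compact_support[OF assms(1,2) Cinf_c_facts(2)[OF assms(3)] K(1-3)] .
  show "integrable (lebesgue_on U) (\<lambda>x. f x * frechet_derivative \<phi> (at x) e)" if "e \<in> Basis"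
    by (rule L1_loc_times_compact_support[OF assms(1,2) Cinf_c_facts(4)[OF assms(3) that] K(1,2,4)])
qed

lemma weak_deriv_add:
  assumes "weak_deriv U e f f'" "weak_deriv U e g g'" "open U" "e \<in> Basis"
  shows "weak_deriv U e (\<lambda>x. f x + g x) (\<lambda>x. f' x + g' x)"
  unfolding weak_deriv_def
proof (intro conjI ballI)
  have L: "L1_loc U f" "L1_loc U f'" "L1_loc U g" "L1_loc U g'"
    using assms by (auto simp: weak_deriv_def)
  show "L1_loc U (\<lambda>x. f x + g x)" "L1_loc U (\<lambda>x. f' x + g' x)" using L by (auto intro: L1_loc_add)
  fix \<phi> assume \<phi>: "\<phi> \<in> Cinf_c U"
  note int = weak_deriv_test_integrable[OF _ assms(3) \<phi>]
  show "integral\<^sup>L (lebesgue_on U) (\<lambda>x. (f x + g x) * frechet_derivative \<phi> (at x) e) =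
      - integral\<^sup>L (lebesgue_on U) (\<lambda>x. (f' x + g' x) * \<phi> x)"
    using assms(1,2) \<phi> L int(1) int(2)[OF _ assms(4)] by (simp add: weak_deriv_def distrib_right)
qed

lemma weak_deriv_cmult:
  assumes "weak_deriv U e f f'"
  shows "weak_deriv U e (\<lambda>x. c * f x) (\<lambda>x. c * f' x)"
  using assms by (auto simp: weak_deriv_def mult.assoc intro: L1_loc_cmult)

text \<open>
  The product rule: \<open>\<eta>\<phi>\<close> is again a test function, and its derivative splits into the two terms.
\<close>

lemma weak_deriv_mult_smooth:
  assumes "weak_deriv U e f f'" "open U" "e \<in> Basis" "\<And>k. C_k k \<eta>"
  shows "weak_deriv U e (\<lambda>x. \<eta> x * f x) (\<lambda>x. \<eta> x * f' x + f x * frechet_derivative \<eta> (at x) e)"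
  unfolding weak_deriv_def
proof (intro conjI ballI)
  have L: "L1_loc U f" "L1_loc U f'" using assms by (auto simp: weak_deriv_def)
  have c: "continuous_on UNIV \<eta>" "continuous_on UNIV (\<lambda>x. frechet_derivative \<eta> (at x) e)"
    and d: "\<And>x. \<eta> differentiable (at x)"
    using assms(4)[of 0] assms(4)[of 1] assms(3) by auto
  show "L1_loc U (\<lambda>x. \<eta> x * f x)" "L1_loc U (\<lambda>x. \<eta> x * f' x + f x * frechet_derivative \<eta> (at x) e)"
    using L1_loc_times_continuous[OF L(1) assms(2) c(1)]
      L1_loc_add[OF L1_loc_times_continuous[OF L(2) assms(2) c(1)] L1_loc_times_continuous[OF L(1) assms(2) c(2)]]
    by (auto simp: mult.commute)
  fix \<phi> assume \<phi>: "\<phi> \<in> Cinf_c U"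
  have \<eta>\<phi>: "(\<lambda>x. \<eta> x * \<phi> x) \<in> Cinf_c U" by (rule Cinf_c_mult[OF assms(4) \<phi>])
  obtain K where K: "compact K" "K \<subseteq> U" "\<And>x. x \<notin> K \<Longrightarrow> \<phi> x = 0"
    "\<And>x e. x \<notin> K \<Longrightarrow> frechet_derivative \<phi> (at x) e = 0"
    by (rule Cinf_c_support[OF \<phi>]) blast
  have i1: "integrable (lebesgue_on U) (\<lambda>x. f x * (\<eta> x * frechet_derivative \<phi> (at x) e))"
    by (rule L1_loc_times_compact_support[OF L(1) assms(2) _ K(1,2)])
      (use c Cinf_c_facts(4)[OF \<phi> assms(3)] K(4) in \<open>auto intro: continuous_intros\<close>)
  have i2: "integrable (lebesgue_on U) (\<lambda>x. f x * (frechet_derivative \<eta> (at x) e * \<phi> x))"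
    by (rule L1_loc_times_compact_support[OF L(1) assms(2) _ K(1,2)])
      (use c Cinf_c_facts(2)[OF \<phi>] K(3) in \<open>auto intro: continuous_intros\<close>)
  have i3: "integrable (lebesgue_on U) (\<lambda>x. f' x * (\<eta> x * \<phi> x))"
    by (rule weak_deriv_test_integrable(1)[OF L(2) assms(2) \<eta>\<phi>])
  have "integral\<^sup>L (lebesgue_on U) (\<lambda>x. f x * frechet_derivative (\<lambda>x. \<eta> x * \<phi> x) (at x) e)
      = - integral\<^sup>L (lebesgue_on U) (\<lambda>x. f' x * (\<eta> x * \<phi> x))"
    using assms(1) \<eta>\<phi> by (simp add: weak_deriv_def)
  moreover have "(\<lambda>x. f x * frechet_derivative (\<lambda>x. \<eta> x * \<phi> x) (at x) e) =
     (\<lambda>x. f x * (\<eta> x * frechet_derivative \<phi> (at x) e) + f x * (frechet_derivative \<eta> (at x) e * \<phi> x))"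
    using d Cinf_c_facts(1)[OF \<phi>] by (simp add: frechet_derivative_mult_apply algebra_simps)
  ultimately have "integral\<^sup>L (lebesgue_on U) (\<lambda>x. f x * (\<eta> x * frechet_derivative \<phi> (at x) e)) =
      - (integral\<^sup>L (lebesgue_on U) (\<lambda>x. f' x * (\<eta> x * \<phi> x)) +
         integral\<^sup>L (lebesgue_on U) (\<lambda>x. f x * (frechet_derivative \<eta> (at x) e * \<phi> x)))"
    using i1 i2 by simp
  also have "\<dots> = - integral\<^sup>L (lebesgue_on U) (\<lambda>x. (\<eta> x * f' x + f x * frechet_derivative \<eta> (at x) e) * \<phi> x)"
    using Bochner_Integration.integral_add[OF i3 i2] by (simp add: algebra_simps)
  finally show "integral\<^sup>L (lebesgue_on U) (\<lambda>x. \<eta> x * f x * frechet_derivative \<phi> (at x) e) =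
      - integral\<^sup>L (lebesgue_on U) (\<lambda>x. (\<eta> x * f' x + f x * frechet_derivative \<eta> (at x) e) * \<phi> x)"
    by (simp add: mult_ac)
qed

lemma integral_lebesgue_on_subset:
  fixes f :: "'a::euclidean_space \<Rightarrow> real"
  assumes "S \<in> sets lebesgue" "S' \<in> sets lebesgue" "S \<subseteq> S'" "\<And>x. x \<in> S' \<Longrightarrow> x \<notin> S \<Longrightarrow> f x = 0"
  shows "integral\<^sup>L (lebesgue_on S) f = integral\<^sup>L (lebesgue_on S') f"
proof -
  have "(\<lambda>x. indicator S x *\<^sub>R f x) = (\<lambda>x. indicator S' x *\<^sub>R f x)"
    using assms by (auto simp: indicator_def fun_eq_iff)
  then show ?thesis using assms by (simp add: integral_restrict_space)
qed

lemma weak_deriv_subset: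
  assumes "weak_deriv U e f g" "open U" "open V" "V \<subseteq> U"
  shows "weak_deriv V e f g"
  unfolding weak_deriv_def
proof (intro conjI ballI)
  show "L1_loc V f" "L1_loc V g" using assms L1_loc_subset by (auto simp: weak_deriv_def)
  fix \<phi> assume \<phi>: "\<phi> \<in> Cinf_c V"
  obtain K where K: "compact K" "K \<subseteq> V" "\<And>x. x \<notin> K \<Longrightarrow> \<phi> x = 0"
    "\<And>x e. x \<notin> K \<Longrightarrow> frechet_derivative \<phi> (at x) e = 0"
    by (rule Cinf_c_support[OF \<phi>]) blast
  have "integral\<^sup>L (lebesgue_on V) (\<lambda>x. f x * frechet_derivative \<phi> (at x) e) =
      integral\<^sup>L (lebesgue_on U) (\<lambda>x. f x * frechet_derivative \<phi> (at x) e)"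
    "integral\<^sup>L (lebesgue_on V) (\<lambda>x. g x * \<phi> x) = integral\<^sup>L (lebesgue_on U) (\<lambda>x. g x * \<phi> x)"
    by (intro integral_lebesgue_on_subset lebesgue_sets_open assms; use K in force)+
  then show "integral\<^sup>L (lebesgue_on V) (\<lambda>x. f x * frechet_derivative \<phi> (at x) e) =
      - integral\<^sup>L (lebesgue_on V) (\<lambda>x. g x * \<phi> x)"
    using assms(1) Cinf_c_mono[OF \<phi> assms(4)] by (simp add: weak_deriv_def)
qed

text \<open>
  A classical derivative in the single direction \<open>e\<close> is a weak one. This is used for functions that are
  differentiable in time but only continuous in space.
\<close>

lemma weak_deriv_if_line_deriv:
  fixes f :: "'a::euclidean_space \<Rightarrow> real"
  assumes "continuous_on UNIV f" "continuous_on UNIV d" "has_line_deriv f e d" "open U" "e \<in> Basis"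
  shows "weak_deriv U e f d"
  unfolding weak_deriv_def
proof (intro conjI ballI)
  show "L1_loc U f" "L1_loc U d" using assms by (auto intro: L1_loc_continuous)
  fix \<phi> assume \<phi>: "\<phi> \<in> Cinf_c U"
  obtain K where K: "compact K" "K \<subseteq> U" "\<And>x. x \<notin> K \<Longrightarrow> \<phi> x = 0"
    "\<And>x e. x \<notin> K \<Longrightarrow> frechet_derivative \<phi> (at x) e = 0"
    by (rule Cinf_c_support[OF \<phi>]) blast
  note c = Cinf_c_facts(2)[OF \<phi>] Cinf_c_facts(4)[OF \<phi> assms(5)]
  have sets: "U \<in> sets borel" using assms by auto
  have "(LBINT x. d x * \<phi> x + f x * frechet_derivative \<phi> (at x) e) = 0"
    by (rule integral_line_deriv_eq_0[OF _ _ has_line_deriv_mult[OF assms(3) has_line_deriv_frechet[OF Cinf_c_facts(1)[OF \<phi>]]] K(1)])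
      (use assms c K(3) in \<open>auto intro!: continuous_intros\<close>)
  moreover have "integrable lborel (\<lambda>x. d x * \<phi> x)"
    "integrable lborel (\<lambda>x. f x * frechet_derivative \<phi> (at x) e)"
    by (rule integrable_if_continuous_compact_support[OF _ K(1)];
      use assms c K(3,4) in \<open>auto intro!: continuous_intros\<close>)+
  ultimately have *: "(LBINT x. f x * frechet_derivative \<phi> (at x) e) = - (LBINT x. d x * \<phi> x)"
    by simp
  have m: "(\<lambda>x. f x * frechet_derivative \<phi> (at x) e) \<in> borel_measurable borel"
    "(\<lambda>x. d x * \<phi> x) \<in> borel_measurable borel"
    using assms c by (auto intro!: borel_measurable_continuous_onI continuous_intros)
  have "indicator U x *\<^sub>R (f x * frechet_derivative \<phi> (at x) e) = f x * frechet_derivative \<phi> (at x) e"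
    "indicator U x *\<^sub>R (d x * \<phi> x) = d x * \<phi> x" for x
    using K by (auto simp: indicator_def)
  with * show "integral\<^sup>L (lebesgue_on U) (\<lambda>x. f x * frechet_derivative \<phi> (at x) e) =
      - integral\<^sup>L (lebesgue_on U) (\<lambda>x. d x * \<phi> x)"
    by (simp add: integral_lebesgue_on_borel[OF _ sets] m del: real_scaleR_def)
qed


section \<open>Square-integrable functions\<close>

lemma Lp_on_2_iff:
  "Lp_on 2 S f \<longleftrightarrow> f \<in> borel_measurable (lebesgue_on S) \<and> integrable (lebesgue_on S) (\<lambda>x. (norm (f x))\<^sup>2)"
  by (simp add: Lp_on_def powr_numeral)

text \<open>
  The comparison may be between functions with values in different spaces, so one lemma covers
  products of scalar and vector-valued functions in either order.
\<close>

lemma Lp_on_2_bound: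
  fixes f :: "'a::euclidean_space \<Rightarrow> 'b::euclidean_space" and g :: "'a \<Rightarrow> 'c::euclidean_space"
  assumes "Lp_on 2 S f" "g \<in> borel_measurable (lebesgue_on S)" "\<And>x. x \<in> S \<Longrightarrow> norm (g x) \<le> C * norm (f x)"
  shows "Lp_on 2 S g"
  unfolding Lp_on_2_iff
proof
  have i: "integrable (lebesgue_on S) (\<lambda>x. C\<^sup>2 * (norm (f x))\<^sup>2)"
    using assms(1) by (simp add: Lp_on_2_iff)
  show "integrable (lebesgue_on S) (\<lambda>x. (norm (g x))\<^sup>2)"
  proof (rule Bochner_Integration.integrable_bound[OF i])
    show "(\<lambda>x. (norm (g x))\<^sup>2) \<in> borel_measurable (lebesgue_on S)" using assms(2) by measurable
    show "AE x in lebesgue_on S. norm ((norm (g x))\<^sup>2) \<le> norm (C\<^sup>2 * (norm (f x))\<^sup>2)"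
    proof (intro AE_I2)
      fix x assume "x \<in> space (lebesgue_on S)"
      then have "norm (g x) \<le> C * norm (f x)" using assms(3) by simp
      from power_mono[OF this, of 2]
      show "norm ((norm (g x))\<^sup>2) \<le> norm (C\<^sup>2 * (norm (f x))\<^sup>2)" by (simp add: power_mult_distrib)
    qed
  qed
qed fact

lemma Lp_on_2_add:
  fixes f g :: "'a::euclidean_space \<Rightarrow> 'b::euclidean_space"
  assumes "Lp_on 2 S f" "Lp_on 2 S g"
  shows "Lp_on 2 S (\<lambda>x. f x + g x)"
  unfolding Lp_on_2_iff
proof
  have m: "f \<in> borel_measurable (lebesgue_on S)" "g \<in> borel_measurable (lebesgue_on S)"
    using assms by (auto simp: Lp_on_2_iff)
  then show "(\<lambda>x. f x + g x) \<in> borel_measurable (lebesgue_on S)" by measurable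
  have i: "integrable (lebesgue_on S) (\<lambda>x. 2 * (norm (f x))\<^sup>2 + 2 * (norm (g x))\<^sup>2)"
    using assms by (simp add: Lp_on_2_iff)
  show "integrable (lebesgue_on S) (\<lambda>x. (norm (f x + g x))\<^sup>2)"
  proof (rule Bochner_Integration.integrable_bound[OF i])
    show "(\<lambda>x. (norm (f x + g x))\<^sup>2) \<in> borel_measurable (lebesgue_on S)" using m by measurable
    show "AE x in lebesgue_on S. norm ((norm (f x + g x))\<^sup>2) \<le> norm (2 * (norm (f x))\<^sup>2 + 2 * (norm (g x))\<^sup>2)"
    proof (intro AE_I2)
      fix x
      have "(norm (f x + g x))\<^sup>2 \<le> (norm (f x) + norm (g x))\<^sup>2"
        by (intro power_mono norm_triangle_ineq) auto
      also have "\<dots> \<le> 2 * (norm (f x))\<^sup>2 + 2 * (norm (g x))\<^sup>2"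
        using zero_le_power2[of "norm (f x) - norm (g x)"] by (simp add: power2_sum power2_diff)
      finally show "norm ((norm (f x + g x))\<^sup>2) \<le> norm (2 * (norm (f x))\<^sup>2 + 2 * (norm (g x))\<^sup>2)"
        by simp
    qed
  qed
qed

lemma Lp_on_2_mult_bounded:
  fixes F :: "'a::euclidean_space \<Rightarrow> 'b::euclidean_space"
  assumes "Lp_on 2 S F" "k \<in> borel_measurable (lebesgue_on S)" "\<And>x. x \<in> S \<Longrightarrow> \<bar>k x\<bar> \<le> B"
  shows "Lp_on 2 S (\<lambda>x. k x *\<^sub>R F x)"
proof (rule Lp_on_2_bound[OF assms(1), where C=B])
  show "(\<lambda>x. k x *\<^sub>R F x) \<in> borel_measurable (lebesgue_on S)"
    using assms by (intro borel_measurable_scaleR) (auto simp: Lp_on_def)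
qed (use assms(3) in \<open>auto intro: mult_right_mono\<close>)

lemma Lp_on_2_scaleR_bounded:
  fixes V :: "'a::euclidean_space \<Rightarrow> 'b::euclidean_space"
  assumes "Lp_on 2 S f" "V \<in> borel_measurable (lebesgue_on S)" "\<And>x. x \<in> S \<Longrightarrow> norm (V x) \<le> B"
  shows "Lp_on 2 S (\<lambda>x. f x *\<^sub>R V x)"
proof (rule Lp_on_2_bound[OF assms(1), where C=B])
  show "(\<lambda>x. f x *\<^sub>R V x) \<in> borel_measurable (lebesgue_on S)"
    using assms by (intro borel_measurable_scaleR) (auto simp: Lp_on_def)
  show "norm (f x *\<^sub>R V x) \<le> B * norm (f x)" if "x \<in> S" for x
    using mult_left_mono[OF assms(3)[OF that], of "\<bar>f x\<bar>"] by (simp add: mult.commute)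
qed

lemma Lp_on_2_inner_integrable:
  fixes f g :: "'a::euclidean_space \<Rightarrow> 'b::euclidean_space"
  assumes "Lp_on 2 S f" "Lp_on 2 S g"
  shows "integrable (lebesgue_on S) (\<lambda>x. f x \<bullet> g x)"
proof (rule Bochner_Integration.integrable_bound)
  show "integrable (lebesgue_on S) (\<lambda>x. (norm (f x))\<^sup>2 + (norm (g x))\<^sup>2)"
    using assms by (simp add: Lp_on_2_iff)
  show "(\<lambda>x. f x \<bullet> g x) \<in> borel_measurable (lebesgue_on S)"
    using assms unfolding Lp_on_2_iff by (intro borel_measurable_inner) auto
  show "AE x in lebesgue_on S. norm (f x \<bullet> g x) \<le> norm ((norm (f x))\<^sup>2 + (norm (g x))\<^sup>2)"
  proof (intro AE_I2)
    fix x
    have "\<bar>f x \<bullet> g x\<bar> \<le> norm (f x) * norm (g x)" by (rule Cauchy_Schwarz_ineq2)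
    also have "\<dots> \<le> (norm (f x))\<^sup>2 + (norm (g x))\<^sup>2"
    proof -
      have "0 \<le> norm (f x) * norm (g x)" "2 * (norm (f x) * norm (g x)) \<le> (norm (f x))\<^sup>2 + (norm (g x))\<^sup>2"
        using sum_squares_bound[of "norm (f x)" "norm (g x)"] by (simp_all add: mult.assoc)
      then show ?thesis by linarith
    qed
    finally show "norm (f x \<bullet> g x) \<le> norm ((norm (f x))\<^sup>2 + (norm (g x))\<^sup>2)" by simp
  qed
qed

lemma Lp_on_bounded:
  fixes f :: "'a::euclidean_space \<Rightarrow> 'b::euclidean_space"
  assumes "f \<in> borel_measurable (lebesgue_on S)" "S \<in> lmeasurable" "\<And>x. x \<in> S \<Longrightarrow> norm (f x) \<le> B" "0 < p"
  shows "Lp_on p S f"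
  unfolding Lp_on_def
proof
  show "integrable (lebesgue_on S) (\<lambda>x. norm (f x) powr p)"
  proof (rule Bochner_Integration.integrable_bound)
    show "integrable (lebesgue_on S) (\<lambda>x. B powr p)"
      using assms(2) by (simp add: lmeasurable_iff_integrable_on integrable_restrict_space fmeasurableD)
        (use assms(2) integrable_real_mult_indicator in \<open>auto simp: fmeasurable_def less_top[symmetric] emeasure_eq_ennreal_measure\<close>)
    show "(\<lambda>x. norm (f x) powr p) \<in> borel_measurable (lebesgue_on S)" using assms(1) by measurable
    show "AE x in lebesgue_on S. norm (norm (f x) powr p) \<le> norm (B powr p)"
      using assms by (intro AE_I2) (auto intro!: powr_mono2)
  qed
qed fact

lemma Lp_on_continuous:
  fixes f :: "'a::euclidean_space \<Rightarrow> 'b::euclidean_space"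
  assumes "continuous_on UNIV f" "bounded S" "S \<in> sets lebesgue" "0 < p"
  shows "Lp_on p S f"
proof -
  have "compact (f ` closure S)" using assms
    by (intro compact_continuous_image) (auto intro: continuous_on_subset)
  then obtain B where B: "\<forall>y\<in>closure S. norm (f y) \<le> B"
    by (auto simp: bounded_iff dest!: compact_imp_bounded)
  show ?thesis
  proof (rule Lp_on_bounded[where B=B])
    show "f \<in> borel_measurable (lebesgue_on S)"
      using assms(1) by (intro borel_imp_lebesgue_on borel_measurable_continuous_onI)
    show "S \<in> lmeasurable" using assms by (simp add: bounded_set_imp_lmeasurable)
    show "norm (f x) \<le> B" if "x \<in> S" for x using B that closure_subset by blast
  qed fact
qed

lemma Lp_on_subset:
  fixes f :: "'a::euclidean_space \<Rightarrow> 'b::euclidean_space"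
  assumes "Lp_on p S f" "S' \<subseteq> S" "S \<in> sets lebesgue" "S' \<in> sets lebesgue"
  shows "Lp_on p S' f"
  unfolding Lp_on_def
proof
  show "f \<in> borel_measurable (lebesgue_on S')"
    using assms(1,2) unfolding Lp_on_def by (blast intro: measurable_restrict_mono)
  have i: "integrable lebesgue (\<lambda>x. indicator S x *\<^sub>R (norm (f x) powr p))"
    using assms by (auto simp: Lp_on_def integrable_restrict_space)
  have "integrable lebesgue (\<lambda>x. indicator S' x *\<^sub>R (indicator S x *\<^sub>R (norm (f x) powr p)))"
    by (rule integrable_mult_indicator[OF assms(4) i])
  moreover have "(\<lambda>x. indicator S' x *\<^sub>R (indicator S x *\<^sub>R (norm (f x) powr p))) =
      (\<lambda>x. indicator S' x *\<^sub>R (norm (f x) powr p))"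
    using assms(2) by (auto simp: indicator_def fun_eq_iff)
  ultimately show "integrable (lebesgue_on S') (\<lambda>x. norm (f x) powr p)"
    using assms by (simp add: integrable_restrict_space)
qed

lemma Lp_on_2_imp_L1_loc:
  fixes f :: "'a::euclidean_space \<Rightarrow> real"
  assumes "Lp_on 2 S f" "S \<in> sets lebesgue"
  shows "L1_loc S f"
  unfolding L1_loc_def
proof (intro allI impI, elim conjE)
  fix K assume K: "compact K" "K \<subseteq> S"
  have 1: "Lp_on 2 K f" by (rule Lp_on_subset[OF assms(1) K(2) assms(2) lebesgue_sets_compact[OF K(1)]])
  have 2: "Lp_on 2 K (\<lambda>x. 1::real)"
    by (rule Lp_on_continuous) (use K in \<open>auto intro: compact_imp_bounded lebesgue_sets_compact\<close>)
  show "integrable (lebesgue_on K) f" using Lp_on_2_inner_integrable[OF 1 2] by simp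
qed


lemma open_cylinder_sets:
  fixes \<Omega> :: "'a::euclidean_space set"
  assumes "open \<Omega>"
  shows "\<Omega> \<times> {a<..<b::real} \<in> sets lebesgue" "\<Omega> \<times> {a<..<b::real} \<in> sets borel"
  by (intro lebesgue_sets_open borel_open open_Times assms open_greaterThanLessThan)+


section \<open>Sobolev functions on space and on space-time\<close>

definition gradient :: "('a::euclidean_space \<Rightarrow> real) \<Rightarrow> 'a \<Rightarrow> 'a" where
  "gradient f x = (\<Sum>i\<in>Basis. frechet_derivative f (at x) i *\<^sub>R i)"

lemma gradient_inner: "i \<in> Basis \<Longrightarrow> gradient f x \<bullet> i = frechet_derivative f (at x) i"
  by (simp add: gradient_def)

lemma gradient_Cinf_c:
  assumes "\<eta> \<in> Cinf_c V"
  shows "continuous_on UNIV (gradient \<eta>)" and "\<exists>B. \<forall>x. norm (gradient \<eta> x) \<le> B"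
    and "\<exists>B. \<forall>x. \<bar>\<eta> x\<bar> \<le> B"
proof -
  obtain K where K: "compact K" "K \<subseteq> V" "\<And>x. x \<notin> K \<Longrightarrow> \<eta> x = 0"
    "\<And>x e. x \<notin> K \<Longrightarrow> frechet_derivative \<eta> (at x) e = 0"
    by (rule Cinf_c_support[OF assms]) blast
  show c: "continuous_on UNIV (gradient \<eta>)" unfolding gradient_def[abs_def]
    using Cinf_c_facts(4)[OF assms] by (intro continuous_intros) auto
  have "\<And>x. x \<notin> K \<Longrightarrow> gradient \<eta> x = 0" using K(4) by (simp add: gradient_def)
  from bounded_if_continuous_compact_support[OF c K(1) this]
  show "\<exists>B. \<forall>x. norm (gradient \<eta> x) \<le> B" by blast
  from bounded_if_continuous_compact_support[OF Cinf_c_facts(2)[OF assms] K(1,3)]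
  show "\<exists>B. \<forall>x. \<bar>\<eta> x\<bar> \<le> B" by (auto simp: real_norm_def)
qed

lemma H1_grad_add:
  assumes "H1_grad \<Omega> f F" "H1_grad \<Omega> g G" "open \<Omega>"
  shows "H1_grad \<Omega> (\<lambda>x. f x + g x) (\<lambda>x. F x + G x)"
  using assms by (auto simp: H1_grad_def inner_add_left intro: Lp_on_2_add weak_deriv_add)

lemma H1_grad_cmult:
  assumes "H1_grad \<Omega> f F"
  shows "H1_grad \<Omega> (\<lambda>x. c * f x) (\<lambda>x. c *\<^sub>R F x)"
proof -
  have L: "Lp_on 2 \<Omega> f" "Lp_on 2 \<Omega> F" and w: "\<And>i. i \<in> Basis \<Longrightarrow> weak_deriv \<Omega> i f (\<lambda>x. F x \<bullet> i)"
    using assms by (auto simp: H1_grad_def)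
  have "Lp_on 2 \<Omega> (\<lambda>x. c *\<^sub>R f x)" "Lp_on 2 \<Omega> (\<lambda>x. c *\<^sub>R F x)"
    by (rule Lp_on_2_mult_bounded[where B="\<bar>c\<bar>"]; simp add: L)+
  then show ?thesis using w weak_deriv_cmult[of \<Omega>] by (simp add: H1_grad_def)
qed

lemma H1_grad_mult_smooth:
  assumes "H1_grad \<Omega> f F" "open \<Omega>" "\<eta> \<in> Cinf_c V"
  shows "H1_grad \<Omega> (\<lambda>x. \<eta> x * f x) (\<lambda>x. \<eta> x *\<^sub>R F x + f x *\<^sub>R gradient \<eta> x)"
proof -
  obtain B B' where B: "\<And>x. \<bar>\<eta> x\<bar> \<le> B" "\<And>x. norm (gradient \<eta> x) \<le> B'"
    using gradient_Cinf_c(2,3)[OF assms(3)] by blast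
  have m: "\<eta> \<in> borel_measurable (lebesgue_on \<Omega>)" "gradient \<eta> \<in> borel_measurable (lebesgue_on \<Omega>)"
    using Cinf_c_facts(2)[OF assms(3)] gradient_Cinf_c(1)[OF assms(3)]
    by (auto intro!: borel_imp_lebesgue_on borel_measurable_continuous_onI)
  have L: "Lp_on 2 \<Omega> f" "Lp_on 2 \<Omega> F" using assms(1) by (auto simp: H1_grad_def)
  note Lp_on_2_mult_bounded[OF L(1) m(1) B(1)] Lp_on_2_mult_bounded[OF L(2) m(1) B(1)]
    Lp_on_2_scaleR_bounded[OF L(1) m(2) B(2)]
  moreover have "weak_deriv \<Omega> i (\<lambda>x. \<eta> x * f x) (\<lambda>x. \<eta> x * (F x \<bullet> i) + f x * frechet_derivative \<eta> (at x) i)"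
    if "i \<in> Basis" for i
    using assms(1) that by (intro weak_deriv_mult_smooth assms(2) that Cinf_c_facts(3)[OF assms(3)])
      (auto simp: H1_grad_def)
  ultimately show ?thesis
    by (auto simp: H1_grad_def inner_add_left gradient_inner intro: Lp_on_2_add)
qed

lemma H1_grad_subset:
  assumes "H1_grad \<Omega> f F" "open \<Omega>" "open \<Omega>'" "\<Omega>' \<subseteq> \<Omega>"
  shows "H1_grad \<Omega>' f F"
  using assms lebesgue_sets_open by (auto simp: H1_grad_def intro: Lp_on_subset weak_deriv_subset)

lemma H1_grad_if_line_derivs:
  fixes f :: "'a::euclidean_space \<Rightarrow> real"
  assumes "continuous_on UNIV f" "continuous_on UNIV F" "open \<Omega>" "bounded \<Omega>"
    and "\<And>i. i \<in> Basis \<Longrightarrow> has_line_deriv f i (\<lambda>x. F x \<bullet> i)"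
  shows "H1_grad \<Omega> f F"
  unfolding H1_grad_def
proof (intro conjI ballI)
  show "Lp_on 2 \<Omega> f" "Lp_on 2 \<Omega> F"
    using assms by (auto intro!: Lp_on_continuous lebesgue_sets_open)
  show "weak_deriv \<Omega> i f (\<lambda>x. F x \<bullet> i)" if "i \<in> Basis" for i
    by (rule weak_deriv_if_line_deriv[OF assms(1) _ assms(5)[OF that] assms(3) that])
      (intro continuous_intros assms)
qed

lemma L2H1_grad_add:
  assumes "L2H1_grad a b \<Omega> f F" "L2H1_grad a b \<Omega> g G" "open \<Omega>"
  shows "L2H1_grad a b \<Omega> (\<lambda>z. f z + g z) (\<lambda>z. F z + G z)"
  unfolding L2H1_grad_def
proof (intro conjI)
  show "Lp_on 2 (\<Omega> \<times> {a<..<b}) (\<lambda>z. f z + g z)" "Lp_on 2 (\<Omega> \<times> {a<..<b}) (\<lambda>z. F z + G z)"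
    using assms by (auto simp: L2H1_grad_def intro: Lp_on_2_add)
  have "AE t in lebesgue_on {a<..<b}. H1_grad \<Omega> (\<lambda>x. f (x, t)) (\<lambda>x. F (x, t))"
    "AE t in lebesgue_on {a<..<b}. H1_grad \<Omega> (\<lambda>x. g (x, t)) (\<lambda>x. G (x, t))"
    using assms by (auto simp: L2H1_grad_def)
  then show "AE t in lebesgue_on {a<..<b}. H1_grad \<Omega> (\<lambda>x. f (x, t) + g (x, t)) (\<lambda>x. F (x, t) + G (x, t))"
    by eventually_elim (rule H1_grad_add[OF _ _ assms(3)])
qed

lemma L2H1_grad_mult_time:
  assumes "L2H1_grad a b \<Omega> f F" "continuous_on UNIV \<beta>" "\<And>t. \<bar>\<beta> t\<bar> \<le> B"
  shows "L2H1_grad a b \<Omega> (\<lambda>z. \<beta> (snd z) * f z) (\<lambda>z. \<beta> (snd z) *\<^sub>R F z)"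
  unfolding L2H1_grad_def
proof (intro conjI)
  have "(\<lambda>z. \<beta> (snd z)) \<in> borel_measurable (lebesgue_on (\<Omega> \<times> {a<..<b}))"
    by (intro borel_imp_lebesgue_on borel_measurable_continuous_onI continuous_on_compose2[OF assms(2)] continuous_intros) auto
  with assms have "Lp_on 2 (\<Omega> \<times> {a<..<b}) (\<lambda>z. \<beta> (snd z) *\<^sub>R f z)"
    "Lp_on 2 (\<Omega> \<times> {a<..<b}) (\<lambda>z. \<beta> (snd z) *\<^sub>R F z)"
    by (auto simp: L2H1_grad_def intro!: Lp_on_2_mult_bounded simp del: real_scaleR_def)
  then show "Lp_on 2 (\<Omega> \<times> {a<..<b}) (\<lambda>z. \<beta> (snd z) * f z)"
    "Lp_on 2 (\<Omega> \<times> {a<..<b}) (\<lambda>z. \<beta> (snd z) *\<^sub>R F z)" by auto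
  have "AE t in lebesgue_on {a<..<b}. H1_grad \<Omega> (\<lambda>x. f (x, t)) (\<lambda>x. F (x, t))"
    using assms by (auto simp: L2H1_grad_def)
  then show "AE t in lebesgue_on {a<..<b}. H1_grad \<Omega> (\<lambda>x. \<beta> (snd (x, t)) * f (x, t)) (\<lambda>x. \<beta> (snd (x, t)) *\<^sub>R F (x, t))"
    by eventually_elim (simp add: H1_grad_cmult)
qed

lemma L2H1_grad_mult_smooth:
  assumes "L2H1_grad a b \<Omega> f F" "open \<Omega>" "\<eta> \<in> Cinf_c V"
  shows "L2H1_grad a b \<Omega> (\<lambda>z. \<eta> (fst z) * f z) (\<lambda>z. \<eta> (fst z) *\<^sub>R F z + f z *\<^sub>R gradient \<eta> (fst z))"
  unfolding L2H1_grad_def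
proof (intro conjI)
  obtain B B' where B: "\<And>x. \<bar>\<eta> x\<bar> \<le> B" "\<And>x. norm (gradient \<eta> x) \<le> B'"
    using gradient_Cinf_c(2,3)[OF assms(3)] by blast
  have m: "(\<lambda>z. \<eta> (fst z)) \<in> borel_measurable (lebesgue_on (\<Omega> \<times> {a<..<b}))"
    "(\<lambda>z. gradient \<eta> (fst z)) \<in> borel_measurable (lebesgue_on (\<Omega> \<times> {a<..<b}))"
    by (intro borel_imp_lebesgue_on borel_measurable_continuous_onI
        continuous_on_compose2[OF Cinf_c_facts(2)[OF assms(3)]]
        continuous_on_compose2[OF gradient_Cinf_c(1)[OF assms(3)]] continuous_intros; simp)+
  have L: "Lp_on 2 (\<Omega> \<times> {a<..<b}) f" "Lp_on 2 (\<Omega> \<times> {a<..<b}) F"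
    using assms(1) by (auto simp: L2H1_grad_def)
  from Lp_on_2_mult_bounded[OF L(1) m(1) B(1)] Lp_on_2_mult_bounded[OF L(2) m(1) B(1)]
    Lp_on_2_scaleR_bounded[OF L(1) m(2) B(2)]
  show "Lp_on 2 (\<Omega> \<times> {a<..<b}) (\<lambda>z. \<eta> (fst z) * f z)"
    "Lp_on 2 (\<Omega> \<times> {a<..<b}) (\<lambda>z. \<eta> (fst z) *\<^sub>R F z + f z *\<^sub>R gradient \<eta> (fst z))"
    by (auto intro: Lp_on_2_add)
  have "AE t in lebesgue_on {a<..<b}. H1_grad \<Omega> (\<lambda>x. f (x, t)) (\<lambda>x. F (x, t))"
    using assms by (auto simp: L2H1_grad_def)
  then show "AE t in lebesgue_on {a<..<b}. H1_grad \<Omega> (\<lambda>x. \<eta> (fst (x, t)) * f (x, t))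
      (\<lambda>x. \<eta> (fst (x, t)) *\<^sub>R F (x, t) + f (x, t) *\<^sub>R gradient \<eta> (fst (x, t)))"
    by eventually_elim (use H1_grad_mult_smooth[OF _ assms(2,3)] in simp)
qed

lemma L2H1_grad_if_line_derivs:
  fixes f :: "'a::euclidean_space \<times> real \<Rightarrow> real"
  assumes "continuous_on UNIV f" "continuous_on UNIV F" "open \<Omega>" "bounded \<Omega>"
    and "\<And>i t. i \<in> Basis \<Longrightarrow> has_line_deriv (\<lambda>x. f (x, t)) i (\<lambda>x. F (x, t) \<bullet> i)"
  shows "L2H1_grad a b \<Omega> f F"
  unfolding L2H1_grad_def
proof (intro conjI)
  have "bounded (\<Omega> \<times> {a<..<b})" "\<Omega> \<times> {a<..<b} \<in> sets lebesgue"
    using assms by (auto intro: bounded_Times open_cylinder_sets)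
  then show "Lp_on 2 (\<Omega> \<times> {a<..<b}) f" "Lp_on 2 (\<Omega> \<times> {a<..<b}) F"
    using assms by (auto intro: Lp_on_continuous)
  have "H1_grad \<Omega> (\<lambda>x. f (x, t)) (\<lambda>x. F (x, t))" for t
    by (rule H1_grad_if_line_derivs[OF _ _ assms(3,4) assms(5)])
      (auto intro!: continuous_on_compose2[OF assms(1)] continuous_on_compose2[OF assms(2)] continuous_intros)
  then show "AE t in lebesgue_on {a<..<b}. H1_grad \<Omega> (\<lambda>x. f (x, t)) (\<lambda>x. F (x, t))" by simp
qed

lemma L2H1_grad_subset:
  assumes "L2H1_grad a b \<Omega> f F" "open \<Omega>" "open \<Omega>'" "\<Omega>' \<subseteq> \<Omega>" "a \<le> a'" "b' \<le> b"
  shows "L2H1_grad a' b' \<Omega>' f F"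
  unfolding L2H1_grad_def
proof (intro conjI)
  have "\<Omega>' \<times> {a'<..<b'} \<subseteq> \<Omega> \<times> {a<..<b}" using assms by auto
  then show "Lp_on 2 (\<Omega>' \<times> {a'<..<b'}) f" "Lp_on 2 (\<Omega>' \<times> {a'<..<b'}) F"
    using assms by (auto simp: L2H1_grad_def intro: Lp_on_subset open_cylinder_sets)
  have "AE t in lborel. t \<in> {a<..<b} \<longrightarrow> H1_grad \<Omega> (\<lambda>x. f (x, t)) (\<lambda>x. F (x, t))"
    using assms(1) by (simp add: L2H1_grad_def AE_lebesgue_on_iff)
  then have "AE t in lborel. t \<in> {a'<..<b'} \<longrightarrow> H1_grad \<Omega>' (\<lambda>x. f (x, t)) (\<lambda>x. F (x, t))"
    by eventually_elim (use assms H1_grad_subset in auto)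
  then show "AE t in lebesgue_on {a'<..<b'}. H1_grad \<Omega>' (\<lambda>x. f (x, t)) (\<lambda>x. F (x, t))"
    by (simp add: AE_lebesgue_on_iff)
qed

lemma weak_deriv_cong_AE:
  assumes "weak_deriv U e f g" "AE x in lebesgue_on U. g x = g' x" "g' \<in> borel_measurable (lebesgue_on U)" "open U"
  shows "weak_deriv U e f g'"
  unfolding weak_deriv_def
proof (intro conjI ballI)
  have U: "U \<in> sets lebesgue" using assms by (simp add: lebesgue_sets_open)
  show "L1_loc U f" using assms by (simp add: weak_deriv_def)
  have ae: "AE x in lebesgue. x \<in> U \<longrightarrow> g x = g' x"
    using assms(2) U by (simp add: AE_restrict_space_iff)
  show "L1_loc U g'" unfolding L1_loc_def
  proof (intro allI impI, elim conjE)
    fix K assume K: "compact K" "K \<subseteq> U"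
    have i: "integrable (lebesgue_on K) g" using assms(1) K by (auto simp: weak_deriv_def L1_loc_def)
    have "integrable (lebesgue_on K) g'"
    proof (subst integrable_cong_AE[of _ _ g])
      show "g' \<in> borel_measurable (lebesgue_on K)"
        using assms(3) K(2) by (rule measurable_restrict_mono)
      show "g \<in> borel_measurable (lebesgue_on K)" using i by auto
      show "AE x in lebesgue_on K. g' x = g x"
        using ae lebesgue_sets_compact[OF K(1)] K(2) by (auto simp: AE_restrict_space_iff)
    qed (rule i)
    then show "integrable (lebesgue_on K) g'" .
  qed
  fix \<phi> assume \<phi>: "\<phi> \<in> Cinf_c U"
  have g: "integrable (lebesgue_on U) (\<lambda>x. g x * \<phi> x)"
    by (rule weak_deriv_test_integrable(1)[OF _ assms(4) \<phi>]) (use assms(1) in \<open>simp add: weak_deriv_def\<close>)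
  have g': "integrable (lebesgue_on U) (\<lambda>x. g' x * \<phi> x)"
    by (rule weak_deriv_test_integrable(1)[OF \<open>L1_loc U g'\<close> assms(4) \<phi>])
  have "integral\<^sup>L (lebesgue_on U) (\<lambda>x. g x * \<phi> x) = integral\<^sup>L (lebesgue_on U) (\<lambda>x. g' x * \<phi> x)"
    using assms(2) borel_measurable_integrable[OF g] borel_measurable_integrable[OF g']
    by (intro integral_cong_AE) auto
  then show "integral\<^sup>L (lebesgue_on U) (\<lambda>x. f x * frechet_derivative \<phi> (at x) e) =
      - integral\<^sup>L (lebesgue_on U) (\<lambda>x. g' x * \<phi> x)"
    using assms(1) \<phi> by (simp add: weak_deriv_def)
qed

lemma Lp_on_cong_AE:
  fixes f :: "'a::euclidean_space \<Rightarrow> 'b::euclidean_space"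
  assumes "Lp_on p S f" "AE x in lebesgue_on S. f x = g x" "g \<in> borel_measurable (lebesgue_on S)"
  shows "Lp_on p S g"
  unfolding Lp_on_def
proof
  have f: "f \<in> borel_measurable (lebesgue_on S)" "integrable (lebesgue_on S) (\<lambda>x. norm (f x) powr p)"
    using assms by (auto simp: Lp_on_def)
  show "integrable (lebesgue_on S) (\<lambda>x. norm (g x) powr p)"
    using f(2) by (rule integrable_cong_AE_imp) (use f assms in auto)
qed fact

lemma H1_grad_cong_AE:
  assumes "H1_grad \<Omega> f F" "AE x in lebesgue_on \<Omega>. F x = F' x" "F' \<in> borel_measurable (lebesgue_on \<Omega>)" "open \<Omega>"
  shows "H1_grad \<Omega> f F'"
  unfolding H1_grad_def
proof (intro conjI ballI)
  show "Lp_on 2 \<Omega> f" "Lp_on 2 \<Omega> F'"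
    using assms Lp_on_cong_AE by (auto simp: H1_grad_def)
  show "weak_deriv \<Omega> i f (\<lambda>x. F' x \<bullet> i)" if "i \<in> Basis" for i
    by (rule weak_deriv_cong_AE[of \<Omega> i f "\<lambda>x. F x \<bullet> i"]) (use assms that in \<open>auto simp: H1_grad_def\<close>)
qed

text \<open>Fubini for null sets, with the time variable outside although it is the second component.\<close>

lemma AE_lborel_time_slices:
  assumes "AE z in (lborel :: ('a::euclidean_space \<times> real) measure). P z"
  shows "AE t in lborel. AE x in lborel. P (x, t)"
proof -
  obtain N where N: "N \<in> null_sets lborel" "{z. \<not> P z} \<subseteq> N"
    using assms by (auto simp: eventually_ae_filter)
  have pair: "pair_sigma_finite (lborel :: 'a measure) (lborel :: real measure)" ..
  have "AE z in lborel \<Otimes>\<^sub>M lborel. z \<notin> N" unfolding lborel_prod by (rule AE_not_in[OF N(1)])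
  then have "AE x in lborel. AE t in lborel. (x, t) \<notin> N" by (rule pair_sigma_finite.AE_pair[OF pair])
  moreover have "{z \<in> space (lborel \<Otimes>\<^sub>M lborel). (fst z, snd z) \<notin> N} \<in>
      sets ((lborel :: 'a measure) \<Otimes>\<^sub>M (lborel :: real measure))"
  proof -
    have "{z \<in> space (lborel :: ('a \<times> real) measure). (fst z, snd z) \<notin> N} = - N" by auto
    then show ?thesis unfolding lborel_prod using N(1) by (auto simp: null_sets_def)
  qed
  ultimately have "AE t in lborel. AE x in lborel. (x, t) \<notin> N"
    using pair_sigma_finite.AE_commute[OF pair, of "\<lambda>x t. (x, t) \<notin> N"] by simp
  then show ?thesis by eventually_elim (use N(2) in \<open>auto elim!: eventually_mono\<close>)
qed

text \<open>
  Componentwise from the real-valued case; outside \<open>S\<close> the representative is set to \<open>0\<close>.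
\<close>

lemma borel_representative:
  fixes G :: "'a::euclidean_space \<Rightarrow> 'b::euclidean_space"
  assumes "G \<in> borel_measurable (lebesgue_on S)" "S \<in> sets borel"
  obtains G' where "G' \<in> borel_measurable borel" "AE x in lborel. x \<in> S \<longrightarrow> G x = G' x"
    "\<And>x. x \<notin> S \<Longrightarrow> G' x = 0"
proof -
  have g: "(\<lambda>x. indicator S x *\<^sub>R G x) \<in> borel_measurable lebesgue"
    using assms by (subst (asm) borel_measurable_restrict_space_iff) auto
  have "\<exists>h\<in>borel_measurable lborel. AE x in lborel. (indicator S x *\<^sub>R G x) \<bullet> b = h x" for b
    using completion_ex_borel_measurable_real[OF borel_measurable_inner[OF g borel_measurable_const]] by simp
  then obtain h where h: "\<And>b. h b \<in> borel_measurable lborel"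
    "\<And>b. AE x in lborel. (indicator S x *\<^sub>R G x) \<bullet> b = h b x" by metis
  define G' where "G' = (\<lambda>x. indicator S x *\<^sub>R (\<Sum>b\<in>Basis. h b x *\<^sub>R b))"
  have "G' \<in> borel_measurable borel" unfolding G'_def using h(1) assms(2) by measurable
  moreover have "AE x in lborel. \<forall>b\<in>Basis. (indicator S x *\<^sub>R G x) \<bullet> b = h b x"
    using h(2) by (intro AE_finite_allI) auto
  then have "AE x in lborel. x \<in> S \<longrightarrow> G x = G' x"
  proof eventually_elim
    case (elim x)
    show ?case
    proof
      assume x: "x \<in> S"
      have "G x = (\<Sum>b\<in>Basis. (G x \<bullet> b) *\<^sub>R b)" by (simp add: euclidean_representation)
      also have "\<dots> = (\<Sum>b\<in>Basis. h b x *\<^sub>R b)" using elim x by (intro sum.cong) auto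
      finally show "G x = G' x" using x by (simp add: G'_def)
    qed
  qed
  moreover have "\<And>x. x \<notin> S \<Longrightarrow> G' x = 0" by (simp add: G'_def)
  ultimately show thesis by (rule that)
qed

text \<open>
  The slices of the gradient change only on null sets for almost every time, which weak derivatives
  do not see.
\<close>

lemma L2H1_grad_borel_representative:
  fixes f :: "'a::euclidean_space \<times> real \<Rightarrow> real"
  assumes "L2H1_grad a b \<Omega> f F" "open \<Omega>"
  obtains F' where "F' \<in> borel_measurable borel" "L2H1_grad a b \<Omega> f F'"
    "\<And>z. z \<notin> \<Omega> \<times> {a<..<b} \<Longrightarrow> F' z = 0"
proof -
  let ?S = "\<Omega> \<times> {a<..<b}"
  have S: "?S \<in> sets borel" using assms(2) by (intro borel_open open_Times) auto
  have "F \<in> borel_measurable (lebesgue_on ?S)" using assms(1) by (simp add: L2H1_grad_def Lp_on_def)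
  then obtain F' where F': "F' \<in> borel_measurable borel" "AE x in lborel. x \<in> ?S \<longrightarrow> F x = F' x"
    "\<And>x. x \<notin> ?S \<Longrightarrow> F' x = 0"
    using S by (rule borel_representative) blast
  have sl: "(\<lambda>x. F' (x, t)) \<in> borel_measurable borel" for t
    using F'(1) by (rule measurable_compose[rotated]) (simp add: borel_prod[symmetric])
  have "L2H1_grad a b \<Omega> f F'"
    unfolding L2H1_grad_def
  proof (intro conjI)
    show "Lp_on 2 ?S f" using assms(1) by (simp add: L2H1_grad_def)
    show "Lp_on 2 ?S F'"
      by (rule Lp_on_cong_AE[of _ _ F]) (use assms(1) F' S in \<open>auto simp: L2H1_grad_def AE_lebesgue_on_iff intro: borel_imp_lebesgue_on\<close>)
    have "AE t in lborel. t \<in> {a<..<b} \<longrightarrow> H1_grad \<Omega> (\<lambda>x. f (x, t)) (\<lambda>x. F (x, t))"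
      using assms(1) by (simp add: L2H1_grad_def AE_lebesgue_on_iff)
    with AE_lborel_time_slices[OF F'(2)]
    have "AE t in lborel. t \<in> {a<..<b} \<longrightarrow> H1_grad \<Omega> (\<lambda>x. f (x, t)) (\<lambda>x. F' (x, t))"
    proof eventually_elim
      case (elim t)
      show ?case
      proof
        assume t: "t \<in> {a<..<b}"
        show "H1_grad \<Omega> (\<lambda>x. f (x, t)) (\<lambda>x. F' (x, t))"
        proof (rule H1_grad_cong_AE[of _ _ "\<lambda>x. F (x, t)"])
          show "AE x in lebesgue_on \<Omega>. F (x, t) = F' (x, t)"
            using elim(1) t assms(2) by (simp add: AE_lebesgue_on_iff)
        qed (use elim t assms(2) sl in \<open>auto intro: borel_imp_lebesgue_on\<close>)
      qed
    qed
    then show "AE t in lebesgue_on {a<..<b}. H1_grad \<Omega> (\<lambda>x. f (x, t)) (\<lambda>x. F' (x, t))"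
      by (simp add: AE_lebesgue_on_iff)
  qed
  with F' show thesis using that by blast
qed


section \<open>Averaging along a direction\<close>

text \<open>
  The average looks backward: for a measure on \<open>[0,h]\<close> and \<open>e\<close> the direction of time, the value at time \<open>t\<close>
  depends on times in \<open>[t-h,t]\<close>.
\<close>

definition average_along :: "real measure \<Rightarrow> 'c \<Rightarrow> ('c::real_normed_vector \<Rightarrow> 'b) \<Rightarrow> 'c \<Rightarrow>
    'b::{banach, second_countable_topology}" where
  "average_along \<mu> e g z = (\<integral>r. g (z - r *\<^sub>R e) \<partial>\<mu>)"

lemma average_along_time: "average_along \<mu> (0, 1) g (x, t) = (\<integral>r. g (x, t - r) \<partial>\<mu>)"
  by (simp add: average_along_def)

text \<open>
  All estimates hold for averages with respect to an arbitrary probability measure \<open>M\<close> on the line,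
  by Fubini's theorem on the product of \<open>M\<close> and Lebesgue measure.
\<close>

context real_distribution
begin

lemma pair_sigma_finite_lborel: "pair_sigma_finite M (lborel :: 'c::euclidean_space measure)"
  by (simp add: pair_sigma_finite_def sigma_finite_measure_axioms sigma_finite_lborel)

lemma borel_measurable_average_along:
  fixes g :: "'c::euclidean_space \<Rightarrow> 'b::{banach, second_countable_topology}"
  assumes [measurable]: "g \<in> borel_measurable borel"
  shows "average_along M e g \<in> borel_measurable borel"
  unfolding average_along_def by measurable

text \<open>
  The two arguments are shifted independently, with \<open>w r = 0\<close> and \<open>w r = r\<close> as the intended cases: the
  first is the integrand before, the second after the substitution that moves the shift from \<open>k\<close> to
  \<open>\<theta>\<close>.
\<close>

lemma shifted_product_integrable:
  fixes k \<theta> :: "'c::euclidean_space \<Rightarrow> real"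
  assumes k: "integrable lborel k" and \<theta>[measurable]: "\<theta> \<in> borel_measurable borel" and B: "\<And>z. \<bar>\<theta> z\<bar> \<le> B"
    and cont: "continuous_on UNIV w"
  shows "integrable (M \<Otimes>\<^sub>M lborel) (\<lambda>(r, z). \<theta> (z + w r *\<^sub>R e) * k (z - r *\<^sub>R e'))"
proof (rule pair_sigma_finite.Fubini_integrable[OF pair_sigma_finite_lborel])
  have [measurable]: "k \<in> borel_measurable borel" using k by auto
  have [measurable]: "w \<in> borel_measurable borel" using cont by (rule borel_measurable_continuous_onI)
  show "(\<lambda>(r, z). \<theta> (z + w r *\<^sub>R e) * k (z - r *\<^sub>R e')) \<in> borel_measurable (M \<Otimes>\<^sub>M lborel)" by measurable
  have ksh: "integrable lborel (\<lambda>z. k (z - r *\<^sub>R e'))" for r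
    using lborel_integrable_translation[OF k, of "- (r *\<^sub>R e')"] by simp
  have bd: "norm (\<theta> (z + w r *\<^sub>R e) * k (z - r *\<^sub>R e')) \<le> B * norm (k (z - r *\<^sub>R e'))" for r z
    using mult_right_mono[OF B[of "z + w r *\<^sub>R e"], of "\<bar>k (z - r *\<^sub>R e')\<bar>"] by (simp add: abs_mult)
  have i: "integrable lborel (\<lambda>z. \<theta> (z + w r *\<^sub>R e) * k (z - r *\<^sub>R e'))" for r
  proof (rule Bochner_Integration.integrable_bound[OF integrable_mult_right[OF integrable_norm[OF ksh], of B]])
    show "AE z in lborel. norm (\<theta> (z + w r *\<^sub>R e) * k (z - r *\<^sub>R e')) \<le> norm (B * norm (k (z - r *\<^sub>R e')))"
      using bd by (intro AE_I2) (metis abs_ge_self order_trans real_norm_def)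
  qed measurable
  then show "AE r in M. integrable lborel (\<lambda>z. case (r, z) of (r, z) \<Rightarrow> \<theta> (z + w r *\<^sub>R e) * k (z - r *\<^sub>R e'))"
    by simp
  show "integrable M (\<lambda>r. \<integral>z. norm (case (r, z) of (r, z) \<Rightarrow> \<theta> (z + w r *\<^sub>R e) * k (z - r *\<^sub>R e')) \<partial>lborel)"
  proof (rule integrable_const_bound)
    show "AE r in M. norm (LBINT z. norm (case (r, z) of (r, z) \<Rightarrow> \<theta> (z + w r *\<^sub>R e) * k (z - r *\<^sub>R e')))
        \<le> B * (LBINT z. norm (k z))"
    proof (intro AE_I2)
      fix r
      have "(LBINT z. norm (\<theta> (z + w r *\<^sub>R e) * k (z - r *\<^sub>R e'))) \<le> (LBINT z. B * norm (k (z - r *\<^sub>R e')))"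
        by (intro integral_mono integrable_norm[OF i] integrable_mult_right[OF integrable_norm[OF ksh]] bd)
      also have "\<dots> = B * (LBINT z. norm (k z))"
        using lborel_integral_translation[of "\<lambda>z. norm (k z)" "- (r *\<^sub>R e')"] by simp
      finally show "norm (LBINT z. norm (case (r, z) of (r, z) \<Rightarrow> \<theta> (z + w r *\<^sub>R e) * k (z - r *\<^sub>R e')))
        \<le> B * (LBINT z. norm (k z))" by simp
    qed
  qed measurable
qed

lemma average_along_integrable:
  fixes k \<theta> :: "'c::euclidean_space \<Rightarrow> real"
  assumes "integrable lborel k" "\<theta> \<in> borel_measurable borel" "\<And>z. \<bar>\<theta> z\<bar> \<le> B"
  shows "integrable lborel (\<lambda>z. \<theta> z * average_along M e k z)"
  using pair_sigma_finite.integrable_snd[OF pair_sigma_finite_lborel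
      shifted_product_integrable[OF assms, of "\<lambda>_. 0" 0 e]]
  by (simp add: average_along_def)

lemma AE_average_along_integrable:
  fixes k :: "'c::euclidean_space \<Rightarrow> real"
  assumes "integrable lborel k"
  shows "AE z in lborel. integrable M (\<lambda>r. k (z - r *\<^sub>R e))"
  using pair_sigma_finite.AE_integrable_snd[OF pair_sigma_finite_lborel
      shifted_product_integrable[OF assms, of "\<lambda>_. 1" 1 "\<lambda>_. 0" 0 e]]
  by simp

text \<open>The average is moved from one factor of an integral to the other, where it runs forward.\<close>

lemma integral_average_along_swap:
  fixes k \<theta> :: "'c::euclidean_space \<Rightarrow> real"
  assumes k: "integrable lborel k" and \<theta>[measurable]: "\<theta> \<in> borel_measurable borel" and B: "\<And>z. \<bar>\<theta> z\<bar> \<le> B"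
  shows "(LBINT z. \<theta> z * average_along M e k z) = (LBINT z. (\<integral>r. \<theta> (z + r *\<^sub>R e) \<partial>M) * k z)"
    and "integrable lborel (\<lambda>z. (\<integral>r. \<theta> (z + r *\<^sub>R e) \<partial>M) * k z)"
proof -
  have [measurable]: "k \<in> borel_measurable borel" using k by auto
  note F = pair_sigma_finite.Fubini_integral[OF pair_sigma_finite_lborel]
  have i1: "integrable (M \<Otimes>\<^sub>M lborel) (\<lambda>(r, z). \<theta> z * k (z - r *\<^sub>R e))"
    using shifted_product_integrable[OF k \<theta> B, of "\<lambda>_. 0" 0 e] by simp
  have i2: "integrable (M \<Otimes>\<^sub>M lborel) (\<lambda>(r, z). \<theta> (z + r *\<^sub>R e) * k z)"
    using shifted_product_integrable[OF k \<theta> B, of "\<lambda>r. r" e 0] by simp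
  have "(LBINT z. \<theta> z * average_along M e k z) = (LBINT z. (\<integral>r. \<theta> z * k (z - r *\<^sub>R e) \<partial>M))"
    by (simp add: average_along_def)
  also have "\<dots> = (\<integral>r. (LBINT z. \<theta> z * k (z - r *\<^sub>R e)) \<partial>M)" by (rule F[OF i1])
  also have "\<dots> = (\<integral>r. (LBINT z. \<theta> (z + r *\<^sub>R e) * k z) \<partial>M)"
  proof (rule Bochner_Integration.integral_cong[OF refl])
    fix r
    have "(\<lambda>z. \<theta> z * k (z - r *\<^sub>R e)) \<in> borel_measurable borel" by measurable
    from lborel_integral_translation[OF this, of "r *\<^sub>R e"]
    show "(LBINT z. \<theta> z * k (z - r *\<^sub>R e)) = (LBINT z. \<theta> (z + r *\<^sub>R e) * k z)"
      by (simp add: add.commute)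
  qed
  also have "\<dots> = (LBINT z. (\<integral>r. \<theta> (z + r *\<^sub>R e) * k z \<partial>M))" by (rule F[OF i2, symmetric])
  finally show "(LBINT z. \<theta> z * average_along M e k z) = (LBINT z. (\<integral>r. \<theta> (z + r *\<^sub>R e) \<partial>M) * k z)"
    by simp
  show "integrable lborel (\<lambda>z. (\<integral>r. \<theta> (z + r *\<^sub>R e) \<partial>M) * k z)"
    using pair_sigma_finite.integrable_snd[OF pair_sigma_finite_lborel i2] by simp
qed

text \<open>
  The average of the indicator of a null set has integral \<open>0\<close>.
\<close>

lemma AE_shifted:
  fixes P :: "'c::euclidean_space \<Rightarrow> bool"
  assumes "AE s in lborel. P s"
  shows "AE z in lborel. AE r in M. P (z - r *\<^sub>R e)"
proof -
  obtain N where N: "N \<in> null_sets lborel" "{z. \<not> P z} \<subseteq> N"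
    using assms by (auto simp: eventually_ae_filter)
  have [measurable]: "N \<in> sets borel" using N(1) by auto
  have "AE z in lborel. z \<notin> N" using N(1) by (rule AE_not_in)
  then have "(AE z in lborel. (indicator N z :: real) = 0)" by eventually_elim simp
  then have k: "integrable lborel (indicator N :: 'c \<Rightarrow> real)" "(\<integral>z. indicator N z \<partial>lborel :: real) = 0"
    using N(1) by (auto simp: null_sets_def measure_def)
  have i: "integrable (M \<Otimes>\<^sub>M lborel) (\<lambda>(r, z). indicator N (z - r *\<^sub>R e) :: real)"
    using shifted_product_integrable[OF k(1), of "\<lambda>_. 1" 1 "\<lambda>_. 0" 0 e] by simp
  have "(LBINT z. 1 * average_along M e (indicator N) z) = (0::real)"
    using integral_average_along_swap(1)[OF k(1), of "\<lambda>_. 1" 1 e] k(2) prob_space by simp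
  moreover have "integrable lborel (\<lambda>z. 1 * average_along M e (indicator N) z :: real)"
    by (rule average_along_integrable[OF k(1), where B=1]) auto
  moreover have "0 \<le> (average_along M e (indicator N) z :: real)" for z
    unfolding average_along_def by (rule Bochner_Integration.integral_nonneg) simp
  ultimately have "AE z in lborel. (average_along M e (indicator N) z :: real) = 0"
    by (subst (asm) integral_nonneg_eq_0_iff_AE) auto
  moreover have "AE z in lborel. integrable M (\<lambda>r. indicator N (z - r *\<^sub>R e) :: real)"
    by (rule AE_average_along_integrable[OF k(1)])
  ultimately show ?thesis
  proof eventually_elim
    case (elim z)
    then have "AE r in M. (indicator N (z - r *\<^sub>R e) :: real) = 0"
      unfolding average_along_def by (subst (asm) integral_nonneg_eq_0_iff_AE) auto
    then show ?case by eventually_elim (use N(2) in \<open>auto simp: indicator_def split: if_splits\<close>)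
  qed
qed

lemma integrable_if_square_integrable:
  fixes f :: "real \<Rightarrow> 'b::euclidean_space"
  assumes [measurable]: "f \<in> borel_measurable borel" and "integrable M (\<lambda>r. (norm (f r))\<^sup>2)"
  shows "integrable M f"
proof (rule Bochner_Integration.integrable_bound)
  show "integrable M (\<lambda>r. 1 + (norm (f r))\<^sup>2)" using assms(2) by simp
  show "f \<in> borel_measurable M" by measurable
  show "AE r in M. norm (f r) \<le> norm (1 + (norm (f r))\<^sup>2)"
  proof (intro AE_I2)
    fix r
    have "0 \<le> norm (f r)" "2 * norm (f r) \<le> 1 + (norm (f r))\<^sup>2"
      using sum_squares_bound[of 1 "norm (f r)"] by auto
    then have "norm (f r) \<le> 1 + (norm (f r))\<^sup>2" by linarith
    then show "norm (f r) \<le> norm (1 + (norm (f r))\<^sup>2)" by simp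
  qed
qed

text \<open>Jensen's inequality for the squared norm: a variance is nonnegative.\<close>

lemma norm_integral_square_le:
  fixes f :: "real \<Rightarrow> 'b::euclidean_space"
  assumes [measurable]: "f \<in> borel_measurable borel" and sq: "integrable M (\<lambda>r. (norm (f r))\<^sup>2)"
  shows "(norm (\<integral>r. f r \<partial>M))\<^sup>2 \<le> (\<integral>r. (norm (f r))\<^sup>2 \<partial>M)"
proof -
  define a where "a = (\<integral>r. f r \<partial>M)"
  have f: "integrable M f" by (rule integrable_if_square_integrable[OF assms])
  have "(norm (f r - a))\<^sup>2 = (norm (f r))\<^sup>2 - 2 * (f r \<bullet> a) + (norm a)\<^sup>2" for r
    by (simp add: power2_norm_eq_inner inner_diff_left inner_diff_right inner_commute)
  moreover have "0 \<le> (\<integral>r. (norm (f r - a))\<^sup>2 \<partial>M)" by simp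
  moreover have "(\<integral>r. (norm (f r))\<^sup>2 - 2 * (f r \<bullet> a) + (norm a)\<^sup>2 \<partial>M) =
      (\<integral>r. (norm (f r))\<^sup>2 \<partial>M) - 2 * (a \<bullet> a) + (norm a)\<^sup>2"
    using sq f prob_space by (simp add: a_def)
  ultimately show ?thesis by (simp add: a_def[symmetric] power2_norm_eq_inner)
qed

lemma AE_norm_average_along_square_le:
  fixes g :: "'c::euclidean_space \<Rightarrow> 'b::euclidean_space"
  assumes [measurable]: "g \<in> borel_measurable borel" and "integrable lborel (\<lambda>z. (norm (g z))\<^sup>2)"
  shows "AE z in lborel. (norm (average_along M e g z))\<^sup>2 \<le> average_along M e (\<lambda>z. (norm (g z))\<^sup>2) z"
  using AE_average_along_integrable[OF assms(2), of e]
proof eventually_elim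
  case (elim z)
  show ?case unfolding average_along_def by (rule norm_integral_square_le[OF _ elim]) measurable
qed

lemma average_along_square_integrable:
  fixes g :: "'c::euclidean_space \<Rightarrow> 'b::euclidean_space"
  assumes g[measurable]: "g \<in> borel_measurable borel" and sq: "integrable lborel (\<lambda>z. (norm (g z))\<^sup>2)"
  shows "integrable lborel (\<lambda>z. (norm (average_along M e g z))\<^sup>2)"
proof (rule Bochner_Integration.integrable_bound)
  have [measurable]: "average_along M e g \<in> borel_measurable borel"
    by (rule borel_measurable_average_along[OF g])
  show "integrable lborel (\<lambda>z. 1 * average_along M e (\<lambda>z. (norm (g z))\<^sup>2) z)"
    by (rule average_along_integrable[OF sq, where B=1]) auto
  show "(\<lambda>z. (norm (average_along M e g z))\<^sup>2) \<in> borel_measurable lborel" by measurable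
  show "AE z in lborel. norm ((norm (average_along M e g z))\<^sup>2) \<le> norm (1 * average_along M e (\<lambda>z. (norm (g z))\<^sup>2) z)"
    using AE_norm_average_along_square_le[OF g sq, of e] by eventually_elim simp
qed

lemma average_along_near:
  fixes g :: "'c::euclidean_space \<Rightarrow> real"
  assumes g: "continuous_on UNIV g" and near: "AE r in M. \<bar>g (z - r *\<^sub>R e) - g z\<bar> \<le> \<epsilon>"
    and bd: "\<And>z. \<bar>g z\<bar> \<le> B"
  shows "\<bar>average_along M e g z - g z\<bar> \<le> \<epsilon>"
proof -
  have [measurable]: "g \<in> borel_measurable borel" using g by (rule borel_measurable_continuous_onI)
  have i: "integrable M (\<lambda>r. g (z - r *\<^sub>R e))"
    by (rule integrable_const_bound[where B=B]) (use bd in \<open>auto\<close>)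
  then have "average_along M e g z - g z = (\<integral>r. g (z - r *\<^sub>R e) - g z \<partial>M)"
    using prob_space by (simp add: average_along_def)
  also have "\<bar>\<dots>\<bar> \<le> (\<integral>r. \<bar>g (z - r *\<^sub>R e) - g z\<bar> \<partial>M)" by (rule integral_abs_bound)
  also have "\<dots> \<le> (\<integral>r. \<epsilon> \<partial>M)" using near i by (intro integral_mono_AE) auto
  finally show ?thesis using prob_space by simp
qed

lemma continuous_on_average_along:
  fixes g :: "'c::euclidean_space \<Rightarrow> real"
  assumes g: "uniformly_continuous_on UNIV g" and bd: "\<And>z. \<bar>g z\<bar> \<le> B"
  shows "continuous_on UNIV (average_along M e g)"
proof (rule uniformly_continuous_imp_continuous, unfold uniformly_continuous_on_def, intro allI impI)
  fix \<epsilon> :: real assume "\<epsilon> > 0"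
  then obtain \<delta> where \<delta>: "\<delta> > 0" "\<And>z z'. dist z' z < \<delta> \<Longrightarrow> dist (g z') (g z) < \<epsilon> / 2"
    using g[unfolded uniformly_continuous_on_def, rule_format, of "\<epsilon> / 2"] by auto
  have [measurable]: "g \<in> borel_measurable borel"
    using uniformly_continuous_imp_continuous[OF g] by (rule borel_measurable_continuous_onI)
  have i: "integrable M (\<lambda>r. g (z - r *\<^sub>R e))" for z
    by (rule integrable_const_bound[where B=B]) (use bd in \<open>auto\<close>)
  have "dist (average_along M e g z') (average_along M e g z) < \<epsilon>" if "dist z' z < \<delta>" for z z'
  proof -
    have "\<bar>average_along M e g z' - average_along M e g z\<bar> = \<bar>\<integral>r. g (z' - r *\<^sub>R e) - g (z - r *\<^sub>R e) \<partial>M\<bar>"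
      using i by (simp add: average_along_def)
    also have "\<dots> \<le> (\<integral>r. \<bar>g (z' - r *\<^sub>R e) - g (z - r *\<^sub>R e)\<bar> \<partial>M)" by (rule integral_abs_bound)
    also have "\<dots> \<le> (\<integral>r. \<epsilon> / 2 \<partial>M)"
    proof (rule integral_mono)
      fix r
      have "dist (z' - r *\<^sub>R e) (z - r *\<^sub>R e) < \<delta>" using that by (simp add: dist_norm)
      from \<delta>(2)[OF this] show "\<bar>g (z' - r *\<^sub>R e) - g (z - r *\<^sub>R e)\<bar> \<le> \<epsilon> / 2" by (simp add: dist_norm)
    qed (use i in auto)
    finally show ?thesis using prob_space \<open>\<epsilon> > 0\<close> by (simp add: dist_norm)
  qed
  then show "\<exists>d>0. \<forall>x\<in>UNIV. \<forall>x'\<in>UNIV. dist x' x < d \<longrightarrow> dist (average_along M e g x') (average_along M e g x) < \<epsilon>"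
    using \<delta>(1) by blast
qed

text \<open>
  The spatial \<open>L\<^sup>1\<close> norm of the slices is an integrable function of time, so its average is finite at
  almost every time.
\<close>

lemma integrable_average_slices:
  fixes g :: "'a::euclidean_space \<times> real \<Rightarrow> 'b::euclidean_space"
  assumes g: "integrable lborel g"
  shows "AE t in lborel. integrable (M \<Otimes>\<^sub>M lborel) (\<lambda>(r, x). g (x, t - r))"
proof -
  have [measurable]: "g \<in> borel_measurable borel" using g by auto
  have g': "integrable (lborel \<Otimes>\<^sub>M lborel) g" unfolding lborel_prod by (rule g)
  have pair: "pair_sigma_finite (lborel :: 'a measure) (lborel :: real measure)" ..
  define N where "N = (\<lambda>t. \<integral>x. norm (g (x, t)) \<partial>lborel)"
  have N: "integrable lborel N" unfolding N_def
    by (rule pair_sigma_finite.integrable_snd[OF pair])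
      (use integrable_norm[OF g'] in \<open>simp add: case_prod_beta'\<close>)
  have sl: "AE s in lborel. integrable lborel (\<lambda>x. g (x, s))"
    by (rule pair_sigma_finite.AE_integrable_snd[OF pair]) (use g' in \<open>simp add: case_prod_beta'\<close>)
  from AE_average_along_integrable[OF N, of 1] AE_shifted[OF sl, of 1]
  show ?thesis
  proof eventually_elim
    case (elim t)
    show ?case
    proof (rule pair_sigma_finite.Fubini_integrable[OF pair_sigma_finite_lborel])
      show "(\<lambda>(r, x). g (x, t - r)) \<in> borel_measurable (M \<Otimes>\<^sub>M lborel)"
        by (simp add: borel_prod[symmetric]) measurable
    qed (use elim in \<open>simp_all add: N_def\<close>)
  qed
qed

text \<open>
  Averaging in time commutes with the weak derivative in space: integrate over \<open>x\<close> first, use the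
  identity at time \<open>t - r\<close>, and exchange the integrals again. The functions \<open>D\<close> and \<open>\<zeta>\<close> stand for the
  derivative of a test function and the test function itself.
\<close>

lemma weak_deriv_average_slice:
  fixes f :: "'a::euclidean_space \<times> real \<Rightarrow> real" and F :: "'a \<times> real \<Rightarrow> 'a"
  assumes f: "integrable (M \<Otimes>\<^sub>M lborel) (\<lambda>(r, x). f (x, t - r))"
    and F: "integrable (M \<Otimes>\<^sub>M lborel) (\<lambda>(r, x). F (x, t - r))"
    and weak: "AE r in M. (LBINT x. f (x, t - r) * D x) = - (LBINT x. (F (x, t - r) \<bullet> i) * \<zeta> x)"
    and D: "continuous_on UNIV D" "\<And>x. \<bar>D x\<bar> \<le> B" and \<zeta>: "continuous_on UNIV \<zeta>" "\<And>x. \<bar>\<zeta> x\<bar> \<le> B"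
  shows "(LBINT x. average_along M (0, 1) f (x, t) * D x) =
    - (LBINT x. (average_along M (0, 1) F (x, t) \<bullet> i) * \<zeta> x)"
proof -
  note Fub = pair_sigma_finite.Fubini_integral[OF pair_sigma_finite_lborel]
  have [measurable]: "D \<in> borel_measurable borel" "\<zeta> \<in> borel_measurable borel"
    using D \<zeta> by (auto intro: borel_measurable_continuous_onI)
  have fD: "integrable (M \<Otimes>\<^sub>M lborel) (\<lambda>(r, x). f (x, t - r) * D x)"
    using integrable_bounded_times[OF f, of "\<lambda>p. D (snd p)" B] D(2)
    by (simp add: case_prod_beta' mult.commute)
  have F\<zeta>: "integrable (M \<Otimes>\<^sub>M lborel) (\<lambda>(r, x). (F (x, t - r) \<bullet> i) * \<zeta> x)"
    using integrable_bounded_times[OF integrable_inner_left[OF F], of "\<lambda>p. \<zeta> (snd p)" B i] \<zeta>(2)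
    by (simp add: case_prod_beta' mult.commute)
  have "(LBINT x. average_along M (0, 1) f (x, t) * D x) = (LBINT x. (\<integral>r. f (x, t - r) * D x \<partial>M))"
    by (simp add: average_along_time)
  also have "\<dots> = (\<integral>r. (LBINT x. f (x, t - r) * D x) \<partial>M)" by (rule Fub[OF fD])
  also have "\<dots> = (\<integral>r. - (LBINT x. (F (x, t - r) \<bullet> i) * \<zeta> x) \<partial>M)"
    using weak pair_sigma_finite.integrable_fst[OF pair_sigma_finite_lborel fD]
      pair_sigma_finite.integrable_fst[OF pair_sigma_finite_lborel F\<zeta>]
    by (intro integral_cong_AE) auto
  also have "\<dots> = - (LBINT x. (\<integral>r. (F (x, t - r) \<bullet> i) * \<zeta> x \<partial>M))"
    using Fub[OF F\<zeta>] by simp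
  also have "(LBINT x. (\<integral>r. (F (x, t - r) \<bullet> i) * \<zeta> x \<partial>M)) =
      (LBINT x. (average_along M (0, 1) F (x, t) \<bullet> i) * \<zeta> x)"
  proof (rule integral_cong_AE)
    show "(\<lambda>x. \<integral>r. (F (x, t - r) \<bullet> i) * \<zeta> x \<partial>M) \<in> borel_measurable lborel"
      using pair_sigma_finite.integrable_snd[OF pair_sigma_finite_lborel F\<zeta>] by auto
    show "(\<lambda>x. (average_along M (0, 1) F (x, t) \<bullet> i) * \<zeta> x) \<in> borel_measurable lborel"
      using borel_measurable_integrable[OF pair_sigma_finite.integrable_snd[OF pair_sigma_finite_lborel F]]
      unfolding average_along_time by measurable
    from pair_sigma_finite.AE_integrable_snd[OF pair_sigma_finite_lborel F]
    show "AE x in lborel. (\<integral>r. (F (x, t - r) \<bullet> i) * \<zeta> x \<partial>M) = (average_along M (0, 1) F (x, t) \<bullet> i) * \<zeta> x"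
      by eventually_elim (simp add: average_along_time)
  qed
  finally show ?thesis .
qed

text \<open>
  Extension by zero outside the cylinder makes the average meaningful for all times. It is harmless
  because the average is taken in time only, so that it does not affect spatial derivatives.
\<close>

lemma L2H1_grad_average:
  fixes f :: "'a::euclidean_space \<times> real \<Rightarrow> real" and F :: "'a \<times> real \<Rightarrow> 'a"
  assumes H: "L2H1_grad 0 T \<Omega> f F" and \<Omega>: "open \<Omega>" "bounded \<Omega>"
    and f[measurable]: "f \<in> borel_measurable borel" and F[measurable]: "F \<in> borel_measurable borel"
    and f0: "\<And>z. z \<notin> cyl \<Omega> T \<Longrightarrow> f z = 0" and F0: "\<And>z. z \<notin> cyl \<Omega> T \<Longrightarrow> F z = 0"
  shows "L2H1_grad 0 T \<Omega> (average_along M (0, 1) f) (average_along M (0, 1) F)"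
proof -
  let ?S = "cyl \<Omega> T" let ?f = "average_along M (0, 1) f" and ?F = "average_along M (0, 1) F"
  note S = open_cylinder_sets[OF \<Omega>(1), of 0 T]
  have [measurable]: "?f \<in> borel_measurable borel" "?F \<in> borel_measurable borel"
    by (rule borel_measurable_average_along, fact)+
  have one: "Lp_on 2 ?S (\<lambda>_. 1::real)"
    by (rule Lp_on_continuous) (use S \<Omega> in \<open>auto intro: bounded_Times\<close>)
  have sqf: "integrable lborel (\<lambda>z. (norm (f z))\<^sup>2)" and sqF: "integrable lborel (\<lambda>z. (norm (F z))\<^sup>2)"
    using H f0 F0
    by (subst lebesgue_on_zero_outside(2)[symmetric, OF _ S(2)]; simp add: L2H1_grad_def Lp_on_2_iff)+
  have L1: "integrable lborel f" "integrable lborel F"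
  proof -
    have i: "integrable lborel (\<lambda>z. indicator ?S z *\<^sub>R (1::real))"
      using Lp_on_2_inner_integrable[OF one one] by (subst (asm) integrable_lebesgue_on_borel[OF _ S(2)]) auto
    have le: "a \<le> 1 + a\<^sup>2" if "0 \<le> a" for a :: real
      using sum_squares_bound[of 1 a] that by simp
    show "integrable lborel f"
    proof (rule Bochner_Integration.integrable_bound[OF Bochner_Integration.integrable_add[OF i sqf]])
      show "AE z in lborel. norm (f z) \<le> norm (indicator ?S z *\<^sub>R (1::real) + (norm (f z))\<^sup>2)"
        using f0 le[of "norm (f _)"] by (intro AE_I2) (auto simp: indicator_def)
    qed measurable
    show "integrable lborel F"
    proof (rule Bochner_Integration.integrable_bound[OF Bochner_Integration.integrable_add[OF i sqF]])
      show "AE z in lborel. norm (F z) \<le> norm (indicator ?S z *\<^sub>R (1::real) + (norm (F z))\<^sup>2)"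
        using F0 le[of "norm (F _)"] by (intro AE_I2) (auto simp: indicator_def)
    qed measurable
  qed
  have Lp: "Lp_on 2 A g" if "integrable lborel (\<lambda>z. (norm (g z))\<^sup>2)" "g \<in> borel_measurable borel" "A \<in> sets borel"
    for A :: "'c::euclidean_space set" and g :: "'c \<Rightarrow> 'd::euclidean_space"
    unfolding Lp_on_2_iff
  proof
    show "g \<in> borel_measurable (lebesgue_on A)" using that(2) by (rule borel_imp_lebesgue_on)
    show "integrable (lebesgue_on A) (\<lambda>x. (norm (g x))\<^sup>2)"
      using that integrable_mult_indicator[OF _ that(1), of A] by (subst integrable_lebesgue_on_borel) auto
  qed
  \<comment> \<open>Time slices on which the weak derivative identity holds; this includes all times outside \<open>(0,T)\<close>, where both sides vanish.\<close>
  define good where "good = (\<lambda>s. \<forall>i\<in>Basis. \<forall>\<zeta>\<in>Cinf_c \<Omega>.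
    (LBINT x. f (x, s) * frechet_derivative \<zeta> (at x) i) = - (LBINT x. (F (x, s) \<bullet> i) * \<zeta> x))"
  have slm: "(\<lambda>x. g (x, s)) \<in> borel_measurable borel" if "g \<in> borel_measurable borel"
    for g :: "'a \<times> real \<Rightarrow> 'd::euclidean_space" and s
    using that by (rule measurable_compose[rotated]) (simp add: borel_prod[symmetric])
  have test: "integral\<^sup>L (lebesgue_on \<Omega>) (\<lambda>x. h x * k x) = (LBINT x. h x * k x)"
    if "h \<in> borel_measurable borel" "continuous_on UNIV k" "\<And>x. x \<notin> \<Omega> \<Longrightarrow> k x = 0" for h k :: "'a \<Rightarrow> real"
    using that(1) borel_measurable_continuous_onI[OF that(2)] that(3) \<Omega>(1)
    by (intro lebesgue_on_zero_outside(1)) auto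
  note \<zeta>0 = Cinf_c_zero_outside
  have "AE s in lborel. s \<in> {0<..<T} \<longrightarrow> H1_grad \<Omega> (\<lambda>x. f (x, s)) (\<lambda>x. F (x, s))"
    using H by (simp add: L2H1_grad_def AE_lebesgue_on_iff)
  then have good: "AE s in lborel. good s"
  proof eventually_elim
    case (elim s)
    show ?case
    proof (cases "s \<in> {0<..<T}")
      case True
      then have h: "H1_grad \<Omega> (\<lambda>x. f (x, s)) (\<lambda>x. F (x, s))" using elim by blast
      show ?thesis unfolding good_def
      proof (intro ballI)
        fix i :: 'a and \<zeta> assume i: "i \<in> Basis" and \<zeta>: "\<zeta> \<in> Cinf_c \<Omega>"
        have "integral\<^sup>L (lebesgue_on \<Omega>) (\<lambda>x. f (x, s) * frechet_derivative \<zeta> (at x) i) =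
            - integral\<^sup>L (lebesgue_on \<Omega>) (\<lambda>x. (F (x, s) \<bullet> i) * \<zeta> x)"
          using h i \<zeta> by (auto simp: H1_grad_def weak_deriv_def)
        then show "(LBINT x. f (x, s) * frechet_derivative \<zeta> (at x) i) = - (LBINT x. (F (x, s) \<bullet> i) * \<zeta> x)"
          using test[OF slm[OF f] Cinf_c_facts(4)[OF \<zeta> i] \<zeta>0(2)[OF \<zeta>]]
            test[OF borel_measurable_inner[OF slm[OF F] borel_measurable_const] Cinf_c_facts(2)[OF \<zeta>] \<zeta>0(1)[OF \<zeta>]]
          by simp
      qed
    next
      case False
      then have "f (x, s) = 0" "F (x, s) = 0" for x using f0 F0 by auto
      then show ?thesis by (simp add: good_def)
    qed
  qed
  have pair: "pair_sigma_finite (lborel :: 'a measure) (lborel :: real measure)" ..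
  have sl_sq: "AE t in lborel. integrable lborel (\<lambda>x. (norm (g (x, t)))\<^sup>2)"
    if "integrable lborel (\<lambda>z. (norm (g z))\<^sup>2)" for g :: "'a \<times> real \<Rightarrow> 'd::euclidean_space"
    by (rule pair_sigma_finite.AE_integrable_snd[OF pair]) (use that in \<open>simp add: case_prod_beta' lborel_prod\<close>)
  have sq_avg: "integrable lborel (\<lambda>z. (norm (?f z))\<^sup>2)" "integrable lborel (\<lambda>z. (norm (?F z))\<^sup>2)"
    by (rule average_along_square_integrable[OF f sqf] average_along_square_integrable[OF F sqF])+
  have "AE t in lborel. H1_grad \<Omega> (\<lambda>x. ?f (x, t)) (\<lambda>x. ?F (x, t))"
    using AE_shifted[OF good, of 1] integrable_average_slices[OF L1(1)] integrable_average_slices[OF L1(2)]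
      sl_sq[OF sq_avg(1)] sl_sq[OF sq_avg(2)]
  proof eventually_elim
    case (elim t)
    have \<Omega>': "\<Omega> \<in> sets borel" "\<Omega> \<in> sets lebesgue" using \<Omega>(1) lebesgue_sets_open by auto
    have Lf: "Lp_on 2 \<Omega> (\<lambda>x. ?f (x, t))" and LF: "Lp_on 2 \<Omega> (\<lambda>x. ?F (x, t))"
      by (rule Lp[OF elim(4) slm \<Omega>'(1)] Lp[OF elim(5) slm \<Omega>'(1)]; fact)+
    show ?case unfolding H1_grad_def
    proof (intro conjI ballI Lf LF)
      fix i :: 'a assume i: "i \<in> Basis"
      have LFi: "Lp_on 2 \<Omega> (\<lambda>x. ?F (x, t) \<bullet> i)"
        by (rule Lp_on_2_bound[OF LF, where C=1])
          (use LF i in \<open>auto simp: Lp_on_def Basis_le_norm intro: borel_measurable_inner\<close>)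
      show "weak_deriv \<Omega> i (\<lambda>x. ?f (x, t)) (\<lambda>x. ?F (x, t) \<bullet> i)"
        unfolding weak_deriv_def
      proof (intro conjI ballI)
        show "L1_loc \<Omega> (\<lambda>x. ?f (x, t))" "L1_loc \<Omega> (\<lambda>x. ?F (x, t) \<bullet> i)"
          by (rule Lp_on_2_imp_L1_loc[OF _ \<Omega>'(2)], fact)+
        fix \<zeta> assume \<zeta>: "\<zeta> \<in> Cinf_c \<Omega>"
        let ?D = "\<lambda>x. frechet_derivative \<zeta> (at x) i"
        obtain K where K: "compact K" "\<And>x. x \<notin> K \<Longrightarrow> \<zeta> x = 0" "\<And>x. x \<notin> K \<Longrightarrow> ?D x = 0"
          by (rule Cinf_c_support[OF \<zeta>]) blast
        obtain B1 where B1: "\<And>x. norm (\<zeta> x) \<le> B1"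
          using bounded_if_continuous_compact_support[OF Cinf_c_facts(2)[OF \<zeta>] K(1,2)] by blast
        obtain B2 where B2: "\<And>x. norm (?D x) \<le> B2"
          using bounded_if_continuous_compact_support[OF Cinf_c_facts(4)[OF \<zeta> i] K(1,3)] by blast
        have "(LBINT x. ?f (x, t) * ?D x) = - (LBINT x. (?F (x, t) \<bullet> i) * \<zeta> x)"
        proof (rule weak_deriv_average_slice[OF elim(2,3) _ Cinf_c_facts(4)[OF \<zeta> i] _ Cinf_c_facts(2)[OF \<zeta>]])
          show "\<bar>?D x\<bar> \<le> max B1 B2" "\<bar>\<zeta> x\<bar> \<le> max B1 B2" for x using B1[of x] B2[of x] by auto
          show "AE r in M. (LBINT x. f (x, t - r) * ?D x) = - (LBINT x. (F (x, t - r) \<bullet> i) * \<zeta> x)"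
            using elim(1) by eventually_elim (use i \<zeta> in \<open>simp add: good_def\<close>)
        qed
        then show "integral\<^sup>L (lebesgue_on \<Omega>) (\<lambda>x. ?f (x, t) * ?D x) =
            - integral\<^sup>L (lebesgue_on \<Omega>) (\<lambda>x. (?F (x, t) \<bullet> i) * \<zeta> x)"
          using test[OF slm Cinf_c_facts(4)[OF \<zeta> i] \<zeta>0(2)[OF \<zeta>], of ?f t]
            test[OF borel_measurable_inner[OF slm borel_measurable_const] Cinf_c_facts(2)[OF \<zeta>] \<zeta>0(1)[OF \<zeta>], of ?F t i]
          by simp
      qed
    qed
  qed
  then have "AE t in lebesgue_on {0<..<T}. H1_grad \<Omega> (\<lambda>x. ?f (x, t)) (\<lambda>x. ?F (x, t))"
    by (subst AE_lebesgue_on_iff) (auto elim: eventually_mono)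
  then show ?thesis unfolding L2H1_grad_def using S(2) sq_avg by (intro conjI Lp) auto
qed

end


section \<open>Steklov averages\<close>

text \<open>
  The uniform distribution on \<open>[0,h]\<close>.
\<close>

definition steklov :: "real \<Rightarrow> real measure" where
  "steklov h = density lborel (\<lambda>r. ennreal (indicator {0..h} r / h))"

lemma real_distribution_steklov:
  assumes "0 < h"
  shows "real_distribution (steklov h)"
proof -
  have "emeasure (steklov h) UNIV = (\<integral>\<^sup>+r. ennreal (1 / h) * indicator {0..h} r \<partial>lborel)"
    unfolding steklov_def using assms
    by (subst emeasure_density) (auto intro!: nn_integral_cong split: split_indicator)
  also have "\<dots> = ennreal (1 / h) * ennreal h"
    using assms by (subst nn_integral_cmult_indicator) auto
  also have "\<dots> = 1" using assms by (simp add: ennreal_mult[symmetric])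
  finally have "prob_space (steklov h)" by (intro prob_spaceI) (simp add: steklov_def)
  then show ?thesis by (simp add: real_distribution_def real_distribution_axioms_def steklov_def)
qed

lemma AE_steklov:
  assumes "\<And>r. 0 \<le> r \<Longrightarrow> r \<le> h \<Longrightarrow> P r"
  shows "AE r in steklov h. P r"
  unfolding steklov_def using assms by (subst AE_density) (auto simp: indicator_def)

lemma integral_steklov:
  assumes "f \<in> borel_measurable borel" "0 < h"
  shows "(\<integral>r. f r \<partial>steklov h) = (LBINT r. f r * indicator {0..h} r) / (h::real)"
  unfolding steklov_def using assms by (subst integral_density) (auto simp: mult_ac)

text \<open>The average over \<open>[0,h]\<close> gains a derivative in the direction of averaging.\<close>

text \<open>
  On the line through \<open>z\<close> the average is the difference quotient \<open>(P s - P (s - h)) / h\<close> of a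
  primitive \<open>P\<close> of \<open>g\<close>.
\<close>

lemma has_line_deriv_steklov:
  fixes g :: "'c::euclidean_space \<Rightarrow> real"
  assumes g: "continuous_on UNIV g" and h: "0 < h"
  shows "has_line_deriv (average_along (steklov h) e g) e (\<lambda>z. (g z - g (z - h *\<^sub>R e)) / h)"
  unfolding has_line_deriv_def
proof
  fix z
  define k where "k = (\<lambda>s. g (z + s *\<^sub>R e))"
  have k: "continuous_on UNIV k" unfolding k_def
    by (intro continuous_on_compose2[OF g] continuous_intros) auto
  have [measurable]: "g \<in> borel_measurable borel" using g by (rule borel_measurable_continuous_onI)
  \<comment> \<open>The lower limit leaves room for \<open>s - h\<close> with \<open>|s| < 1\<close> in the interior of the interval.\<close>
  define P where "P = (\<lambda>s. integral {- h - 2..s} k)"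
  have P: "(P has_real_derivative k s) (at s)" if "- h - 2 < s" for s
  proof -
    have "(P has_real_derivative k s) (at s within {- h - 2..s + 1})"
      unfolding P_def using that
      by (intro integral_has_real_derivative continuous_on_subset[OF k]) auto
    moreover have "at s within {- h - 2..s + 1} = at s"
      using that by (intro at_within_interior) auto
    ultimately show ?thesis by simp
  qed
  have avg: "average_along (steklov h) e g (z + s *\<^sub>R e) = (P s - P (s - h)) / h" if "\<bar>s\<bar> < 1" for s
  proof -
    have "(LBINT r. k (s - r) * indicator {0..h} r) = (- P (s - h)) - (- P (s - 0))"
    proof (rule integral_FTC_Icc_real)
      fix r assume "0 \<le> r" "r \<le> h"
      then have "- h - 2 < s - r" using that by auto
      then have "((\<lambda>r. P (s - r)) has_real_derivative k (s - r) * (- 1)) (at r)"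
        by (intro DERIV_chain2[OF P]) (auto intro!: derivative_eq_intros)
      then show "((\<lambda>r. - P (s - r)) has_real_derivative k (s - r)) (at r)"
        by (auto dest: DERIV_minus)
      have "continuous_on UNIV (\<lambda>r. k (s - r))"
        by (intro continuous_on_compose2[OF k] continuous_intros) auto
      then show "isCont (\<lambda>r. k (s - r)) r" by (simp add: continuous_on_eq_continuous_at)
    qed (use h in auto)
    then show ?thesis using h
      by (simp add: average_along_def integral_steklov k_def algebra_simps)
  qed
  have "((\<lambda>s. (P s - P (s - h)) / h) has_real_derivative (k 0 - k (0 - h) * 1) / h) (at 0)"
    by (intro DERIV_cdivide DERIV_diff P DERIV_chain2[OF P, of "\<lambda>s. s - h"])
      (use h in \<open>auto intro!: derivative_eq_intros\<close>)
  then have d: "((\<lambda>s. (P s - P (s - h)) / h) has_real_derivative (g z - g (z - h *\<^sub>R e)) / h) (at 0)"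
    by (simp add: k_def)
  have "\<forall>\<^sub>F s in nhds 0. s \<in> ball 0 (1::real)" by (intro eventually_nhds_in_open) auto
  then have "\<forall>\<^sub>F s in nhds 0. average_along (steklov h) e g (z + s *\<^sub>R e) = (P s - P (s - h)) / h"
    by eventually_elim (use avg in auto)
  with d show "((\<lambda>s. average_along (steklov h) e g (z + s *\<^sub>R e)) has_real_derivative (g z - g (z - h *\<^sub>R e)) / h) (at 0)"
    by (subst DERIV_cong_ev) auto
qed


section \<open>Continuous functions and elementary inequalities\<close>

lemma continuous_on_UNIV_if_compact_support:
  fixes f :: "'a::euclidean_space \<Rightarrow> 'b::real_normed_vector"
  assumes "open S" "continuous_on S f" "compact K" "K \<subseteq> S" "\<And>x. x \<notin> K \<Longrightarrow> f x = 0"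
  shows "continuous_on UNIV f"
proof -
  have "continuous_on (- K) f"
    by (rule continuous_on_eq[of _ "\<lambda>_. 0"]) (use assms in auto)
  then have "continuous_on (S \<union> - K) f"
    using assms by (intro continuous_on_open_Un) (auto intro: compact_imp_closed)
  moreover have "S \<union> - K = UNIV" using assms by auto
  ultimately show ?thesis by simp
qed

lemma uniformly_continuous_if_compact_support:
  fixes f :: "'a::euclidean_space \<Rightarrow> 'b::real_normed_vector"
  assumes "continuous_on UNIV f" "compact K" "\<And>x. x \<notin> K \<Longrightarrow> f x = 0"
  shows "uniformly_continuous_on UNIV f"
  unfolding uniformly_continuous_on_def
proof (intro allI impI)
  fix e :: real assume e: "e > 0"
  obtain R where R: "\<And>x. x \<in> K \<Longrightarrow> norm x \<le> R"
    using compact_imp_bounded[OF assms(2)] by (auto simp: bounded_iff)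
  have "uniformly_continuous_on (cball 0 (R + 1)) f"
    by (intro compact_uniformly_continuous continuous_on_subset[OF assms(1)]) auto
  from this[unfolded uniformly_continuous_on_def, rule_format, OF e]
  obtain d where d: "d > 0" "\<And>x x'. x \<in> cball 0 (R + 1) \<Longrightarrow> x' \<in> cball 0 (R + 1) \<Longrightarrow> dist x' x < d \<Longrightarrow> dist (f x') (f x) < e"
    by blast
  have "dist (f x') (f x) < e" if "dist x' x < min d 1" for x x'
  proof (cases "x \<in> K \<or> x' \<in> K")
    case True
    have "norm x \<le> norm x' + dist x' x" "norm x' \<le> norm x + dist x' x"
      using norm_triangle_sub[of x x'] norm_triangle_sub[of x' x] by (auto simp: dist_norm norm_minus_commute)
    then have "norm x \<le> R + 1" "norm x' \<le> R + 1"
      using True R[of x] R[of x'] that by auto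
    then show ?thesis using d(2) that by auto
  next
    case False
    then show ?thesis using assms(3) e by simp
  qed
  then show "\<exists>d>0. \<forall>x\<in>UNIV. \<forall>x'\<in>UNIV. dist x' x < d \<longrightarrow> dist (f x') (f x) < e"
    using d(1) by (intro exI[of _ "min d 1"]) auto
qed

text \<open>
  The set where \<open>f\<close> is negative is open, so it is empty if it is a null set.
\<close>

lemma continuous_nonneg_if_AE:
  fixes f :: "'a::euclidean_space \<Rightarrow> real"
  assumes "open S" "continuous_on S f" "AE x in lebesgue_on S. 0 \<le> f x" "x \<in> S"
  shows "0 \<le> f x"
proof (rule ccontr)
  assume "\<not> 0 \<le> f x"
  let ?N = "S \<inter> f -` {..<0}"
  have "open ?N" using assms by (intro continuous_open_preimage) auto
  moreover have "AE x in lebesgue. x \<notin> ?N"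
    using assms(3) lebesgue_sets_open[OF assms(1)]
    by (subst (asm) AE_restrict_space_iff) (auto elim: eventually_mono)
  then have "negligible ?N"
    unfolding negligible_iff_null_sets by (rule iffD2[OF AE_iff_null_sets[OF lebesgue_sets_open[OF \<open>open ?N\<close>]]])
  ultimately have "?N = {}" using open_not_negligible by blast
  with \<open>\<not> 0 \<le> f x\<close> assms(4) show False by auto
qed

lemma compact_shift_in_open:
  fixes A V :: "real set"
  assumes "compact A" "open V" "A \<subseteq> V"
  obtains h where "0 < h" "\<And>t r. t \<in> A \<Longrightarrow> \<bar>r\<bar> \<le> h \<Longrightarrow> t - r \<in> V"
proof -
  obtain h where h: "0 < h" "(\<Union>t\<in>A. cball t h) \<subseteq> V"
    using compact_subset_open_imp_cball_epsilon_subset[OF assms] by blast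
  have "t - r \<in> V" if "t \<in> A" "\<bar>r\<bar> \<le> h" for t r
  proof -
    have "t - r \<in> cball t h" using that(2) by (simp add: dist_real_def)
    with that(1) h(2) show ?thesis by blast
  qed
  with h(1) show thesis by (rule that)
qed

lemma difference_quotient_near:
  fixes a a' :: "real \<Rightarrow> real"
  assumes "\<And>t. (a has_real_derivative a' t) (at t)" "0 < h"
    and "\<And>t r. 0 \<le> r \<Longrightarrow> r \<le> h \<Longrightarrow> \<bar>a' (t + r) - a' t\<bar> \<le> \<epsilon>"
  shows "\<bar>(a (t + h) - a t) / h - a' t\<bar> \<le> \<epsilon>"
proof -
  obtain z where z: "t < z" "z < t + h" "a (t + h) - a t = (t + h - t) * a' z"
    using MVT2[of t "t + h" a a'] assms(1,2) by auto
  then have "(a (t + h) - a t) / h = a' (t + (z - t))" using assms(2) by simp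
  with assms(3)[of "z - t" t] z show ?thesis by simp
qed

lemma frechet_derivative_zero_where_constant:
  assumes "open V" "x \<in> V" "\<And>y. y \<in> V \<Longrightarrow> f y = c"
  shows "frechet_derivative f (at x) e = 0"
proof -
  have "(f has_derivative (\<lambda>_. 0)) (at x)"
    by (rule has_derivative_transform_within_open[OF has_derivative_const assms(1,2)]) (use assms(3) in simp)
  from frechet_derivative_at[OF this] show ?thesis by metis
qed

lemma gradient_zero_where_constant:
  assumes "open V" "x \<in> V" "\<And>y. y \<in> V \<Longrightarrow> f y = c"
  shows "gradient f x = 0"
  using frechet_derivative_zero_where_constant[OF assms] by (simp add: gradient_def)

text \<open>Young's inequality, in the form of convexity of \<open>y \<mapsto> m/(m+1) y^((m+1)/m)\<close>, evaluated at \<open>y = a^m\<close> and \<open>y = b^m\<close>.\<close>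

lemma power_m_convexity:
  fixes a b m :: real
  assumes "0 \<le> a" "0 \<le> b" "0 < m"
  shows "m / (m + 1) * (a powr (m + 1) - b powr (m + 1)) \<le> a * (a powr m - b powr m)"
proof -
  have "a * b powr m \<le> a powr (m + 1) / (m + 1) + (b powr m) powr ((m + 1) / m) / ((m + 1) / m)"
    using assms by (intro Youngs_inequality) (auto simp: field_simps)
  also have "(b powr m) powr ((m + 1) / m) = b powr (m + 1)"
    using assms by (simp add: powr_powr)
  finally have 1: "a * b powr m \<le> a powr (m + 1) / (m + 1) + m / (m + 1) * b powr (m + 1)"
    using assms by (simp add: mult.commute)
  have 2: "a * a powr m = a powr (m + 1)"
    using assms by (cases "a = 0") (auto simp: powr_add)
  have 3: "a powr (m + 1) / (m + 1) = a powr (m + 1) - m / (m + 1) * a powr (m + 1)"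
    using assms by (simp add: field_simps)
  show ?thesis using 1 2 3 by (simp add: right_diff_distrib)
qed

lemma C_Lp_if_continuous:
  fixes v :: "'a::euclidean_space \<times> real \<Rightarrow> real"
  assumes v: "continuous_on UNIV v" and \<Omega>: "open \<Omega>" "bounded \<Omega>" and p: "0 < p"
  shows "C_Lp T p \<Omega> v"
  unfolding C_Lp_def
proof (intro exI[of _ "\<lambda>t x. v (x, t)"] conjI ballI)
  have sl: "continuous_on UNIV (\<lambda>x. v (x, t))" for t
    by (intro continuous_on_compose2[OF v] continuous_intros) auto
  have \<Omega>m: "\<Omega> \<in> lmeasurable" using \<Omega> by (simp add: lmeasurable_open)
  show "Lp_on p \<Omega> (\<lambda>x. v (x, t))" for t
    using \<Omega> by (intro Lp_on_continuous[OF sl _ _ p]) (auto intro: lebesgue_sets_open)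
  fix s assume s: "s \<in> {0..T}"
  define A where "A = measure lebesgue \<Omega> powr (1 / p)"
  have A: "0 \<le> A" by (simp add: A_def)
  show "((\<lambda>t. Lp_norm p \<Omega> (\<lambda>x. v (x, t) - v (x, s))) \<longlongrightarrow> 0) (at s within {0..T})"
  proof (rule tendstoI)
    fix e :: real assume e: "e > 0"
    define e' where "e' = e / (A + 1)"
    have e': "0 < e'" using e A by (simp add: e'_def)
    have "uniformly_continuous_on (closure \<Omega> \<times> {0..T}) v"
      using \<Omega> by (intro compact_uniformly_continuous continuous_on_subset[OF v] compact_Times) auto
    from this[unfolded uniformly_continuous_on_def, rule_format, OF e']
    obtain d where d: "d > 0" "\<And>z z'. z \<in> closure \<Omega> \<times> {0..T} \<Longrightarrow> z' \<in> closure \<Omega> \<times> {0..T} \<Longrightarrow>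
        dist z' z < d \<Longrightarrow> dist (v z') (v z) < e'" by blast
    have "Lp_norm p \<Omega> (\<lambda>x. v (x, t) - v (x, s)) < e" if t: "t \<in> {0..T}" "dist t s < d" for t
    proof -
      have le: "norm (v (x, t) - v (x, s)) \<le> e'" if "x \<in> \<Omega>" for x
        using d(2)[of "(x, s)" "(x, t)"] that t s closure_subset[of \<Omega>]
        by (auto simp: dist_Pair_Pair dist_norm subset_iff less_imp_le)
      have "Lp_on p \<Omega> (\<lambda>x. v (x, t) - v (x, s))"
        using \<Omega> by (intro Lp_on_continuous[OF _ _ _ p] continuous_intros sl) (auto intro: lebesgue_sets_open)
      moreover have "integrable (lebesgue_on \<Omega>) (\<lambda>_. e' powr p)"
        using integrable_mult_right[of "e' powr p" "lebesgue_on \<Omega>" "\<lambda>_. 1"] Lp_on_bounded[of "\<lambda>_. 1 :: real" \<Omega> 1 p] \<Omega>m p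
        by (simp add: Lp_on_def)
      ultimately have "(\<integral>x. norm (v (x, t) - v (x, s)) powr p \<partial>lebesgue_on \<Omega>) \<le> (\<integral>x. e' powr p \<partial>lebesgue_on \<Omega>)"
        using le p
        by (intro integral_mono) (auto simp: Lp_on_def intro: powr_mono2)
      also have "\<dots> = measure lebesgue \<Omega> * e' powr p"
        using \<Omega>m by (simp add: measure_restrict_space fmeasurableD)
      finally have "Lp_norm p \<Omega> (\<lambda>x. v (x, t) - v (x, s)) \<le> (measure lebesgue \<Omega> * e' powr p) powr (1 / p)"
        unfolding Lp_norm_def using p by (intro powr_mono2) auto
      also have "\<dots> = A * e'"
        using p e' by (simp add: A_def powr_mult powr_powr)
      also have "\<dots> < e" using e A by (simp add: e'_def field_simps)
      finally show ?thesis .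
    qed
    moreover have "0 \<le> Lp_norm p \<Omega> (\<lambda>x. v (x, t) - v (x, s))" for t by (simp add: Lp_norm_def)
    ultimately show "\<forall>\<^sub>F t in at s within {0..T}. dist (Lp_norm p \<Omega> (\<lambda>x. v (x, t) - v (x, s))) 0 < e"
      unfolding eventually_at using d(1) by (auto simp: dist_real_def)
  qed
qed auto



section \<open>The comparison functions\<close>

text \<open>
  The data of the argument that do not depend on the averaging length. \<open>M\<close> bounds \<open>\<psi>\<^sup>m\<close>, and \<open>G\<close> is a Borel
  version of \<open>\<nabla>u\<^sup>m\<close>. The cutoffs are nested: \<open>\<eta>\<close> and \<open>\<alpha>\<close> are \<open>1\<close> with vanishing derivatives on the set \<open>K\<phi>\<close>
  that carries \<open>\<phi>\<close>, while \<open>\<eta>2\<close> and \<open>\<beta>\<close> are \<open>1\<close> on the sets \<open>K\<eta>\<close> and \<open>K\<alpha>\<close> that carry \<open>\<eta>\<close> and \<open>\<alpha>\<close>.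
  The open set \<open>W\<close> around \<open>K\<alpha>\<close> is where \<open>\<beta> = 1\<close>: it contains the slightly earlier times that an average
  reaches. The number \<open>s\<close> is so small that \<open>u\<^sup>m + s\<phi>\<close> respects the obstacle.
\<close>

locale obstacle_test =
  fixes \<Omega> :: "'a::euclidean_space set" and m T M s :: real
    and \<psi> u :: "'a \<times> real \<Rightarrow> real" and G :: "'a \<times> real \<Rightarrow> 'a"
    and \<eta> \<eta>2 :: "'a \<Rightarrow> real" and \<alpha> \<beta> :: "real \<Rightarrow> real" and \<phi> :: "'a \<times> real \<Rightarrow> real"
    and K\<eta> :: "'a set" and K\<alpha> W :: "real set" and K\<phi> :: "('a \<times> real) set"
  assumes m: "0 < m" and \<Omega>: "open \<Omega>" "bounded \<Omega>" and T: "0 < T"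
    and u_cont: "continuous_on (cyl \<Omega> T) u"
    and \<psi>_nonneg: "\<And>z. z \<in> cyl \<Omega> T \<Longrightarrow> 0 \<le> \<psi> z"
    and \<psi>_le_u: "\<And>z. z \<in> cyl \<Omega> T \<Longrightarrow> \<psi> z \<le> u z"
    and \<psi>_le_M: "\<And>z. z \<in> cyl \<Omega> T \<Longrightarrow> \<psi> z powr m \<le> M" and M: "0 \<le> M"
    and G_borel: "G \<in> borel_measurable borel" and G: "L2H1_grad 0 T \<Omega> (\<lambda>z. u z powr m) G"
    and G_zero: "\<And>z. z \<notin> cyl \<Omega> T \<Longrightarrow> G z = 0"
    and sol: "obstacle_local_weak_solution m \<Omega> T \<psi> u"
    and \<eta>: "\<eta> \<in> Cinf_c \<Omega>" "\<And>x. 0 \<le> \<eta> x"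
    and \<eta>2: "\<eta>2 \<in> Cinf_c \<Omega>" "\<And>x. 0 \<le> \<eta>2 x" "\<And>x. \<eta>2 x \<le> 1"
    and \<alpha>: "\<alpha> \<in> Cinf_c {0<..<T}" "\<And>t. 0 \<le> \<alpha> t"
    and \<beta>: "\<beta> \<in> Cinf_c {0<..<T}" "\<And>t. 0 \<le> \<beta> t" "\<And>t. \<beta> t \<le> 1"
    and K\<eta>: "\<And>x. x \<notin> K\<eta> \<Longrightarrow> \<eta> x = 0" "\<And>x. x \<notin> K\<eta> \<Longrightarrow> gradient \<eta> x = 0"
      "\<And>x. x \<in> K\<eta> \<Longrightarrow> \<eta>2 x = 1" "\<And>x. x \<in> K\<eta> \<Longrightarrow> gradient \<eta>2 x = 0"
    and K\<alpha>: "compact K\<alpha>" "\<And>t. t \<notin> K\<alpha> \<Longrightarrow> \<alpha> t = 0" "\<And>t. t \<notin> K\<alpha> \<Longrightarrow> frechet_derivative \<alpha> (at t) 1 = 0"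
    and W: "open W" "K\<alpha> \<subseteq> W" "\<And>t. t \<in> W \<Longrightarrow> \<beta> t = 1"
    and \<phi>: "\<phi> \<in> Cinf_c (cyl \<Omega> T)"
    and K\<phi>: "\<And>z. z \<notin> K\<phi> \<Longrightarrow> \<phi> z = 0" "\<And>z e. z \<notin> K\<phi> \<Longrightarrow> frechet_derivative \<phi> (at z) e = 0"
      "\<And>x t. (x, t) \<in> K\<phi> \<Longrightarrow> \<eta> x = 1 \<and> gradient \<eta> x = 0 \<and> \<alpha> t = 1 \<and> frechet_derivative \<alpha> (at t) 1 = 0"
    and s: "\<And>z. z \<in> K\<phi> \<Longrightarrow> \<psi> z powr m \<le> u z powr m + s * \<phi> z"
begin

abbreviation w :: "'a \<times> real \<Rightarrow> real" where "w z \<equiv> u z powr m"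

definition d\<alpha> :: "real \<Rightarrow> real" where "d\<alpha> t = frechet_derivative \<alpha> (at t) 1"

definition cutoff :: "'a \<times> real \<Rightarrow> real" where "cutoff z = \<beta> (snd z) * \<eta>2 (fst z)"

text \<open>
  \<open>u\<^sup>m - M\<close>, cut off to compact support, and its spatial gradient. Both are written as the product
  rules for \<open>L2H1_grad\<close> deliver them.
\<close>

definition Z :: "'a \<times> real \<Rightarrow> real" where "Z z = \<beta> (snd z) * (\<eta>2 (fst z) * (w z + - M))"

definition GZ :: "'a \<times> real \<Rightarrow> 'a" where
  "GZ z = \<beta> (snd z) *\<^sub>R (\<eta>2 (fst z) *\<^sub>R (G z + 0) + (w z + - M) *\<^sub>R gradient \<eta>2 (fst z))"

text \<open>
  \<open>ut\<close> and the power in \<open>\<rho>\<close> replace \<open>u\<close> in the integrands: on the supports of \<open>\<alpha>\<close> and \<open>\<eta>\<close> nothing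
  changes, but the integrands become continuous functions with compact support on the whole space.
\<close>

definition ut :: "'a \<times> real \<Rightarrow> real" where "ut z = cutoff z * u z"

definition \<rho> :: "'a \<times> real \<Rightarrow> real" where "\<rho> z = \<eta> (fst z) * ut z powr (m + 1)"

text \<open>The energy densities before and after the cutoff by \<open>\<eta>2\<close> and \<open>\<beta>\<close>.\<close>

definition k :: "'a \<times> real \<Rightarrow> real" where "k z = \<eta> (fst z) * (norm (G z))\<^sup>2"

definition k' :: "'a \<times> real \<Rightarrow> real" where "k' z = \<eta> (fst z) * (norm (GZ z))\<^sup>2"

text \<open>
  The factors of \<open>\<epsilon>\<close> in the pointwise estimates of the time term and of the gradient term. Together with
  the contributions of the shifted cutoff they make up the constant \<open>error_bound\<close>.
\<close>

definition time_error :: "'a \<times> real \<Rightarrow> real" where "time_error z = 2 * (\<eta> (fst z) * \<bar>d\<alpha> (snd z)\<bar> * ut z)"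

definition energy_error :: "'a \<times> real \<Rightarrow> real" where
  "energy_error z = 2 * (\<alpha> (snd z) * (norm (G z) * norm (gradient \<eta> (fst z))))"

definition error_bound :: real where
  "error_bound = integral\<^sup>L lborel time_error + integral\<^sup>L lborel \<rho> + integral\<^sup>L lborel k / 2 + integral\<^sup>L lborel energy_error"

definition equation_integrand :: "'a \<times> real \<Rightarrow> real" where
  "equation_integrand z = - ut z * deriv_t \<phi> z + G z \<bullet> grad_x \<phi> z"

lemma cyl_sets: "cyl \<Omega> T \<in> sets lebesgue" "cyl \<Omega> T \<in> sets borel" and open_cyl: "open (cyl \<Omega> T)"
  and bounded_cyl: "bounded (cyl \<Omega> T)"
  using open_cylinder_sets[OF \<Omega>(1), of 0 T] open_Times[OF \<Omega>(1) open_greaterThanLessThan]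
    bounded_Times[OF \<Omega>(2) bounded_Ioo] by auto

lemma u_nonneg: "z \<in> cyl \<Omega> T \<Longrightarrow> 0 \<le> u z"
  using \<psi>_nonneg \<psi>_le_u order_trans by blast

lemma cont_fst: "continuous_on UNIV f \<Longrightarrow> continuous_on UNIV (\<lambda>z::'a \<times> real. f (fst z))"
  and cont_snd: "continuous_on UNIV g \<Longrightarrow> continuous_on UNIV (\<lambda>z::'a \<times> real. g (snd z))"
  for f :: "'a \<Rightarrow> 'c::topological_space" and g :: "real \<Rightarrow> 'd::topological_space"
  by (erule continuous_on_compose2; simp add: continuous_on_fst continuous_on_snd continuous_on_id)+

lemma cont_\<eta>: "continuous_on UNIV (\<lambda>z::'a \<times> real. \<eta> (fst z))"
  and cont_\<eta>2: "continuous_on UNIV (\<lambda>z::'a \<times> real. \<eta>2 (fst z))"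
  and cont_grad_\<eta>: "continuous_on UNIV (\<lambda>z::'a \<times> real. gradient \<eta> (fst z))"
  and cont_grad_\<eta>2: "continuous_on UNIV (\<lambda>z::'a \<times> real. gradient \<eta>2 (fst z))"
  and cont_\<alpha>: "continuous_on UNIV (\<lambda>z::'a \<times> real. \<alpha> (snd z))"
  and cont_\<beta>: "continuous_on UNIV (\<lambda>z::'a \<times> real. \<beta> (snd z))"
  and cont_d\<alpha>: "continuous_on UNIV (\<lambda>z::'a \<times> real. d\<alpha> (snd z))"
  using Cinf_c_facts(2)[OF \<eta>(1)] Cinf_c_facts(2)[OF \<eta>2(1)] gradient_Cinf_c(1)[OF \<eta>(1)]
    gradient_Cinf_c(1)[OF \<eta>2(1)] Cinf_c_facts(2)[OF \<alpha>(1)] Cinf_c_facts(2)[OF \<beta>(1)]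
    Cinf_c_facts(4)[OF \<alpha>(1), of 1]
  by (auto intro!: cont_fst cont_snd simp: d\<alpha>_def)

lemma \<alpha>_deriv: "(\<alpha> has_real_derivative d\<alpha> t) (at t)"
  using has_line_deriv_at[OF has_line_deriv_frechet[OF Cinf_c_facts(1)[OF \<alpha>(1)], of 1], of 0 t]
  by (simp add: d\<alpha>_def)

lemma cutoff_bounds: "0 \<le> cutoff z" "cutoff z \<le> 1"
  using \<eta>2 \<beta> by (auto simp: cutoff_def mult_le_one)

lemma cutoff_nonzero: "cutoff z \<noteq> 0 \<Longrightarrow> z \<in> cyl \<Omega> T"
  using Cinf_c_zero_outside(1)[OF \<eta>2(1)] Cinf_c_zero_outside(1)[OF \<beta>(1)]
  by (cases z) (auto simp: cutoff_def)

lemma cutoff_eq_1: "x \<in> K\<eta> \<Longrightarrow> t \<in> W \<Longrightarrow> cutoff (x, t) = 1"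
  using K\<eta>(3) W(3) by (simp add: cutoff_def)

lemma core_in_cyl: "x \<in> K\<eta> \<Longrightarrow> t \<in> W \<Longrightarrow> (x, t) \<in> cyl \<Omega> T"
  using cutoff_nonzero[of "(x, t)"] cutoff_eq_1[of x t] by simp

lemma cutoff_support:
  obtains K where "compact K" "K \<subseteq> cyl \<Omega> T" "\<And>z. z \<notin> K \<Longrightarrow> cutoff z = 0"
    "\<And>z. z \<notin> K \<Longrightarrow> \<beta> (snd z) *\<^sub>R gradient \<eta>2 (fst z) = 0"
proof -
  obtain K1 where K1: "compact K1" "K1 \<subseteq> \<Omega>" "\<And>x. x \<notin> K1 \<Longrightarrow> \<eta>2 x = 0"
    "\<And>x e. x \<notin> K1 \<Longrightarrow> frechet_derivative \<eta>2 (at x) e = 0"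
    by (rule Cinf_c_support[OF \<eta>2(1)]) blast
  obtain K2 where K2: "compact K2" "K2 \<subseteq> {0<..<T}" "\<And>x. x \<notin> K2 \<Longrightarrow> \<beta> x = 0"
    by (rule Cinf_c_support[OF \<beta>(1)]) blast
  show thesis
  proof (rule that[of "K1 \<times> K2"])
    show "compact (K1 \<times> K2)" using K1(1) K2(1) by (rule compact_Times)
    show "K1 \<times> K2 \<subseteq> cyl \<Omega> T" using K1(2) K2(2) by auto
    show "z \<notin> K1 \<times> K2 \<Longrightarrow> cutoff z = 0" for z using K1(3) K2(3) by (cases z) (auto simp: cutoff_def)
    show "z \<notin> K1 \<times> K2 \<Longrightarrow> \<beta> (snd z) *\<^sub>R gradient \<eta>2 (fst z) = 0" for z
      using K1(4) K2(3) by (cases z) (auto simp: gradient_def)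
  qed
qed

lemma continuous_cutoff: "continuous_on UNIV cutoff"
  unfolding cutoff_def[abs_def] by (intro continuous_intros cont_\<beta> cont_\<eta>2)

lemma continuous_cutoff_times:
  assumes "continuous_on (cyl \<Omega> T) g"
  shows "continuous_on UNIV (\<lambda>z. cutoff z * g z)"
proof -
  obtain K where K: "compact K" "K \<subseteq> cyl \<Omega> T" "\<And>z. z \<notin> K \<Longrightarrow> cutoff z = 0"
    by (rule cutoff_support) blast
  show ?thesis
    by (rule continuous_on_UNIV_if_compact_support[OF open_cyl _ K(1,2)])
      (use K(3) in \<open>auto intro!: continuous_intros assms continuous_on_subset[OF continuous_cutoff]\<close>)
qed

lemma w_cont: "continuous_on (cyl \<Omega> T) w"
  using m u_nonneg by (intro continuous_on_powr' u_cont continuous_on_const) auto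

lemma Z_eq: "Z z = cutoff z * (w z - M)"
  by (simp add: Z_def cutoff_def)

lemma Z_cont: "continuous_on UNIV Z"
  unfolding Z_eq[abs_def] by (intro continuous_cutoff_times continuous_intros w_cont)

lemma ut_cont: "continuous_on UNIV ut"
  unfolding ut_def[abs_def] by (rule continuous_cutoff_times[OF u_cont])

lemma ut_nonneg: "0 \<le> ut z"
  using cutoff_bounds(1)[of z] u_nonneg[OF cutoff_nonzero, of z] by (cases "cutoff z = 0") (auto simp: ut_def)

lemma Z_zero: "z \<notin> cyl \<Omega> T \<Longrightarrow> Z z = 0" and ut_zero: "z \<notin> cyl \<Omega> T \<Longrightarrow> ut z = 0"
  using cutoff_nonzero[of z] by (auto simp: Z_eq ut_def)

lemma Z_support: obtains K where "compact K" "\<And>z. z \<notin> K \<Longrightarrow> Z z = 0"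
  by (rule cutoff_support) (use Z_eq in auto)

lemma ut_support: obtains K where "compact K" "\<And>z. z \<notin> K \<Longrightarrow> ut z = 0"
  by (rule cutoff_support) (use ut_def in auto)

lemma Z_unif: "uniformly_continuous_on UNIV Z"
  by (rule Z_support) (rule uniformly_continuous_if_compact_support[OF Z_cont])

lemma Z_bounded: obtains B where "\<And>z. \<bar>Z z\<bar> \<le> B"
proof -
  obtain K where "compact K" "\<And>z. z \<notin> K \<Longrightarrow> Z z = 0" by (rule Z_support) blast
  from bounded_if_continuous_compact_support[OF Z_cont this] show thesis
    using that by (metis real_norm_def)
qed

text \<open>\<open>M + Z\<close> is a convex combination of \<open>u\<^sup>m\<close> and \<open>M\<close>.\<close>

lemma truncated_nonneg: "0 \<le> M + Z z"
proof -
  have "M + Z z = cutoff z * w z + (1 - cutoff z) * M" by (simp add: Z_eq algebra_simps)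
  then show ?thesis using cutoff_bounds[of z] M by simp
qed

lemma obstacle_le_truncated:
  assumes "z \<in> cyl \<Omega> T"
  shows "\<psi> z powr m \<le> M + Z z"
proof -
  have "\<psi> z powr m \<le> w z" using assms \<psi>_nonneg \<psi>_le_u m by (intro powr_mono2) auto
  then have "cutoff z * (\<psi> z powr m) + (1 - cutoff z) * (\<psi> z powr m) \<le> cutoff z * w z + (1 - cutoff z) * M"
    using cutoff_bounds[of z] \<psi>_le_M[OF assms] by (intro add_mono mult_left_mono) auto
  then show ?thesis by (simp add: Z_eq algebra_simps)
qed

lemma core_values:
  assumes "x \<in> K\<eta>" "t \<in> W"
  shows "ut (x, t) = u (x, t)" "Z (x, t) = w (x, t) - M" "GZ (x, t) = G (x, t)"
  using cutoff_eq_1[OF assms] assms K\<eta>(3,4) W(3) by (auto simp: ut_def Z_eq GZ_def)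

lemma K\<phi>_core: assumes "(x, t) \<in> K\<phi>" shows "x \<in> K\<eta>" "t \<in> K\<alpha>" "t \<in> W"
  using K\<phi>(3)[OF assms] K\<eta>(1) K\<alpha>(2) W(2) by (metis zero_neq_one subsetD)+

lemma GZ_eq: "GZ z = cutoff z *\<^sub>R G z + (w z - M) *\<^sub>R (\<beta> (snd z) *\<^sub>R gradient \<eta>2 (fst z))"
  by (simp add: GZ_def cutoff_def scaleR_add_right mult.commute)

lemma GZ_borel: "GZ \<in> borel_measurable borel"
proof -
  obtain K where K: "compact K" "K \<subseteq> cyl \<Omega> T" "\<And>z. z \<notin> K \<Longrightarrow> \<beta> (snd z) *\<^sub>R gradient \<eta>2 (fst z) = 0"
    by (rule cutoff_support) blast
  have c: "continuous_on UNIV (\<lambda>z. (w z - M) *\<^sub>R (\<beta> (snd z) *\<^sub>R gradient \<eta>2 (fst z)))"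
    by (rule continuous_on_UNIV_if_compact_support[OF open_cyl _ K(1,2)])
      (use K(3) in \<open>auto intro!: continuous_intros w_cont continuous_on_subset[OF cont_\<beta>] continuous_on_subset[OF cont_grad_\<eta>2]\<close>)
  show ?thesis unfolding GZ_eq[abs_def]
    using borel_measurable_continuous_onI[OF c] borel_measurable_continuous_onI[OF continuous_cutoff] G_borel
    by measurable
qed

lemma GZ_zero: "z \<notin> cyl \<Omega> T \<Longrightarrow> GZ z = 0"
proof -
  obtain K where K: "compact K" "K \<subseteq> cyl \<Omega> T" "\<And>z. z \<notin> K \<Longrightarrow> cutoff z = 0"
    "\<And>z. z \<notin> K \<Longrightarrow> \<beta> (snd z) *\<^sub>R gradient \<eta>2 (fst z) = 0"
    by (rule cutoff_support) blast
  then show "z \<notin> cyl \<Omega> T \<Longrightarrow> GZ z = 0" unfolding GZ_eq by (metis add.right_neutral scaleR_zero_left scaleR_zero_right subsetD)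
qed

lemma L2H1_const: "L2H1_grad 0 T \<Omega> (\<lambda>z. c) (\<lambda>z. 0)"
  by (rule L2H1_grad_if_line_derivs) (use \<Omega> in \<open>auto simp: has_line_deriv_def\<close>)

lemma L2H1_Z: "L2H1_grad 0 T \<Omega> Z GZ"
  unfolding Z_def[abs_def] GZ_def[abs_def]
  by (rule L2H1_grad_mult_time[where B=1, OF L2H1_grad_mult_smooth[OF L2H1_grad_add[OF G L2H1_const \<Omega>(1)] \<Omega>(1) \<eta>2(1)]])
    (use Cinf_c_facts(2)[OF \<beta>(1)] \<beta> in auto)

lemma \<rho>_nonneg: "0 \<le> \<rho> z"
  using \<eta>(2) by (simp add: \<rho>_def)

lemma \<rho>_cont: "continuous_on UNIV \<rho>"
  unfolding \<rho>_def[abs_def] using m ut_nonneg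
  by (intro continuous_intros cont_\<eta> continuous_on_powr' ut_cont) auto

lemma integrable_if_vanishes_with_ut:
  assumes "continuous_on UNIV g" "\<And>z. ut z = 0 \<Longrightarrow> g z = 0"
  shows "integrable lborel (g :: _ \<Rightarrow> real)"
proof -
  obtain K where K: "compact K" "\<And>z. z \<notin> K \<Longrightarrow> ut z = 0" by (rule ut_support) blast
  show ?thesis by (rule integrable_if_continuous_compact_support[OF assms(1) K(1)]) (use K assms(2) in auto)
qed

lemma \<rho>_int: "integrable lborel \<rho>"
  by (rule integrable_if_vanishes_with_ut[OF \<rho>_cont]) (simp add: \<rho>_def)

lemma time_error_int: "integrable lborel time_error"
  by (rule integrable_if_vanishes_with_ut)
    (auto simp: time_error_def[abs_def] intro!: continuous_intros cont_\<eta> cont_d\<alpha> ut_cont)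

lemma G_Lp: "Lp_on 2 (cyl \<Omega> T) G"
  using G by (simp add: L2H1_grad_def)

lemma G_square_int: "integrable lborel (\<lambda>z. (norm (G z))\<^sup>2)"
  using G_Lp G_borel G_zero
  by (subst lebesgue_on_zero_outside(2)[symmetric, OF _ cyl_sets(2)]) (auto simp: Lp_on_2_iff)

lemma GZ_square_int: "integrable lborel (\<lambda>z. (norm (GZ z))\<^sup>2)"
  using L2H1_Z GZ_borel GZ_zero
  by (subst lebesgue_on_zero_outside(2)[symmetric, OF _ cyl_sets(2)]) (auto simp: L2H1_grad_def Lp_on_2_iff)

lemma \<eta>_bounded: obtains B where "\<And>x. \<bar>\<eta> x\<bar> \<le> B"
  using gradient_Cinf_c(3)[OF \<eta>(1)] by blast

lemma \<alpha>_bounded: obtains B where "\<And>x. \<bar>\<alpha> x\<bar> \<le> B"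
  using gradient_Cinf_c(3)[OF \<alpha>(1)] by blast

lemma k_int: "integrable lborel k" and k'_int: "integrable lborel k'"
  unfolding k_def[abs_def] k'_def[abs_def]
  by (rule \<eta>_bounded, rule integrable_bounded_times,
    rule G_square_int GZ_square_int, use borel_measurable_continuous_onI[OF cont_\<eta>] in simp, blast)+

lemma k'_le_k: "k' z \<le> k z" and k_nonneg: "0 \<le> k z" and k'_nonneg: "0 \<le> k' z"
proof -
  show "0 \<le> k z" "0 \<le> k' z" using \<eta>(2) by (auto simp: k_def k'_def)
  show "k' z \<le> k z"
  proof (cases "fst z \<in> K\<eta>")
    case True
    then have "GZ z = \<beta> (snd z) *\<^sub>R G z" using K\<eta>(3,4) by (simp add: GZ_def)
    then have "norm (GZ z) \<le> norm (G z)"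
      using \<beta>(2,3)[of "snd z"] mult_right_mono[of "\<beta> (snd z)" 1 "norm (G z)"] by simp
    then show ?thesis using \<eta>(2) by (auto simp: k_def k'_def intro!: mult_left_mono power_mono)
  qed (use K\<eta>(1) in \<open>simp add: k_def k'_def\<close>)
qed

lemma energy_error_int: "integrable lborel energy_error"
proof -
  have [measurable]: "G \<in> borel_measurable borel" "(\<lambda>z::'a \<times> real. \<alpha> (snd z)) \<in> borel_measurable borel"
    "(\<lambda>z::'a \<times> real. gradient \<eta> (fst z)) \<in> borel_measurable borel"
    using G_borel cont_\<alpha> cont_grad_\<eta> by (auto intro: borel_measurable_continuous_onI)
  have 1: "Lp_on 2 (cyl \<Omega> T) (\<lambda>z. norm (G z))" using G_Lp by (auto simp: Lp_on_2_iff)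
  have 2: "Lp_on 2 (cyl \<Omega> T) (\<lambda>z. \<alpha> (snd z) * norm (gradient \<eta> (fst z)))"
    by (rule Lp_on_continuous[OF _ bounded_cyl cyl_sets(1)])
      (auto intro!: continuous_intros cont_\<alpha> cont_grad_\<eta>)
  have "integrable (lebesgue_on (cyl \<Omega> T)) (\<lambda>z. norm (G z) * (\<alpha> (snd z) * norm (gradient \<eta> (fst z))))"
    using Lp_on_2_inner_integrable[OF 1 2] by simp
  then have "integrable lborel (\<lambda>z. norm (G z) * (\<alpha> (snd z) * norm (gradient \<eta> (fst z))))"
    using G_zero by (subst (asm) lebesgue_on_zero_outside(2)[OF _ cyl_sets(2)]) auto
  then show ?thesis unfolding energy_error_def[abs_def] by (simp add: mult_ac)
qed

lemma time_error_nonneg: "0 \<le> time_error z" and energy_error_nonneg: "0 \<le> energy_error z"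
  using \<eta>(2) \<alpha>(2) ut_nonneg by (auto simp: time_error_def energy_error_def)

lemma grad_x_cont: "continuous_on UNIV (grad_x \<phi>)" and deriv_t_cont: "continuous_on UNIV (deriv_t \<phi>)"
  unfolding grad_x_def[abs_def] deriv_t_def[abs_def]
  by (intro continuous_intros Cinf_c_facts(4)[OF \<phi>]; simp add: Basis_prod_def)+

lemma \<phi>_zero_off: "z \<notin> K\<phi> \<Longrightarrow> grad_x \<phi> z = 0" "z \<notin> K\<phi> \<Longrightarrow> deriv_t \<phi> z = 0"
  using K\<phi>(2) by (simp_all add: grad_x_def deriv_t_def)

lemma equation_integrand_int: "integrable lborel (\<lambda>z. ut z * deriv_t \<phi> z)" "integrable lborel (\<lambda>z. G z \<bullet> grad_x \<phi> z)"
proof -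
  show "integrable lborel (\<lambda>z. ut z * deriv_t \<phi> z)"
    by (rule integrable_if_vanishes_with_ut) (auto intro!: continuous_intros ut_cont deriv_t_cont)
  have [measurable]: "G \<in> borel_measurable borel" "grad_x \<phi> \<in> borel_measurable borel"
    using G_borel grad_x_cont by (auto intro: borel_measurable_continuous_onI)
  have "Lp_on 2 (cyl \<Omega> T) (grad_x \<phi>)"
    by (rule Lp_on_continuous[OF grad_x_cont bounded_cyl cyl_sets(1)]) auto
  from Lp_on_2_inner_integrable[OF G_Lp this]
  show "integrable lborel (\<lambda>z. G z \<bullet> grad_x \<phi> z)"
    using G_zero by (subst (asm) lebesgue_on_zero_outside(2)[OF _ cyl_sets(2)]) auto
qed

end


section \<open>The estimate for a fixed averaging length\<close>

text \<open>
  The length \<open>h\<close> is so small that the average at a time in \<open>K\<alpha>\<close> stays where \<open>\<beta> = 1\<close>, that \<open>Z\<close> and \<open>\<alpha>\<close>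
  vary by at most \<open>\<epsilon>\<close> over it, and that the difference quotient of \<open>\<alpha>\<close> is \<open>\<epsilon>\<close>-close to its derivative.
\<close>

locale obstacle_test_step = obstacle_test +
  fixes \<epsilon> h :: real
  assumes \<epsilon>: "0 < \<epsilon>" and h: "0 < h"
    and shift: "\<And>t r. t \<in> K\<alpha> \<Longrightarrow> 0 \<le> r \<Longrightarrow> r \<le> h \<Longrightarrow> t - r \<in> W"
    and Z_near: "\<And>z r. 0 \<le> r \<Longrightarrow> r \<le> h \<Longrightarrow> \<bar>Z (z - r *\<^sub>R (0, 1)) - Z z\<bar> \<le> \<epsilon>"
    and \<alpha>_near: "\<And>t r. 0 \<le> r \<Longrightarrow> r \<le> h \<Longrightarrow> \<bar>\<alpha> (t + r) - \<alpha> t\<bar> \<le> \<epsilon>"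
    and \<alpha>_quotient: "\<And>t. \<bar>(\<alpha> (t + h) - \<alpha> t) / h - d\<alpha> t\<bar> \<le> \<epsilon>"

sublocale obstacle_test_step \<subseteq> stek: real_distribution "steklov h"
  using h by (rule real_distribution_steklov)

context obstacle_test_step
begin

abbreviation avg :: "('a \<times> real \<Rightarrow> 'b::{banach, second_countable_topology}) \<Rightarrow> 'a \<times> real \<Rightarrow> 'b"
  where "avg \<equiv> average_along (steklov h) (0, 1)"

definition SZ :: "'a \<times> real \<Rightarrow> real" where "SZ = avg Z"

definition SGZ :: "'a \<times> real \<Rightarrow> 'a" where "SGZ = avg GZ"

text \<open>
  \<open>v_power\<close> is \<open>v\<^sup>m\<close>. The summand \<open>\<epsilon>\<close> compensates the error of the average, so that the
  obstacle is respected exactly.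
\<close>

definition v_power :: "'a \<times> real \<Rightarrow> real" where "v_power z = SZ z + (M + \<epsilon> + s * \<phi> z)"

definition v_power_grad :: "'a \<times> real \<Rightarrow> 'a" where "v_power_grad z = SGZ z + s *\<^sub>R grad_x \<phi> z"

definition v :: "'a \<times> real \<Rightarrow> real" where "v z = v_power z powr (1 / m)"

definition earlier :: "'a \<times> real \<Rightarrow> 'a \<times> real" where "earlier z = z - h *\<^sub>R (0, 1)"

definition d :: "'a \<times> real \<Rightarrow> real" where "d z = (Z z - Z (earlier z)) / h + s * deriv_t \<phi> z"

definition H :: "'a \<times> real \<Rightarrow> 'a" where
  "H z = \<eta> (fst z) *\<^sub>R (v_power_grad z + (-1) *\<^sub>R G z) + (v_power z + (-1) * w z) *\<^sub>R gradient \<eta> (fst z)"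

lemma SZ_near: "\<bar>SZ z - Z z\<bar> \<le> \<epsilon>"
proof -
  obtain B where B: "\<And>z. \<bar>Z z\<bar> \<le> B" by (rule Z_bounded) blast
  show ?thesis unfolding SZ_def
    by (rule stek.average_along_near[OF Z_cont _ B]) (rule AE_steklov, rule Z_near)
qed

lemma SZ_cont: "continuous_on UNIV SZ"
proof -
  obtain B where B: "\<And>z. \<bar>Z z\<bar> \<le> B" by (rule Z_bounded) blast
  show ?thesis unfolding SZ_def by (rule stek.continuous_on_average_along[OF Z_unif B])
qed

lemma \<phi>_cont: "continuous_on UNIV \<phi>" by (rule Cinf_c_facts(2)[OF \<phi>])

lemma v_power_cont: "continuous_on UNIV v_power"
  unfolding v_power_def[abs_def] by (intro continuous_intros SZ_cont \<phi>_cont)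

lemma obstacle_le_v_power: "z \<in> cyl \<Omega> T \<Longrightarrow> \<psi> z powr m \<le> v_power z" and v_power_nonneg: "0 \<le> v_power z"
proof -
  have 1: "M + Z z + s * \<phi> z \<le> v_power z" using SZ_near[of z] by (simp add: v_power_def)
  show "z \<in> cyl \<Omega> T \<Longrightarrow> \<psi> z powr m \<le> v_power z"
  proof (cases "z \<in> K\<phi>")
    case True
    obtain x t where z: "z = (x, t)" by (cases z)
    have "M + Z z = w z" using core_values(2)[of x t] K\<phi>_core[of x t] True z by simp
    then show ?thesis using 1 s[OF True] by simp
  next
    case False
    assume "z \<in> cyl \<Omega> T"
    from obstacle_le_truncated[OF this] show ?thesis using 1 K\<phi>(1)[OF False] by simp
  qed
  show "0 \<le> v_power z"
  proof (cases "z \<in> K\<phi>")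
    case True
    obtain x t where z: "z = (x, t)" by (cases z)
    have "M + Z z = w z" using core_values(2)[of x t] K\<phi>_core[of x t] True z by simp
    moreover have "0 \<le> \<psi> z powr m" by simp
    ultimately show ?thesis using 1 s[OF True] by linarith
  next
    case False
    then show ?thesis using 1 K\<phi>(1)[OF False] truncated_nonneg[of z] by simp
  qed
qed

lemma v_powr: "v z powr m = v_power z"
  using m v_power_nonneg[of z] by (simp add: v_def powr_powr)

lemma v_cont: "continuous_on UNIV v"
  unfolding v_def[abs_def] using m v_power_nonneg by (intro continuous_on_powr' v_power_cont continuous_on_const) auto

lemma obstacle_le_v: "z \<in> cyl \<Omega> T \<Longrightarrow> \<psi> z \<le> v z"
proof -
  assume z: "z \<in> cyl \<Omega> T"
  have "(\<psi> z powr m) powr (1 / m) \<le> v_power z powr (1 / m)"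
    using obstacle_le_v_power[OF z] m by (intro powr_mono2) auto
  then show ?thesis using \<psi>_nonneg[OF z] m by (simp add: v_def powr_powr)
qed

lemma L2H1_v_power: "L2H1_grad 0 T \<Omega> v_power v_power_grad"
proof -
  have 1: "L2H1_grad 0 T \<Omega> SZ SGZ" unfolding SZ_def SGZ_def
    by (rule stek.L2H1_grad_average[OF L2H1_Z \<Omega> _ GZ_borel Z_zero GZ_zero])
      (rule borel_measurable_continuous_onI[OF Z_cont])
  have "has_line_deriv (\<lambda>x. M + \<epsilon> + s * \<phi> (x, t)) i (\<lambda>x. (s *\<^sub>R grad_x \<phi> (x, t)) \<bullet> i)" if i: "i \<in> Basis" for i t
    unfolding has_line_deriv_def
  proof
    fix x
    have "has_line_deriv \<phi> (i, 0) (\<lambda>z. frechet_derivative \<phi> (at z) (i, 0))"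
      by (rule has_line_deriv_frechet[OF Cinf_c_facts(1)[OF \<phi>]])
    then have "((\<lambda>s. \<phi> (x + s *\<^sub>R i, t)) has_real_derivative frechet_derivative \<phi> (at (x, t)) (i, 0)) (at 0)"
      unfolding has_line_deriv_def by (auto dest: spec[of _ "(x, t)"])
    moreover have "grad_x \<phi> (x, t) \<bullet> i = frechet_derivative \<phi> (at (x, t)) (i, 0)"
      using i by (simp add: grad_x_def)
    ultimately show "((\<lambda>r. M + \<epsilon> + s * \<phi> (x + r *\<^sub>R i, t)) has_real_derivative (s *\<^sub>R grad_x \<phi> (x, t)) \<bullet> i) (at 0)"
      by (auto intro!: derivative_eq_intros)
  qed
  then have 2: "L2H1_grad 0 T \<Omega> (\<lambda>z. M + \<epsilon> + s * \<phi> z) (\<lambda>z. s *\<^sub>R grad_x \<phi> z)"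
    by (intro L2H1_grad_if_line_derivs \<Omega> continuous_intros \<phi>_cont grad_x_cont) auto
  show ?thesis unfolding v_power_def[abs_def] v_power_grad_def[abs_def] by (rule L2H1_grad_add[OF 1 2 \<Omega>(1)])
qed

lemma v_in_K_psi: "v \<in> K_psi m \<Omega> T \<psi>"
proof -
  have "v \<in> borel_measurable (lebesgue_on (cyl \<Omega> T))"
    by (rule borel_imp_lebesgue_on[OF borel_measurable_continuous_onI[OF v_cont]])
  moreover have "\<exists>F. L2H1_grad 0 T \<Omega> (\<lambda>z. v z powr m) F" using L2H1_v_power by (auto simp: v_powr)
  moreover have "C_Lp T (m + 1) \<Omega> v" using m by (intro C_Lp_if_continuous v_cont \<Omega>) auto
  moreover have "AE z in lebesgue_on (cyl \<Omega> T). \<psi> z \<le> v z"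
    by (rule AE_I2) (use obstacle_le_v in auto)
  ultimately show ?thesis by (simp add: K_psi_def)
qed

lemma earlier_simp: "earlier (x, t) = (x, t - h)" by (simp add: earlier_def)

lemma earlier_cont: "continuous_on UNIV earlier"
  unfolding earlier_def[abs_def] by (intro continuous_intros)

lemma cont_earlier: "continuous_on UNIV g \<Longrightarrow> continuous_on UNIV (\<lambda>z. g (earlier z))"
  by (erule continuous_on_compose2[OF _ earlier_cont]) simp

lemma d_cont: "continuous_on UNIV d"
  unfolding d_def[abs_def] using h by (intro continuous_intros cont_earlier Z_cont deriv_t_cont) auto

lemma time_deriv_v_power: "has_line_deriv v_power (0, 1) d"
  unfolding has_line_deriv_def
proof
  fix z
  have "((\<lambda>r. SZ (z + r *\<^sub>R (0, 1))) has_real_derivative (Z z - Z (earlier z)) / h) (at 0)"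
    unfolding SZ_def earlier_def
    by (rule has_line_deriv_steklov[OF Z_cont h, of "(0, 1)", unfolded has_line_deriv_def, THEN spec])
  moreover have "((\<lambda>r. \<phi> (z + r *\<^sub>R (0, 1))) has_real_derivative deriv_t \<phi> z) (at 0)"
    unfolding deriv_t_def
    by (rule has_line_deriv_frechet[OF Cinf_c_facts(1)[OF \<phi>], of "(0, 1)", unfolded has_line_deriv_def, THEN spec])
  ultimately show "((\<lambda>r. v_power (z + r *\<^sub>R (0, 1))) has_real_derivative d z) (at 0)"
    unfolding v_power_def d_def by (auto intro!: derivative_eq_intros simp del: scaleR_Pair)
qed

lemma v_in_K_psi': "K_psi'_deriv m \<Omega> T \<psi> v d"
proof -
  have "weak_deriv (cyl \<Omega> T) (0, 1) v_power d"
    by (rule weak_deriv_if_line_deriv[OF v_power_cont d_cont time_deriv_v_power open_cyl]) (simp add: Basis_prod_def)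
  moreover have "Lp_on ((m + 1) / m) (cyl \<Omega> T) d"
    using m by (intro Lp_on_continuous d_cont bounded_cyl cyl_sets) auto
  ultimately show ?thesis by (simp add: K_psi'_deriv_def v_in_K_psi v_powr)
qed

lemma \<alpha>_W1inf: "W1inf_0_nonneg T \<alpha> d\<alpha>"
proof -
  have c: "continuous_on UNIV \<alpha>" "continuous_on UNIV d\<alpha>"
    using Cinf_c_facts(2)[OF \<alpha>(1)] Cinf_c_facts(4)[OF \<alpha>(1), of 1] by (auto simp: d\<alpha>_def[abs_def])
  have b: "Linf_on {0<..<T} g" if g: "continuous_on UNIV g" "\<And>t. t \<notin> K\<alpha> \<Longrightarrow> g t = 0" for g
  proof -
    obtain B where "\<And>t. norm (g t) \<le> B"
      using bounded_if_continuous_compact_support[OF g(1) K\<alpha>(1) g(2)] by blast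
    then show ?thesis using g(1) unfolding Linf_on_def
      by (auto intro!: borel_imp_lebesgue_on borel_measurable_continuous_onI exI[of _ B])
  qed
  have "has_line_deriv \<alpha> 1 d\<alpha>"
    using has_line_deriv_frechet[OF Cinf_c_facts(1)[OF \<alpha>(1)], of 1] by (simp add: d\<alpha>_def[abs_def])
  then have "weak_deriv {0<..<T} 1 \<alpha> d\<alpha>" by (intro weak_deriv_if_line_deriv c) auto
  moreover have "\<alpha> 0 = 0" "\<alpha> T = 0" using Cinf_c_zero_outside(1)[OF \<alpha>(1)] by auto
  moreover have "Linf_on {0<..<T} \<alpha>" "Linf_on {0<..<T} d\<alpha>"
    using b[OF c(1)] b[OF c(2)] K\<alpha>(2,3) by (auto simp: d\<alpha>_def)
  ultimately show ?thesis using \<alpha>(2) c by (auto simp: W1inf_0_nonneg_def intro: continuous_on_subset)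
qed

lemma L2H1_H: "L2H1_grad 0 T \<Omega> (\<lambda>(x, t). \<eta> x * (v (x, t) powr m - u (x, t) powr m)) H"
proof -
  have "L2H1_grad 0 T \<Omega> (\<lambda>z. (-1) * w z) (\<lambda>z. (-1) *\<^sub>R G z)"
    by (rule L2H1_grad_mult_time[OF G, where \<beta>="\<lambda>_. -1" and B=1]) auto
  from L2H1_grad_mult_smooth[OF L2H1_grad_add[OF L2H1_v_power this \<Omega>(1)] \<Omega>(1) \<eta>(1)]
  have "L2H1_grad 0 T \<Omega> (\<lambda>z. \<eta> (fst z) * (v_power z + (-1) * w z)) H"
    unfolding H_def[abs_def] by simp
  then show ?thesis by (simp add: case_prod_beta' v_powr)
qed

text \<open>
  The two integrands of the variational inequality, with \<open>u\<close> and \<open>u\<^sup>m\<close> replaced by \<open>ut\<close> and \<open>M + Z\<close>. As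
  functions on the whole space they agree with the original ones, because the cutoffs vanish wherever
  the replacement changes anything.
\<close>

definition time_integrand :: "'a \<times> real \<Rightarrow> real" where
  "time_integrand z = \<eta> (fst z) * (d\<alpha> (snd z) * (1 / (m + 1) * ut z powr (m + 1) - ut z * v_power z) - \<alpha> (snd z) * ut z * d z)"

definition energy_integrand :: "'a \<times> real \<Rightarrow> real" where
  "energy_integrand z = \<alpha> (snd z) * (G z \<bullet> (\<eta> (fst z) *\<^sub>R (v_power_grad z - G z) + (v_power z - M - Z z) *\<^sub>R gradient \<eta> (fst z)))"

lemma K\<alpha>_W: "t \<in> K\<alpha> \<Longrightarrow> t \<in> W" using W(2) by blast

lemma time_integrand_eq: "\<eta> (fst z) * (d\<alpha> (snd z) * (1 / (m + 1) * u z powr (m + 1) - u z * v z powr m)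
    - \<alpha> (snd z) * u z * d z) = time_integrand z"
proof (cases "fst z \<in> K\<eta> \<and> snd z \<in> K\<alpha>")
  case True
  then have "ut z = u z" using core_values(1)[of "fst z" "snd z"] K\<alpha>_W by simp
  then show ?thesis by (simp add: time_integrand_def v_powr)
next
  case False
  then have "\<eta> (fst z) = 0 \<or> (\<alpha> (snd z) = 0 \<and> d\<alpha> (snd z) = 0)" using K\<eta>(1) K\<alpha>(2,3) by (auto simp: d\<alpha>_def)
  then show ?thesis by (auto simp: time_integrand_def)
qed

lemma energy_integrand_eq: "\<alpha> (snd z) * (G z \<bullet> H z) = energy_integrand z"
proof (cases "fst z \<in> K\<eta> \<and> snd z \<in> K\<alpha>")
  case True
  then have "Z z = w z - M" using core_values(2)[of "fst z" "snd z"] K\<alpha>_W by simp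
  then show ?thesis by (simp add: energy_integrand_def H_def)
next
  case False
  then have "(\<eta> (fst z) = 0 \<and> gradient \<eta> (fst z) = 0) \<or> \<alpha> (snd z) = 0" using K\<eta>(1,2) K\<alpha>(2) by auto
  then show ?thesis by (auto simp: energy_integrand_def H_def)
qed

lemma time_integrand_int: "integrable lborel time_integrand" and time_integrand_meas: "time_integrand \<in> borel_measurable borel"
proof -
  have c: "continuous_on UNIV time_integrand" unfolding time_integrand_def[abs_def] using m ut_nonneg
    by (intro continuous_intros cont_\<eta> cont_d\<alpha> cont_\<alpha> ut_cont v_power_cont d_cont continuous_on_powr') auto
  show "integrable lborel time_integrand" by (rule integrable_if_vanishes_with_ut[OF c]) (simp add: time_integrand_def)
  show "time_integrand \<in> borel_measurable borel" by (rule borel_measurable_continuous_onI[OF c])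
qed

lemma SGZ_borel: "SGZ \<in> borel_measurable borel"
  unfolding SGZ_def by (rule stek.borel_measurable_average_along[OF GZ_borel])

lemma energy_integrand_meas: "energy_integrand \<in> borel_measurable borel"
proof -
  have [measurable]: "G \<in> borel_measurable borel" "(\<lambda>z::'a \<times> real. \<alpha> (snd z)) \<in> borel_measurable borel"
    "(\<lambda>z::'a \<times> real. gradient \<eta> (fst z)) \<in> borel_measurable borel" "(\<lambda>z::'a \<times> real. \<eta> (fst z)) \<in> borel_measurable borel"
    "v_power \<in> borel_measurable borel" "Z \<in> borel_measurable borel" "SGZ \<in> borel_measurable borel"
    "grad_x \<phi> \<in> borel_measurable borel"
    using G_borel cont_\<alpha> cont_\<eta> cont_grad_\<eta> v_power_cont Z_cont SGZ_borel grad_x_cont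
    by (auto intro: borel_measurable_continuous_onI)
  have [measurable]: "v_power_grad \<in> borel_measurable borel" unfolding v_power_grad_def[abs_def] by measurable
  show ?thesis unfolding energy_integrand_def[abs_def] by measurable
qed

lemma energy_integrand_int: "integrable lborel energy_integrand"
proof -
  obtain B where B: "\<And>t. \<bar>\<alpha> t\<bar> \<le> B" by (rule \<alpha>_bounded) blast
  have "Lp_on 2 (cyl \<Omega> T) (\<lambda>z. \<alpha> (snd z) *\<^sub>R G z)"
    by (rule Lp_on_2_mult_bounded[OF G_Lp _ B])
      (rule borel_imp_lebesgue_on[OF borel_measurable_continuous_onI[OF cont_\<alpha>]])
  from Lp_on_2_inner_integrable[OF this, of H] L2H1_H
  have "integrable (lebesgue_on (cyl \<Omega> T)) energy_integrand"
    by (simp add: L2H1_grad_def energy_integrand_eq)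
  then show ?thesis
    by (subst (asm) lebesgue_on_zero_outside(2)[OF energy_integrand_meas cyl_sets(2)]) (simp add: energy_integrand_def G_zero)
qed

lemma tested: "0 \<le> integral\<^sup>L lborel time_integrand + integral\<^sup>L lborel energy_integrand"
proof -
  have \<eta>C1: "\<eta> \<in> C1_c \<Omega>" 
    using \<eta>(1) Cinf_c_facts(3)[OF \<eta>(1), of 1] by (simp only: Cinf_c_def C1_c_def mem_Collect_eq)
  have "0 \<le> time_term m \<Omega> T u v d \<eta> \<alpha> d\<alpha> +
      integral\<^sup>L (lebesgue_on (cyl \<Omega> T)) (\<lambda>(x, t). \<alpha> t * (G (x, t) \<bullet> H (x, t)))"
    using sol v_in_K_psi' \<eta>C1 \<eta>(2) \<alpha>_W1inf G L2H1_H unfolding obstacle_local_weak_solution_def by blast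
  also have "time_term m \<Omega> T u v d \<eta> \<alpha> d\<alpha> = integral\<^sup>L (lebesgue_on (cyl \<Omega> T)) time_integrand"
    unfolding time_term_def time_integrand_eq[symmetric, abs_def] by (simp add: case_prod_beta')
  also have "\<dots> = integral\<^sup>L lborel time_integrand"
    by (rule lebesgue_on_zero_outside(1)[OF time_integrand_meas cyl_sets(2)]) (simp add: time_integrand_def ut_zero)
  also have "integral\<^sup>L (lebesgue_on (cyl \<Omega> T)) (\<lambda>(x, t). \<alpha> t * (G (x, t) \<bullet> H (x, t))) =
      integral\<^sup>L (lebesgue_on (cyl \<Omega> T)) energy_integrand"
    unfolding energy_integrand_eq[symmetric, abs_def] by (simp add: case_prod_beta')
  also have "\<dots> = integral\<^sup>L lborel energy_integrand"
    by (rule lebesgue_on_zero_outside(1)[OF energy_integrand_meas cyl_sets(2)]) (simp add: energy_integrand_def G_zero)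
  finally show ?thesis .
qed

text \<open>
  What remains of the two integrands after the pointwise estimates, apart from the equation itself and
  the errors of order \<open>\<epsilon>\<close>. These remainders are not small pointwise; their integrals are, since a
  translation in time moves the shift from \<open>\<rho>\<close> and \<open>k'\<close> to \<open>\<alpha>\<close>.
\<close>

definition time_gap :: "'a \<times> real \<Rightarrow> real" where
  "time_gap z = - (m / (m + 1)) * (d\<alpha> (snd z) * \<rho> z + (\<alpha> (snd z) * \<rho> z - \<alpha> (snd z) * \<rho> (earlier z)) / h)"

definition energy_gap :: "'a \<times> real \<Rightarrow> real" where
  "energy_gap z = (\<alpha> (snd z) * avg k' z - \<alpha> (snd z) * k z) / 2"

lemma excess: "0 \<le> SZ z - Z z + \<epsilon>" "SZ z - Z z + \<epsilon> \<le> 2 * \<epsilon>"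
  using SZ_near[of z] by (auto simp: abs_le_iff)

text \<open>
  The terms with \<open>\<alpha>'\<close> carry \<open>u\<^sup>m\<^sup>+\<^sup>1\<close> with the factor \<open>1/(m+1) - 1 = - m/(m+1)\<close>, which matches the factor in
  the convexity inequality for the time difference of \<open>u\<^sup>m\<close>. The terms with \<open>\<phi>\<close> simplify because \<open>\<alpha>'\<close>
  vanishes and \<open>\<eta> \<alpha> = 1\<close> where \<open>\<phi>\<close> or its derivatives do not vanish.
\<close>

lemma time_integrand_le: "time_integrand z \<le> time_gap z + \<epsilon> * time_error z - s * (ut z * deriv_t \<phi> z)"
proof (cases "fst z \<in> K\<eta> \<and> snd z \<in> K\<alpha>")
  case False
  have off: "z \<notin> K\<phi>" using False K\<phi>_core[of "fst z" "snd z"] by auto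
  have "\<eta> (fst z) = 0 \<or> (\<alpha> (snd z) = 0 \<and> d\<alpha> (snd z) = 0)" using False K\<eta>(1) K\<alpha>(2,3) by (auto simp: d\<alpha>_def)
  moreover have "fst (earlier z) = fst z" by (cases z) (simp add: earlier_simp)
  ultimately have "time_integrand z = 0" "time_gap z = 0" by (auto simp: time_integrand_def time_gap_def \<rho>_def)
  then show ?thesis using time_error_nonneg \<epsilon> \<phi>_zero_off(2)[OF off] by simp
next
  case True
  obtain x t where z: "z = (x, t)" by (cases z)
  have xt: "x \<in> K\<eta>" "t \<in> K\<alpha>" "t \<in> W" "t - h \<in> W" using True z shift[of t h] h K\<alpha>_W by auto
  define a b e where "a = u (x, t)" and "b = u (x, t - h)" and "e = SZ z - Z z + \<epsilon>"
  have ab: "0 \<le> a" "0 \<le> b" 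
    using u_nonneg[OF core_in_cyl[OF xt(1) xt(3)]] u_nonneg[OF core_in_cyl[OF xt(1) xt(4)]] by (auto simp: a_def b_def)
  have vals: "ut z = a" "Z z = a powr m - M" "ut (earlier z) = b" "Z (earlier z) = b powr m - M"
    using core_values[OF xt(1) xt(3)] core_values[OF xt(1) xt(4)] by (auto simp: z earlier_simp a_def b_def)
  have e: "0 \<le> e" "e \<le> 2 * \<epsilon>" using excess by (auto simp: e_def)
  have v_power: "v_power z = a powr m + e + s * \<phi> z" using vals by (simp add: v_power_def e_def)
  define E A D where "E = \<eta> x" and "A = \<alpha> t" and "D = d\<alpha> t"
  have EA: "0 \<le> E" "0 \<le> A" using \<eta> \<alpha> by (auto simp: E_def A_def)
  define c where "c = m / (m + 1)"
  have c: "1 / (m + 1) = 1 - c" using m by (simp add: c_def field_simps)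
  define p q where "p = a powr (m + 1)" and "q = b powr (m + 1)"
  have ap: "a * a powr m = p" using m ab by (cases "a = 0") (auto simp: p_def powr_add)
  have D\<phi>: "D * \<phi> z = 0" using K\<phi>(1,3) z by (cases "z \<in> K\<phi>") (auto simp: D_def d\<alpha>_def)
  have E\<phi>: "E * A * deriv_t \<phi> z = deriv_t \<phi> z" using K\<phi>(3) \<phi>_zero_off(2) z by (cases "z \<in> K\<phi>") (auto simp: E_def A_def)
  have conv: "c * (p - q) \<le> a * (a powr m - b powr m)"
    unfolding c_def p_def q_def by (rule power_m_convexity[OF ab m])
  have "time_integrand z = E * (D * ((1 - c) * p - a * (a powr m + e + s * \<phi> z)) - A * a * ((a powr m - b powr m) / h + s * deriv_t \<phi> z))"
    unfolding time_integrand_def v_power d_def vals c[symmetric] by (simp add: z E_def A_def D_def p_def)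
  also have "\<dots> = - c * (D * (E * p)) - E * D * a * e - E * A * (a * (a powr m - b powr m)) / h
      - E * a * s * (D * \<phi> z) - s * a * (E * A * deriv_t \<phi> z)"
    unfolding ap[symmetric] by (simp add: algebra_simps add_divide_distrib diff_divide_distrib)
  also have "\<dots> = - c * (D * (E * p)) - E * D * a * e - E * A * (a * (a powr m - b powr m)) / h - s * (a * deriv_t \<phi> z)"
    by (simp only: D\<phi> E\<phi> mult_zero_right diff_zero)
  also have "\<dots> \<le> - c * (D * (E * p)) + \<epsilon> * (2 * (E * \<bar>D\<bar> * a)) - E * A * (c * (p - q)) / h - s * (a * deriv_t \<phi> z)"
  proof -
    have "- (E * D * a * e) \<le> \<bar>E * D * a * e\<bar>" by linarith
    also have "\<bar>E * D * a * e\<bar> = E * \<bar>D\<bar> * a * e" using EA ab e by (simp add: abs_mult)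
    also have "\<dots> \<le> E * \<bar>D\<bar> * a * (2 * \<epsilon>)" using EA ab e by (intro mult_left_mono) auto
    finally have 1: "- (E * D * a * e) \<le> \<epsilon> * (2 * (E * \<bar>D\<bar> * a))" by (simp add: mult_ac)
    have 2: "E * A * (c * (p - q)) / h \<le> E * A * (a * (a powr m - b powr m)) / h"
      using EA h conv by (intro divide_right_mono mult_left_mono) auto
    show ?thesis using 1 2 by linarith
  qed
  also have "\<dots> = time_gap z + \<epsilon> * time_error z - s * (ut z * deriv_t \<phi> z)"
    unfolding time_gap_def time_error_def \<rho>_def vals c_def[symmetric] p_def[symmetric] q_def[symmetric]
    by (simp add: z earlier_simp E_def A_def D_def algebra_simps diff_divide_distrib)
  finally show ?thesis .
qed

text \<open>
  The mixed product of \<open>G\<close> and its average is split symmetrically by Young's inequality. The factor \<open>\<eta>\<close>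
  can be moved under the average, since it does not depend on time.
\<close>

lemma AE_energy_integrand_le: "AE z in lborel. energy_integrand z \<le> energy_gap z + \<epsilon> * energy_error z + s * (G z \<bullet> grad_x \<phi> z)"
  using stek.AE_norm_average_along_square_le[OF GZ_borel GZ_square_int, of "(0, 1)"]
proof eventually_elim
  case (elim z)
  show ?case
  proof (cases "fst z \<in> K\<eta> \<and> snd z \<in> K\<alpha>")
    case False
    have off: "z \<notin> K\<phi>" using False K\<phi>_core[of "fst z" "snd z"] by auto
    have *: "\<eta> (fst z) = 0 \<and> gradient \<eta> (fst z) = 0 \<or> \<alpha> (snd z) = 0" using False K\<eta>(1,2) K\<alpha>(2) by auto
    moreover have "avg k' z = 0" if "\<eta> (fst z) = 0"
      using that by (simp add: average_along_def k'_def)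
    ultimately have "energy_integrand z = 0" "energy_gap z = 0" by (auto simp: energy_integrand_def energy_gap_def k_def)
    then show ?thesis using energy_error_nonneg \<epsilon> \<phi>_zero_off(1)[OF off] by simp
  next
    case True
    obtain x t where z: "z = (x, t)" by (cases z)
    define e where "e = SZ z - Z z + \<epsilon>"
    have e: "0 \<le> e" "e \<le> 2 * \<epsilon>" using excess by (auto simp: e_def)
    define E A N where "E = \<eta> x" and "A = \<alpha> t" and "N = gradient \<eta> x"
    have EA: "0 \<le> E" "0 \<le> A" using \<eta> \<alpha> by (auto simp: E_def A_def)
    have N\<phi>: "\<phi> z *\<^sub>R N = 0" using K\<phi>(1,3) z by (cases "z \<in> K\<phi>") (auto simp: N_def)
    have E\<phi>: "(E * A) *\<^sub>R grad_x \<phi> z = grad_x \<phi> z"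
      using K\<phi>(3) \<phi>_zero_off(1) z by (cases "z \<in> K\<phi>") (auto simp: E_def A_def)
    have "(v_power z - M - Z z) *\<^sub>R N = e *\<^sub>R N + s *\<^sub>R (\<phi> z *\<^sub>R N)"
      by (simp add: v_power_def e_def scaleR_left_distrib[symmetric])
    then have fMZ: "(v_power z - M - Z z) *\<^sub>R N = e *\<^sub>R N" by (simp only: N\<phi> scaleR_zero_right add_0_right)
    have "energy_integrand z = A * (G z \<bullet> (E *\<^sub>R (v_power_grad z - G z) + (v_power z - M - Z z) *\<^sub>R N))"
      by (simp add: energy_integrand_def z E_def A_def N_def)
    also have "\<dots> = A * (G z \<bullet> (E *\<^sub>R (v_power_grad z - G z) + e *\<^sub>R N))" by (simp only: fMZ)
    also have "\<dots> = A * (E * (G z \<bullet> SGZ z) - E * (norm (G z))\<^sup>2) + s * (G z \<bullet> ((E * A) *\<^sub>R grad_x \<phi> z)) + A * (e * (G z \<bullet> N))"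
      by (simp add: v_power_grad_def inner_add_right inner_diff_right power2_norm_eq_inner algebra_simps)
    also have "\<dots> = A * (E * (G z \<bullet> SGZ z) - E * (norm (G z))\<^sup>2) + s * (G z \<bullet> grad_x \<phi> z) + A * (e * (G z \<bullet> N))"
      by (simp only: E\<phi>)
    also have "\<dots> \<le> energy_gap z + s * (G z \<bullet> grad_x \<phi> z) + \<epsilon> * energy_error z"
    proof -
      have "G z \<bullet> SGZ z \<le> norm (G z) * norm (SGZ z)" by (rule norm_cauchy_schwarz)
      moreover have "2 * (norm (G z) * norm (SGZ z)) \<le> (norm (G z))\<^sup>2 + (norm (SGZ z))\<^sup>2"
        using sum_squares_bound[of "norm (G z)" "norm (SGZ z)"] by (simp add: mult.assoc)
      moreover have "(norm (SGZ z))\<^sup>2 \<le> avg (\<lambda>z. (norm (GZ z))\<^sup>2) z"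
        using elim by (simp add: SGZ_def)
      ultimately have "G z \<bullet> SGZ z - (norm (G z))\<^sup>2 \<le>
          (avg (\<lambda>z. (norm (GZ z))\<^sup>2) z - (norm (G z))\<^sup>2) / 2" by (simp add: field_simps)
      then have "(A * E) * (G z \<bullet> SGZ z - (norm (G z))\<^sup>2) \<le>
          (A * E) * ((avg (\<lambda>z. (norm (GZ z))\<^sup>2) z - (norm (G z))\<^sup>2) / 2)"
        using EA by (intro mult_left_mono) auto
      also have "\<dots> = energy_gap z"
        by (simp add: energy_gap_def average_along_def k'_def k_def z E_def A_def right_diff_distrib mult.assoc)
      finally have 1: "(A * E) * (G z \<bullet> SGZ z - (norm (G z))\<^sup>2) \<le> energy_gap z" .
      have "e * (G z \<bullet> N) \<le> e * (norm (G z) * norm N)"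
        using e norm_cauchy_schwarz by (intro mult_left_mono) auto
      also have "\<dots> \<le> (2 * \<epsilon>) * (norm (G z) * norm N)" using e by (intro mult_right_mono) auto
      finally have "A * (e * (G z \<bullet> N)) \<le> A * ((2 * \<epsilon>) * (norm (G z) * norm N))"
        using EA by (intro mult_left_mono) auto
      also have "\<dots> = \<epsilon> * energy_error z" by (simp add: energy_error_def z A_def N_def)
      finally show ?thesis using 1 by (simp add: algebra_simps)
    qed
    finally show ?thesis by simp
  qed
qed

text \<open>
  After the shift, \<open>\<rho>\<close> is multiplied by the difference between \<open>\<alpha>'\<close> and a difference quotient of \<open>\<alpha>\<close>.
\<close>

lemma time_gap_int: "integrable lborel time_gap" and time_gap_le: "integral\<^sup>L lborel time_gap \<le> \<epsilon> * integral\<^sup>L lborel \<rho>"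
proof -
  have i1: "integrable lborel (\<lambda>z. d\<alpha> (snd z) * \<rho> z)" "integrable lborel (\<lambda>z. \<alpha> (snd z) * \<rho> z)"
    "integrable lborel (\<lambda>z. \<alpha> (snd z + h) * \<rho> z)"
    by (rule integrable_if_vanishes_with_ut;
      auto simp: \<rho>_def[symmetric] intro!: continuous_intros cont_d\<alpha> cont_\<alpha> \<rho>_cont
        continuous_on_compose2[OF Cinf_c_facts(2)[OF \<alpha>(1)]]; simp add: \<rho>_def)+
  have eq: "(\<lambda>z. \<alpha> (snd z) * \<rho> (earlier z)) = (\<lambda>z. (\<lambda>z. \<alpha> (snd z + h) * \<rho> z) (- (h *\<^sub>R (0, 1)) + z))"
    by (auto simp: earlier_simp fun_eq_iff)
  have i2: "integrable lborel (\<lambda>z. \<alpha> (snd z) * \<rho> (earlier z))"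
    unfolding eq by (rule lborel_integrable_translation[OF i1(3)])
  have "(LBINT z. \<alpha> (snd z) * \<rho> (earlier z)) = (LBINT z. \<alpha> (snd z + h) * \<rho> z)"
    unfolding eq by (rule lborel_integral_translation) (use i1(3) in auto)
  note e = this
  show "integrable lborel time_gap" unfolding time_gap_def[abs_def] using i1 i2 by simp
  have Q: "(\<lambda>z. ((\<alpha> (snd z + h) - \<alpha> (snd z)) / h - d\<alpha> (snd z)) * \<rho> z) =
      (\<lambda>z. (\<alpha> (snd z + h) * \<rho> z - \<alpha> (snd z) * \<rho> z) / h - d\<alpha> (snd z) * \<rho> z)"
    by (auto simp: fun_eq_iff left_diff_distrib diff_divide_distrib)
  have "integral\<^sup>L lborel time_gap = - (m / (m + 1)) * ((LBINT z. d\<alpha> (snd z) * \<rho> z) +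
      ((LBINT z. \<alpha> (snd z) * \<rho> z) - (LBINT z. \<alpha> (snd z + h) * \<rho> z)) / h)"
    unfolding time_gap_def[abs_def] using i1 i2 e by simp
  also have "\<dots> = (m / (m + 1)) * (LBINT z. ((\<alpha> (snd z + h) - \<alpha> (snd z)) / h - d\<alpha> (snd z)) * \<rho> z)"
  proof -
    have X: "(LBINT z. ((\<alpha> (snd z + h) - \<alpha> (snd z)) / h - d\<alpha> (snd z)) * \<rho> z) =
      ((LBINT z. \<alpha> (snd z + h) * \<rho> z) - (LBINT z. \<alpha> (snd z) * \<rho> z)) / h - (LBINT z. d\<alpha> (snd z) * \<rho> z)"
      unfolding Q using i1 by simp
    show ?thesis unfolding X by (simp add: right_diff_distrib distrib_left diff_divide_distrib)
  qed
  also have "\<dots> \<le> (m / (m + 1)) * (LBINT z. \<epsilon> * \<rho> z)"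
  proof (rule mult_left_mono[OF integral_mono])
    show "integrable lborel (\<lambda>z. ((\<alpha> (snd z + h) - \<alpha> (snd z)) / h - d\<alpha> (snd z)) * \<rho> z)"
      unfolding Q using i1 by simp
    show "((\<alpha> (snd z + h) - \<alpha> (snd z)) / h - d\<alpha> (snd z)) * \<rho> z \<le> \<epsilon> * \<rho> z" for z
      using \<alpha>_quotient[of "snd z"] \<rho>_nonneg[of z] by (intro mult_right_mono) auto
  qed (use \<rho>_int m in auto)
  also have "\<dots> \<le> 1 * (LBINT z. \<epsilon> * \<rho> z)"
    using m \<epsilon> \<rho>_nonneg by (intro mult_right_mono Bochner_Integration.integral_nonneg) auto
  finally show "integral\<^sup>L lborel time_gap \<le> \<epsilon> * integral\<^sup>L lborel \<rho>" by simp
qed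

text \<open>
  After the shift, \<open>k'\<close> is multiplied by a forward average of \<open>\<alpha>\<close>, which exceeds \<open>\<alpha>\<close> by at most \<open>\<epsilon>\<close>.
\<close>

lemma energy_gap_int: "integrable lborel energy_gap" and energy_gap_le: "integral\<^sup>L lborel energy_gap \<le> \<epsilon> * (integral\<^sup>L lborel k / 2)"
proof -
  obtain B where B: "\<And>t. \<bar>\<alpha> t\<bar> \<le> B" by (rule \<alpha>_bounded) blast
  have \<alpha>m: "(\<lambda>z::'a \<times> real. \<alpha> (snd z)) \<in> borel_measurable borel"
    by (rule borel_measurable_continuous_onI[OF cont_\<alpha>])
  have \<alpha>b: "\<And>z::'a \<times> real. \<bar>\<alpha> (snd z)\<bar> \<le> B" using B by blast
  have i1: "integrable lborel (\<lambda>z. \<alpha> (snd z) * avg k' z)"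
    by (rule stek.average_along_integrable[OF k'_int \<alpha>m \<alpha>b])
  have i2: "integrable lborel (\<lambda>z. \<alpha> (snd z) * k z)"
    by (rule integrable_bounded_times[OF k_int _ \<alpha>b]) (use \<alpha>m in simp)
  show "integrable lborel energy_gap" unfolding energy_gap_def[abs_def] using i1 i2 by simp
  have avg: "(\<integral>r. \<alpha> (snd (z + r *\<^sub>R (0, 1))) \<partial>steklov h) \<le> \<alpha> (snd z) + \<epsilon>" for z :: "'a \<times> real"
  proof -
    have c: "continuous_on UNIV (\<lambda>r. \<alpha> (snd (z + r *\<^sub>R (0, 1))))"
      by (intro continuous_on_compose2[OF Cinf_c_facts(2)[OF \<alpha>(1)]] continuous_intros) auto
    have i: "integrable (steklov h) (\<lambda>r. \<alpha> (snd (z + r *\<^sub>R (0, 1))))"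
      by (rule stek.integrable_const_bound[where B=B])
        (use B borel_measurable_continuous_onI[OF c] in auto)
    have "AE r in steklov h. \<alpha> (snd (z + r *\<^sub>R (0, 1))) \<le> \<alpha> (snd z) + \<epsilon>"
    proof (rule AE_steklov)
      fix r assume "0 \<le> r" "r \<le> h"
      from \<alpha>_near[OF this, of "snd z"] show "\<alpha> (snd (z + r *\<^sub>R (0, 1))) \<le> \<alpha> (snd z) + \<epsilon>" by simp
    qed
    then have "(\<integral>r. \<alpha> (snd (z + r *\<^sub>R (0, 1))) \<partial>steklov h) \<le> (\<integral>r. \<alpha> (snd z) + \<epsilon> \<partial>steklov h)"
      by (intro integral_mono_AE i) auto
    then show ?thesis using stek.prob_space by simp
  qed
  have "(LBINT z. \<alpha> (snd z) * avg k' z) =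
      (LBINT z. (\<integral>r. \<alpha> (snd (z + r *\<^sub>R (0, 1))) \<partial>steklov h) * k' z)"
    by (rule stek.integral_average_along_swap(1)[OF k'_int \<alpha>m \<alpha>b])
  also have "\<dots> \<le> (LBINT z. \<alpha> (snd z) * k z + \<epsilon> * k z)"
  proof (rule integral_mono)
    show "integrable lborel (\<lambda>z. (\<integral>r. \<alpha> (snd (z + r *\<^sub>R (0, 1))) \<partial>steklov h) * k' z)"
      by (rule stek.integral_average_along_swap(2)[OF k'_int \<alpha>m \<alpha>b])
    show "integrable lborel (\<lambda>z. \<alpha> (snd z) * k z + \<epsilon> * k z)" using i2 k_int by simp
    fix z :: "'a \<times> real"
    have "(\<integral>r. \<alpha> (snd (z + r *\<^sub>R (0, 1))) \<partial>steklov h) * k' z \<le> (\<alpha> (snd z) + \<epsilon>) * k' z"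
      using avg k'_nonneg by (intro mult_right_mono) auto
    also have "\<dots> \<le> (\<alpha> (snd z) + \<epsilon>) * k z"
      using \<alpha>(2)[of "snd z"] \<epsilon> k'_le_k by (intro mult_left_mono) auto
    finally show "(\<integral>r. \<alpha> (snd (z + r *\<^sub>R (0, 1))) \<partial>steklov h) * k' z \<le> \<alpha> (snd z) * k z + \<epsilon> * k z"
      by (simp add: distrib_right)
  qed
  also have "\<dots> = (LBINT z. \<alpha> (snd z) * k z) + \<epsilon> * integral\<^sup>L lborel k" using i2 k_int by simp
  finally show "integral\<^sup>L lborel energy_gap \<le> \<epsilon> * (integral\<^sup>L lborel k / 2)"
    unfolding energy_gap_def[abs_def] using i1 i2 by simp
qed

lemma estimate: "0 \<le> s * integral\<^sup>L lborel equation_integrand + \<epsilon> * error_bound"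
proof -
  have equation_integrand: "integral\<^sup>L lborel equation_integrand = (LBINT z. G z \<bullet> grad_x \<phi> z) - (LBINT z. ut z * deriv_t \<phi> z)"
    unfolding equation_integrand_def[abs_def] using equation_integrand_int by simp
  have "integral\<^sup>L lborel time_integrand \<le> (LBINT z. time_gap z + \<epsilon> * time_error z - s * (ut z * deriv_t \<phi> z))"
    using time_integrand_int time_gap_int time_error_int equation_integrand_int time_integrand_le by (intro integral_mono) auto
  also have "\<dots> = integral\<^sup>L lborel time_gap + \<epsilon> * integral\<^sup>L lborel time_error - s * (LBINT z. ut z * deriv_t \<phi> z)"
    using time_gap_int time_error_int equation_integrand_int by simp
  finally have 1: "integral\<^sup>L lborel time_integrand \<le> \<dots>" .
  have "integral\<^sup>L lborel energy_integrand \<le> (LBINT z. energy_gap z + \<epsilon> * energy_error z + s * (G z \<bullet> grad_x \<phi> z))"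
    using energy_integrand_int energy_gap_int energy_error_int equation_integrand_int AE_energy_integrand_le by (intro integral_mono_AE) auto
  also have "\<dots> = integral\<^sup>L lborel energy_gap + \<epsilon> * integral\<^sup>L lborel energy_error + s * (LBINT z. G z \<bullet> grad_x \<phi> z)"
    using energy_gap_int energy_error_int equation_integrand_int by simp
  finally have 2: "integral\<^sup>L lborel energy_integrand \<le> \<dots>" .
  have sJ: "s * integral\<^sup>L lborel equation_integrand = s * (LBINT z. G z \<bullet> grad_x \<phi> z) - s * (LBINT z. ut z * deriv_t \<phi> z)"
    unfolding equation_integrand by (rule right_diff_distrib)
  have "\<epsilon> * error_bound = \<epsilon> * integral\<^sup>L lborel time_error + \<epsilon> * integral\<^sup>L lborel \<rho> + \<epsilon> * (integral\<^sup>L lborel k / 2) + \<epsilon> * integral\<^sup>L lborel energy_error"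
    unfolding error_bound_def by (simp only: distrib_left)
  then show ?thesis using tested 1 2 time_gap_le energy_gap_le sJ by linarith
qed

end


section \<open>The equation off the contact set\<close>

lemma (in obstacle_test) first_variation_nonneg: "0 \<le> s * integral\<^sup>L lborel equation_integrand"
proof -
  have est: "0 \<le> s * integral\<^sup>L lborel equation_integrand + \<epsilon> * error_bound" if \<epsilon>: "0 < \<epsilon>" for \<epsilon>
  proof -
    obtain h1 where h1: "0 < h1" "\<And>t r. t \<in> K\<alpha> \<Longrightarrow> \<bar>r\<bar> \<le> h1 \<Longrightarrow> t - r \<in> W"
      using compact_shift_in_open[OF K\<alpha>(1) W(1,2)] by blast
    obtain h2 where h2: "0 < h2" "\<And>z z'. dist z' z < h2 \<Longrightarrow> dist (Z z') (Z z) < \<epsilon>"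
      using Z_unif[unfolded uniformly_continuous_on_def, rule_format, OF \<epsilon>] by auto
    have "uniformly_continuous_on UNIV \<alpha>"
      by (rule uniformly_continuous_if_compact_support[OF Cinf_c_facts(2)[OF \<alpha>(1)] K\<alpha>(1,2)])
    from this[unfolded uniformly_continuous_on_def, rule_format, OF \<epsilon>]
    obtain h3 where h3: "0 < h3" "\<And>t t'. dist t' t < h3 \<Longrightarrow> dist (\<alpha> t') (\<alpha> t) < \<epsilon>" by auto
    have "uniformly_continuous_on UNIV d\<alpha>"
      by (rule uniformly_continuous_if_compact_support[OF _ K\<alpha>(1)])
        (use Cinf_c_facts(4)[OF \<alpha>(1), of 1] K\<alpha>(3) in \<open>auto simp: d\<alpha>_def[abs_def]\<close>)
    from this[unfolded uniformly_continuous_on_def, rule_format, OF \<epsilon>]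
    obtain h4 where h4: "0 < h4" "\<And>t t'. dist t' t < h4 \<Longrightarrow> dist (d\<alpha> t') (d\<alpha> t) < \<epsilon>" by auto
    define h where "h = Min {h1, h2, h3, h4} / 2"
    have "0 < Min {h1, h2, h3, h4}" using h1(1) h2(1) h3(1) h4(1) by simp
    moreover have "Min {h1, h2, h3, h4} \<le> h1" "Min {h1, h2, h3, h4} \<le> h2"
      "Min {h1, h2, h3, h4} \<le> h3" "Min {h1, h2, h3, h4} \<le> h4" by simp_all
    ultimately have h: "0 < h" "h \<le> h1" "h < h2" "h < h3" "h < h4" unfolding h_def by linarith+
    have near: "\<bar>\<alpha> (t + r) - \<alpha> t\<bar> \<le> \<epsilon>" "\<bar>d\<alpha> (t + r) - d\<alpha> t\<bar> \<le> \<epsilon>" if "0 \<le> r" "r \<le> h" for t r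
      using h3(2)[of "t + r" t] h4(2)[of "t + r" t] h that by (auto simp: dist_real_def)
    interpret step: obstacle_test_step \<Omega> m T M s \<psi> u G \<eta> \<eta>2 \<alpha> \<beta> \<phi> K\<eta> K\<alpha> W K\<phi> \<epsilon> h
    proof unfold_locales
      show "\<bar>Z (z - r *\<^sub>R (0, 1)) - Z z\<bar> \<le> \<epsilon>" if "0 \<le> r" "r \<le> h" for z r
        using h2(2)[of "z - r *\<^sub>R (0, 1)" z] h that by (auto simp: dist_norm)
      show "\<bar>(\<alpha> (t + h) - \<alpha> t) / h - d\<alpha> t\<bar> \<le> \<epsilon>" for t
        by (rule difference_quotient_near[OF \<alpha>_deriv h(1) near(2)])
    qed (use \<epsilon> h h1(2) near(1) in auto)
    show ?thesis by (rule step.estimate)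
  qed
  have "0 \<le> error_bound"
    unfolding error_bound_def using \<rho>_nonneg k_nonneg time_error_nonneg energy_error_nonneg
    by (intro add_nonneg_nonneg divide_nonneg_nonneg Bochner_Integration.integral_nonneg) auto
  show ?thesis
  proof (rule ccontr)
    assume neg: "\<not> 0 \<le> s * integral\<^sup>L lborel equation_integrand"
    \<comment> \<open>This \<open>\<epsilon>\<close> makes \<open>\<epsilon> * error_bound\<close> at most half of the negative quantity in absolute value.\<close>
    define \<epsilon> where "\<epsilon> = - (s * integral\<^sup>L lborel equation_integrand) / (2 * (error_bound + 1))"
    have "0 < \<epsilon>" using neg \<open>0 \<le> error_bound\<close> unfolding \<epsilon>_def by (intro divide_pos_pos) auto
    have "\<epsilon> * error_bound \<le> \<epsilon> * (error_bound + 1)" using \<open>0 < \<epsilon>\<close> by simp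
    also have "\<dots> = - (s * integral\<^sup>L lborel equation_integrand) / 2" using \<open>0 \<le> error_bound\<close> by (simp add: \<epsilon>_def field_simps)
    finally show False using est[OF \<open>0 < \<epsilon>\<close>] neg by linarith
  qed
qed

lemma open_noncontact_set:
  fixes u \<psi> :: "'a::topological_space \<Rightarrow> real"
  assumes "open S" "continuous_on S u" "continuous_on S \<psi>"
  shows "open {z \<in> S. u z > \<psi> z}"
proof -
  have "open (S \<inter> (\<lambda>z. u z - \<psi> z) -` {0<..})"
    by (intro continuous_open_preimage continuous_on_diff assms open_greaterThan)
  moreover have "S \<inter> (\<lambda>z. u z - \<psi> z) -` {0<..} = {z \<in> S. u z > \<psi> z}" by auto
  ultimately show ?thesis by simp
qed

text \<open>
  The cutoffs are chosen from the support \<open>K\<close> of \<open>\<phi>\<close> outwards, and \<open>s\<close> from the positive minimum \<open>c\<close> of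
  \<open>u\<^sup>m - \<psi>\<^sup>m\<close> on \<open>K\<close>. Then \<open>first_variation_nonneg\<close> applies to \<open>s\<close> and to \<open>-s\<close>.
\<close>

lemma weak_equation_on_noncontact_set:
  fixes \<Omega> :: "'a::euclidean_space set"
  assumes m: "0 < m" and \<Omega>: "open \<Omega>" "bounded \<Omega>" and T: "0 < T"
    and \<psi>_cont: "continuous_on (closure (cyl \<Omega> T)) \<psi>" and \<psi>_nonneg: "\<And>z. z \<in> closure (cyl \<Omega> T) \<Longrightarrow> 0 \<le> \<psi> z"
    and u_cont: "continuous_on (cyl \<Omega> T) u" and \<psi>_le_u: "\<And>z. z \<in> cyl \<Omega> T \<Longrightarrow> \<psi> z \<le> u z"
    and sol: "obstacle_local_weak_solution m \<Omega> T \<psi> u"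
    and G: "G \<in> borel_measurable borel" "L2H1_grad 0 T \<Omega> (\<lambda>z. u z powr m) G" "\<And>z. z \<notin> cyl \<Omega> T \<Longrightarrow> G z = 0"
    and \<phi>: "\<phi> \<in> Cinf_c {z \<in> cyl \<Omega> T. u z > \<psi> z}" (is "\<phi> \<in> Cinf_c ?U")
  shows "integral\<^sup>L (lebesgue_on ?U) (\<lambda>z. - u z * deriv_t \<phi> z + G z \<bullet> grad_x \<phi> z) = 0"
proof -
  have cl: "cyl \<Omega> T \<subseteq> closure (cyl \<Omega> T)" by (rule closure_subset)
  have oc: "open (cyl \<Omega> T)" using \<Omega> by (intro open_Times) auto
  have "compact (closure (cyl \<Omega> T))" using \<Omega> by (auto intro!: bounded_Times)
  then have "compact (\<psi> ` closure (cyl \<Omega> T))" by (rule compact_continuous_image[OF \<psi>_cont])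
  then obtain L where L: "\<And>z. z \<in> closure (cyl \<Omega> T) \<Longrightarrow> \<psi> z \<le> L"
    by (auto simp: bounded_iff dest!: compact_imp_bounded) (metis abs_le_D1)
  define M where "M = \<bar>L\<bar> powr m"
  have M: "\<psi> z powr m \<le> M" if "z \<in> cyl \<Omega> T" for z
    unfolding M_def using that cl m L[of z] \<psi>_nonneg[of z] by (intro powr_mono2) auto
  obtain K where K: "compact K" "K \<subseteq> ?U" "\<And>z. z \<notin> K \<Longrightarrow> \<phi> z = 0"
    "\<And>z e. z \<notin> K \<Longrightarrow> frechet_derivative \<phi> (at z) e = 0"
    by (rule Cinf_c_support[OF \<phi>]) blast
  have \<phi>': "\<phi> \<in> Cinf_c (cyl \<Omega> T)" by (rule Cinf_c_mono[OF \<phi>]) auto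
  have K1: "compact (fst ` K)" "compact (snd ` K)" "fst ` K \<subseteq> \<Omega>" "snd ` K \<subseteq> {0<..<T}"
    using K(1,2) by (auto intro!: compact_continuous_image continuous_intros)
  obtain \<eta> V1 where \<eta>: "\<eta> \<in> Cinf_c \<Omega>" "\<And>x. 0 \<le> \<eta> x" "\<And>x. \<eta> x \<le> 1"
    "open V1" "fst ` K \<subseteq> V1" "\<And>x. x \<in> V1 \<Longrightarrow> \<eta> x = 1"
    by (rule smooth_cutoff[OF K1(1) \<Omega>(1) K1(3)]) blast
  obtain \<alpha> V2 where \<alpha>: "\<alpha> \<in> Cinf_c {0<..<T}" "\<And>x. 0 \<le> \<alpha> x" "\<And>x. \<alpha> x \<le> 1"
    "open V2" "snd ` K \<subseteq> V2" "\<And>x. x \<in> V2 \<Longrightarrow> \<alpha> x = 1"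
    by (rule smooth_cutoff[OF K1(2) open_greaterThanLessThan K1(4)]) blast
  obtain K\<eta> where K\<eta>: "compact K\<eta>" "K\<eta> \<subseteq> \<Omega>" "\<And>x. x \<notin> K\<eta> \<Longrightarrow> \<eta> x = 0"
    "\<And>x e. x \<notin> K\<eta> \<Longrightarrow> frechet_derivative \<eta> (at x) e = 0"
    by (rule Cinf_c_support[OF \<eta>(1)]) blast
  obtain K\<alpha> where K\<alpha>: "compact K\<alpha>" "K\<alpha> \<subseteq> {0<..<T}" "\<And>x. x \<notin> K\<alpha> \<Longrightarrow> \<alpha> x = 0"
    "\<And>x e. x \<notin> K\<alpha> \<Longrightarrow> frechet_derivative \<alpha> (at x) e = 0"
    by (rule Cinf_c_support[OF \<alpha>(1)]) blast
  obtain \<eta>2 V3 where \<eta>2: "\<eta>2 \<in> Cinf_c \<Omega>" "\<And>x. 0 \<le> \<eta>2 x" "\<And>x. \<eta>2 x \<le> 1"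
    "open V3" "K\<eta> \<subseteq> V3" "\<And>x. x \<in> V3 \<Longrightarrow> \<eta>2 x = 1"
    by (rule smooth_cutoff[OF K\<eta>(1) \<Omega>(1) K\<eta>(2)]) blast
  obtain \<beta> V4 where \<beta>: "\<beta> \<in> Cinf_c {0<..<T}" "\<And>x. 0 \<le> \<beta> x" "\<And>x. \<beta> x \<le> 1"
    "open V4" "K\<alpha> \<subseteq> V4" "\<And>x. x \<in> V4 \<Longrightarrow> \<beta> x = 1"
    by (rule smooth_cutoff[OF K\<alpha>(1) open_greaterThanLessThan K\<alpha>(2)]) blast
  have core: "\<eta> x = 1 \<and> gradient \<eta> x = 0 \<and> \<alpha> t = 1 \<and> frechet_derivative \<alpha> (at t) 1 = 0" if "(x, t) \<in> K" for x t
  proof -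
    have x: "x \<in> V1" and t: "t \<in> V2" using that \<eta>(5) \<alpha>(5) by force+
    show ?thesis
      using \<eta>(6)[OF x] \<alpha>(6)[OF t] gradient_zero_where_constant[OF \<eta>(4) x \<eta>(6)]
        frechet_derivative_zero_where_constant[OF \<alpha>(4) t \<alpha>(6)] by simp
  qed
  have \<eta>2_core: "\<eta>2 x = 1" "gradient \<eta>2 x = 0" if "x \<in> K\<eta>" for x
    using \<eta>2(5,6) gradient_zero_where_constant[OF \<eta>2(4) _ \<eta>2(6)] that by auto
  obtain c where c: "0 < c" "\<And>z. z \<in> K \<Longrightarrow> \<psi> z powr m + c \<le> u z powr m"
  proof (cases "K = {}")
    case False
    have sub: "K \<subseteq> cyl \<Omega> T" using K(2) by auto
    have cont: "continuous_on K (\<lambda>z. u z powr m - \<psi> z powr m)"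
    proof (intro continuous_on_diff continuous_on_powr' continuous_on_const)
      show "continuous_on K u" "continuous_on K \<psi>"
        using sub cl by (auto intro: continuous_on_subset[OF u_cont] continuous_on_subset[OF \<psi>_cont])
      show "\<forall>z\<in>K. 0 \<le> u z \<and> (u z = 0 \<longrightarrow> 0 < m)" "\<forall>z\<in>K. 0 \<le> \<psi> z \<and> (\<psi> z = 0 \<longrightarrow> 0 < m)"
        using sub cl m \<psi>_nonneg \<psi>_le_u order_trans by blast+
    qed
    obtain z0 where z0: "z0 \<in> K" "\<And>z. z \<in> K \<Longrightarrow> u z0 powr m - \<psi> z0 powr m \<le> u z powr m - \<psi> z powr m"
      using continuous_attains_inf[OF K(1) False cont] by blast
    have "\<psi> z0 powr m < u z0 powr m"
      using z0(1) K(2) \<psi>_nonneg[OF subsetD[OF cl subsetD[OF sub z0(1)]]] m by (intro powr_less_mono2) auto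
    with z0 show thesis by (intro that[of "u z0 powr m - \<psi> z0 powr m"]) (auto simp: algebra_simps)
  qed (use that[of 1] in auto)
  obtain B where B: "\<And>z. norm (\<phi> z) \<le> B"
    using bounded_if_continuous_compact_support[OF Cinf_c_facts(2)[OF \<phi>] K(1,3)] by blast
  \<comment> \<open>With this choice \<open>|s \<phi>| \<le> c\<close>; the summand \<open>1\<close> keeps the denominator positive.\<close>
  define s where "s = c / (\<bar>B\<bar> + 1)"
  have s: "0 < s" using c(1) by (simp add: s_def add_nonneg_pos)
  have s\<phi>: "\<bar>s * \<phi> z\<bar> \<le> c" for z
  proof -
    have "\<bar>\<phi> z\<bar> \<le> \<bar>B\<bar> + 1" using B[of z] by simp
    then have "s * \<bar>\<phi> z\<bar> \<le> s * (\<bar>B\<bar> + 1)" using s by (intro mult_left_mono) auto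
    also have "\<dots> = c" by (simp add: s_def field_simps)
    finally show ?thesis using s by (simp add: abs_mult)
  qed
  have test: "obstacle_test \<Omega> m T M s' \<psi> u G \<eta> \<eta>2 \<alpha> \<beta> \<phi> K\<eta> K\<alpha> V4 K" if "\<bar>s'\<bar> = s" for s'
  proof
    show "\<psi> z powr m \<le> u z powr m + s' * \<phi> z" if "z \<in> K" for z
    proof -
      have "\<bar>s' * \<phi> z\<bar> \<le> c" using s\<phi>[of z] \<open>\<bar>s'\<bar> = s\<close> s by (simp add: abs_mult)
      with c(2)[OF that] show ?thesis by linarith
    qed
    show "gradient \<eta> x = 0" if "x \<notin> K\<eta>" for x using K\<eta>(4)[OF that] by (simp add: gradient_def)
    show "0 \<le> \<psi> z" if "z \<in> cyl \<Omega> T" for z using \<psi>_nonneg that cl by blast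
  qed (fact m \<Omega> T u_cont \<psi>_le_u M G sol \<eta> \<eta>2 \<alpha> \<beta> K\<eta> K\<alpha> \<eta>2_core \<phi>' K core | simp add: M_def)+
  define I where "I = obstacle_test.equation_integrand u G \<eta>2 \<beta> \<phi>"
  have pos: "0 \<le> s' * integral\<^sup>L lborel I" if "\<bar>s'\<bar> = s" for s'
    unfolding I_def by (rule obstacle_test.first_variation_nonneg[OF test[OF that]])
  have "integral\<^sup>L lborel I = 0"
    using pos[of s] pos[of "- s"] s by (simp add: zero_le_mult_iff mult_le_0_iff)
  interpret obstacle_test \<Omega> m T M s \<psi> u G \<eta> \<eta>2 \<alpha> \<beta> \<phi> K\<eta> K\<alpha> V4 K
    by (rule test) (use s in simp)
  have U: "open ?U"
    by (rule open_noncontact_set[OF oc u_cont continuous_on_subset[OF \<psi>_cont cl]])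
  have I_meas: "I \<in> borel_measurable borel"
    unfolding I_def equation_integrand_def[abs_def] using equation_integrand_int[THEN borel_measurable_integrable] by (intro borel_measurable_add) auto
  have eq: "I z = - u z * deriv_t \<phi> z + G z \<bullet> grad_x \<phi> z" for z
  proof (cases "z \<in> K")
    case True
    then show ?thesis
      using core_values(1)[of "fst z" "snd z"] K\<phi>_core[of "fst z" "snd z"] by (simp add: I_def equation_integrand_def)
  next
    case False
    then show ?thesis using \<phi>_zero_off by (simp add: I_def equation_integrand_def)
  qed
  have "integral\<^sup>L (lebesgue_on ?U) I = integral\<^sup>L lborel I"
  proof (rule lebesgue_on_zero_outside(1)[OF I_meas borel_open[OF U]])
    fix z assume "z \<notin> ?U"
    then have "z \<notin> K" using K(2) by blast
    then show "I z = 0" using \<phi>_zero_off by (simp add: eq)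
  qed
  with \<open>integral\<^sup>L lborel I = 0\<close> show ?thesis by (simp add: eq[abs_def])
qed

theorem lemma3p6:
  fixes \<Omega> :: "(real ^ 'n) set" and m T :: real
    and \<psi> u :: "(real ^ 'n) \<times> real \<Rightarrow> real"
  assumes "0 < m" and "m < 1"
    and "open \<Omega>" and "bounded \<Omega>" and "0 < T"
    and "continuous_on (closure (cyl \<Omega> T)) \<psi>"
    and "\<forall>z\<in>closure (cyl \<Omega> T). 0 \<le> \<psi> z"
    and "continuous_on (cyl \<Omega> T) u"
    and "obstacle_local_weak_solution m \<Omega> T \<psi> u"
  shows "PME_weak_solution m {z \<in> cyl \<Omega> T. u z > \<psi> z} u"
proof -
  let ?U = "{z \<in> cyl \<Omega> T. u z > \<psi> z}"
  have cl: "cyl \<Omega> T \<subseteq> closure (cyl \<Omega> T)" by (rule closure_subset)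
  have oc: "open (cyl \<Omega> T)" using assms(3) by (intro open_Times) auto
  have \<psi>c: "continuous_on (cyl \<Omega> T) \<psi>" by (rule continuous_on_subset[OF assms(6) cl])
  have uK: "u \<in> K_psi m \<Omega> T \<psi>" using assms(9) by (simp add: obstacle_local_weak_solution_def)
  have le: "\<psi> z \<le> u z" if "z \<in> cyl \<Omega> T" for z
  proof -
    have "AE z in lebesgue_on (cyl \<Omega> T). 0 \<le> u z - \<psi> z" using uK by (auto simp: K_psi_def)
    from continuous_nonneg_if_AE[OF oc continuous_on_diff[OF assms(8) \<psi>c] this that] show ?thesis by simp
  qed
  have un: "0 \<le> u z" if "z \<in> cyl \<Omega> T" for z using le[OF that] assms(7) cl that by force
  obtain G0 where "L2H1_grad 0 T \<Omega> (\<lambda>z. u z powr m) G0" using uK by (auto simp: K_psi_def)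
  from L2H1_grad_borel_representative[OF this assms(3)]
  obtain G where G: "G \<in> borel_measurable borel" "L2H1_grad 0 T \<Omega> (\<lambda>z. u z powr m) G"
    "\<And>z. z \<notin> cyl \<Omega> T \<Longrightarrow> G z = 0" by blast
  have U: "open ?U" by (rule open_noncontact_set[OF oc assms(8) \<psi>c])
  show ?thesis
    unfolding PME_weak_solution_def
  proof (intro conjI allI impI ballI exI[of _ G])
    show "open ?U" by (rule U)
    show "u \<in> borel_measurable (lebesgue_on ?U)"
      by (rule continuous_imp_measurable_on_sets_lebesgue[OF continuous_on_subset[OF assms(8)] lebesgue_sets_open[OF U]]) auto
    show "0 \<le> u z" if "z \<in> ?U" for z using un that by auto
    show "Lp_on (1 / m) K (\<lambda>z. u z powr m)" if K: "compact K \<and> K \<subseteq> ?U" for K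
    proof -
      have c: "continuous_on K (\<lambda>z. u z powr m)"
        using K un assms(1) by (intro continuous_on_powr' continuous_on_subset[OF assms(8)] continuous_on_const) auto
      then obtain B where B: "\<forall>z\<in>K. norm (u z powr m) \<le> B"
        using compact_imp_bounded[OF compact_continuous_image[OF c]] K by (auto simp: bounded_iff)
      show ?thesis
        by (rule Lp_on_bounded[where B=B])
          (use B K c assms(1) in \<open>auto intro: continuous_imp_measurable_on_sets_lebesgue lebesgue_sets_compact lmeasurable_compact\<close>)
    qed
    show "L2H1_loc_grad ?U (\<lambda>z. u z powr m) G"
      unfolding L2H1_loc_grad_def
    proof (intro allI impI, elim conjE)
      fix \<Omega>' :: "(real ^ 'n) set" and a b :: real
      assume *: "open \<Omega>'" "bounded \<Omega>'" "a < b" "closure \<Omega>' \<times> {a..b} \<subseteq> ?U"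
      show "L2H1_grad a b \<Omega>' (\<lambda>z. u z powr m) G"
      \<comment> \<open>For empty \<open>\<Omega>'\<close> the inclusion does not confine \<open>a\<close> and \<open>b\<close> to \<open>[0,T]\<close>.\<close>
      proof (cases "\<Omega>' = {}")
        case True
        show ?thesis
          by (simp add: True measurable_lebesgue_on_empty L2H1_grad_def H1_grad_def weak_deriv_def L1_loc_def Lp_on_2_iff integral_lebesgue_on_empty)
      next
        case False
        then obtain x where x: "x \<in> \<Omega>'" by blast
        then have "x \<in> closure \<Omega>'" using closure_subset by blast
        then have "(x, a) \<in> closure \<Omega>' \<times> {a..b}" "(x, b) \<in> closure \<Omega>' \<times> {a..b}" using *(3) by auto
        from subsetD[OF *(4) this(1)] subsetD[OF *(4) this(2)]
        have "(x, a) \<in> ?U" "(x, b) \<in> ?U" .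
        then have ab: "0 \<le> a" "b \<le> T" by auto
        have "\<Omega>' \<subseteq> \<Omega>"
        proof
          fix y assume "y \<in> \<Omega>'"
          then have "(y, a) \<in> closure \<Omega>' \<times> {a..b}" using *(3) closure_subset by auto
          from subsetD[OF *(4) this] show "y \<in> \<Omega>" by auto
        qed
        from L2H1_grad_subset[OF G(2) assms(3) *(1) this ab] show ?thesis .
      qed
    qed
    show "integral\<^sup>L (lebesgue_on ?U) (\<lambda>z. - u z * deriv_t \<phi> z + G z \<bullet> grad_x \<phi> z) = 0"
      if "\<phi> \<in> Cinf_c ?U" for \<phi>
      by (rule weak_equation_on_noncontact_set[OF assms(1,3,4,5,6) _ assms(8) le assms(9) G that])
        (use assms(7) in auto)
  qed
qed

end
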